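(* Let $\mathcal H_1$ and $\mathcal H_2$ be infinite dimensional Hilbert spaces and let $1\le p,q\le 2$. Then the Banach algebra $S_p(\mathcal H_1)\otimes^\gamma S_q(\mathcal H_2)$ (the projective tensor product of the Schatten classes, each with composition as multiplication) is not Arens regular.
   Context: Hilbert spaces are complex. For a Hilbert space $\mathcal H$ and $1\le p<\infty$, $S_p(\mathcal H)$ is the set of $T\in B(\mathcal H)$ with $\|T\|_p:=\operatorname{Tr}(|T|^p)^{1/p}<\infty$; it is a Banach algebra under composition with norm $\|\cdot\|_p$. Projective tensor product: for Banach algebras $A,B$, the algebraic tensor product $A\otimes B$ has multiplication determined by $(x_1\otimes y_1)(x_2\otimes y_2)=x_1x_2\otimes y_1y_2$ and norm $\|u\|_\gamma=\inf\{\sum_{i=1}^n\|x_i\|\|y_i\| : u=\sum_{i=1}^n x_i\otimes y_i\}$; its completion is the Banach algebra $A\otimes^\gamma B$. Arens regularity: let $A$ be a normed algebra. For $a\in A$, $\omega\in A^*$, $f\in A^{**}$ define $\omega_a,{}_a\omega\in A^*$ by $\omega_a(b)=\omega(ab)$, ${}_a\omega(b)=\omega(ba)$, and $\omega_f,{}_f\omega\in A^*$ by $\omega_f(a)=f({}_a\omega)$, ${}_f\omega(a)=f(\omega_a)$. For $f,g\in A^{**}$ set $(f\Box g)(\omega)=f({}_g\omega)$ and $(f\diamond g)(\omega)=g(\omega_f)$ for $\omega\in A^*$. $A$ is Arens regular if $f\Box g=f\diamond g$ for all $f,g\in A^{**}$. *)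

theory Defs
  imports "HOL-Analysis.Analysis" "HOL-Library.Poly_Mapping"
begin

section \<open>Complex Hilbert spaces\<close>

class scaleC =
  fixes scaleC :: "complex \<Rightarrow> 'a \<Rightarrow> 'a"  (infixr "*\<^sub>C" 75)

class chilbert_space = banach + scaleC +
  fixes cinner :: "'a \<Rightarrow> 'a \<Rightarrow> complex"
  assumes scaleC_add_right: "c *\<^sub>C (x + y) = c *\<^sub>C x + c *\<^sub>C y"
    and scaleC_add_left: "(c + d) *\<^sub>C x = c *\<^sub>C x + d *\<^sub>C x"
    and scaleC_scaleC: "c *\<^sub>C (d *\<^sub>C x) = (c * d) *\<^sub>C x"
    and scaleC_one: "1 *\<^sub>C x = x"
    and scaleR_scaleC: "r *\<^sub>R x = complex_of_real r *\<^sub>C x"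
    and cinner_commute: "cinner x y = cnj (cinner y x)"
    and cinner_add_right: "cinner x (y + z) = cinner x y + cinner x z"
    and cinner_scaleC_right: "cinner x (c *\<^sub>C y) = c * cinner x y"
    and norm_eq_sqrt_cinner: "norm x = sqrt (Re (cinner x x))"
  \<comment> \<open>The inner product is linear in the second argument. Positive definiteness follows from the
      last axiom and the norm axioms of \<^class>\<open>banach\<close>, which also gives completeness.\<close>

abbreviation cspan :: "'a::chilbert_space set \<Rightarrow> 'a set" where
  "cspan \<equiv> module.span scaleC"

definition infinite_dimensional :: "'a::chilbert_space itself \<Rightarrow> bool" where
  "infinite_dimensional _ \<longleftrightarrow> (\<nexists>B::'a set. finite B \<and> cspan B = UNIV)"

definition orthonormal_basis :: "'a::chilbert_space set \<Rightarrow> bool" where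
  "orthonormal_basis E \<longleftrightarrow>
     (\<forall>e\<in>E. norm e = 1) \<and> (\<forall>e\<in>E. \<forall>e'\<in>E. e \<noteq> e' \<longrightarrow> cinner e e' = 0) \<and>
     closure (cspan E) = UNIV"

section \<open>Bounded operators and Schatten classes\<close>

text \<open>\<open>B(H)\<close> consists of the complex-linear elements of the library type of real-linear bounded
  maps; the norm of that type is the operator norm.\<close>

definition bounded_ops :: "('a::chilbert_space \<Rightarrow>\<^sub>L 'a) set" where
  "bounded_ops = {T. \<forall>c x. blinfun_apply T (c *\<^sub>C x) = c *\<^sub>C blinfun_apply T x}"

definition op_scaleC :: "complex \<Rightarrow> ('a::chilbert_space \<Rightarrow>\<^sub>L 'a) \<Rightarrow> ('a \<Rightarrow>\<^sub>L 'a)" where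
  "op_scaleC c T = Blinfun (\<lambda>x. c *\<^sub>C blinfun_apply T x)"

definition adjoint_op :: "('a::chilbert_space \<Rightarrow>\<^sub>L 'a) \<Rightarrow> ('a \<Rightarrow>\<^sub>L 'a)" where
  "adjoint_op T = (THE S. S \<in> bounded_ops \<and>
     (\<forall>x y. cinner (blinfun_apply S x) y = cinner x (blinfun_apply T y)))"

definition positive_op :: "('a::chilbert_space \<Rightarrow>\<^sub>L 'a) \<Rightarrow> bool" where
  "positive_op S \<longleftrightarrow>
     S \<in> bounded_ops \<and> (\<forall>x. cinner x (blinfun_apply S x) \<in> \<real>\<^sub>\<ge>\<^sub>0)"

definition abs_op :: "('a::chilbert_space \<Rightarrow>\<^sub>L 'a) \<Rightarrow> ('a \<Rightarrow>\<^sub>L 'a)" where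
  "abs_op T = (THE S. positive_op S \<and> S o\<^sub>L S = adjoint_op T o\<^sub>L T)"

definition poly_op :: "real poly \<Rightarrow> ('a::chilbert_space \<Rightarrow>\<^sub>L 'a) \<Rightarrow> ('a \<Rightarrow>\<^sub>L 'a)" where
  "poly_op P S = (\<Sum>i\<le>degree P. coeff P i *\<^sub>R (blinfun_compose S ^^ i) id_blinfun)"

text \<open>Continuous functional calculus \<open>f(S)\<close> of a positive operator \<open>S\<close>: the common norm limit of
  \<open>P\<^sub>n(S)\<close> for polynomials \<open>P\<^sub>n\<close> converging to \<open>f\<close> uniformly on \<open>[0, \<parallel>S\<parallel>]\<close>, an interval containing
  the spectrum of \<open>S\<close>.\<close>

definition fun_op :: "(real \<Rightarrow> real) \<Rightarrow> ('a::chilbert_space \<Rightarrow>\<^sub>L 'a) \<Rightarrow> ('a \<Rightarrow>\<^sub>L 'a)" where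
  "fun_op f S = (THE R. \<forall>P :: nat \<Rightarrow> real poly.
     uniform_limit {0..norm S} (\<lambda>n. poly (P n)) f sequentially \<longrightarrow>
     (\<lambda>n. poly_op (P n) S) \<longlonglongrightarrow> R)"

text \<open>The trace of a positive operator, with values in \<open>[0, \<infinity>]\<close>; the sum does not depend on the
  orthonormal basis.\<close>

definition trace_op :: "('a::chilbert_space \<Rightarrow>\<^sub>L 'a) \<Rightarrow> ennreal" where
  "trace_op R = (\<Sum>\<^sub>\<infinity>e\<in>(SOME E. orthonormal_basis E).
     ennreal (Re (cinner e (blinfun_apply R e))))"

definition schatten_trace :: "real \<Rightarrow> ('a::chilbert_space \<Rightarrow>\<^sub>L 'a) \<Rightarrow> ennreal" where
  "schatten_trace p T = trace_op (fun_op (\<lambda>t. t powr p) (abs_op T))"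

section \<open>Normed spaces and algebras with explicit carriers\<close>

text \<open>The Schatten classes depend on the real parameter \<open>p\<close>, so they cannot be types. The
  operations below are only meaningful on the carrier.\<close>

record 'a nspace =
  carr :: "'a set"
  add :: "'a \<Rightarrow> 'a \<Rightarrow> 'a"
  scl :: "complex \<Rightarrow> 'a \<Rightarrow> 'a"
  nrm :: "'a \<Rightarrow> real"

record 'a nalgebra = "'a nspace" +
  mul :: "'a \<Rightarrow> 'a \<Rightarrow> 'a"

definition schatten :: "real \<Rightarrow> ('h::chilbert_space \<Rightarrow>\<^sub>L 'h) nalgebra" where
  "schatten p =
     \<lparr> carr = {T \<in> bounded_ops. schatten_trace p T < \<infinity>},
       add = (+),
       scl = op_scaleC,
       nrm = (\<lambda>T. enn2real (schatten_trace p T) powr (1 / p)),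
       mul = (o\<^sub>L) \<rparr>"

section \<open>Projective tensor product\<close>

text \<open>The algebraic tensor product is the quotient of the free complex vector space on the product
  of the carriers by the subspace spanned by the bilinearity relations.\<close>

abbreviation gen :: "'a \<Rightarrow> 'b \<Rightarrow> ('a \<times> 'b) \<Rightarrow>\<^sub>0 complex" where
  "gen x y \<equiv> Poly_Mapping.single (x, y) 1"

definition free_scl :: "complex \<Rightarrow> ('c \<Rightarrow>\<^sub>0 complex) \<Rightarrow> ('c \<Rightarrow>\<^sub>0 complex)" where
  "free_scl c u = Poly_Mapping.map ((*) c) u"

definition free_mul ::
  "('a, 'm) nalgebra_scheme \<Rightarrow> ('b, 'n) nalgebra_scheme \<Rightarrow>
   (('a \<times> 'b) \<Rightarrow>\<^sub>0 complex) \<Rightarrow> (('a \<times> 'b) \<Rightarrow>\<^sub>0 complex) \<Rightarrow> (('a \<times> 'b) \<Rightarrow>\<^sub>0 complex)" where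
  "free_mul A B u v = (\<Sum>(x1, y1)\<in>Poly_Mapping.keys u. \<Sum>(x2, y2)\<in>Poly_Mapping.keys v.
     free_scl (Poly_Mapping.lookup u (x1, y1) * Poly_Mapping.lookup v (x2, y2))
       (gen (mul A x1 x2) (mul B y1 y2)))"

definition bilinearity_relations ::
  "('a, 'm) nspace_scheme \<Rightarrow> ('b, 'n) nspace_scheme \<Rightarrow> (('a \<times> 'b) \<Rightarrow>\<^sub>0 complex) set" where
  "bilinearity_relations A B =
     {gen (add A x x') y - gen x y - gen x' y | x x' y. x \<in> carr A \<and> x' \<in> carr A \<and> y \<in> carr B} \<union>
     {gen x (add B y y') - gen x y - gen x y' | x y y'. x \<in> carr A \<and> y \<in> carr B \<and> y' \<in> carr B} \<union>
     {gen (scl A c x) y - free_scl c (gen x y) | c x y. x \<in> carr A \<and> y \<in> carr B} \<union>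
     {gen x (scl B c y) - free_scl c (gen x y) | c x y. x \<in> carr A \<and> y \<in> carr B}"

definition tensor_rel ::
  "('a, 'm) nspace_scheme \<Rightarrow> ('b, 'n) nspace_scheme \<Rightarrow>
   ((('a \<times> 'b) \<Rightarrow>\<^sub>0 complex) \<times> (('a \<times> 'b) \<Rightarrow>\<^sub>0 complex)) set" where
  "tensor_rel A B = {(u, v).
     Poly_Mapping.keys u \<subseteq> carr A \<times> carr B \<and>
     Poly_Mapping.keys v \<subseteq> carr A \<times> carr B \<and>
     u - v \<in> module.span free_scl (bilinearity_relations A B)}"

definition alg_tensor ::
  "('a, 'm) nalgebra_scheme \<Rightarrow> ('b, 'n) nalgebra_scheme \<Rightarrow>
   (('a \<times> 'b) \<Rightarrow>\<^sub>0 complex) set nalgebra" where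
  "alg_tensor A B =
     \<lparr> carr = {u. Poly_Mapping.keys u \<subseteq> carr A \<times> carr B} // tensor_rel A B,
       add = (\<lambda>X Y. \<Union>u\<in>X. \<Union>v\<in>Y. tensor_rel A B `` {u + v}),
       scl = (\<lambda>c X. \<Union>u\<in>X. tensor_rel A B `` {free_scl c u}),
       nrm = (\<lambda>X. Inf {\<Sum>(x, y)\<leftarrow>ws. nrm A x * nrm B y | ws.
               set ws \<subseteq> carr A \<times> carr B \<and> X = tensor_rel A B `` {\<Sum>(x, y)\<leftarrow>ws. gen x y}}),
       mul = (\<lambda>X Y. \<Union>u\<in>X. \<Union>v\<in>Y. tensor_rel A B `` {free_mul A B u v}) \<rparr>"

text \<open>Completion: Cauchy sequences modulo null sequences.\<close>

definition ndist :: "('a, 'm) nspace_scheme \<Rightarrow> 'a \<Rightarrow> 'a \<Rightarrow> real" where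
  "ndist A x y = nrm A (add A x (scl A (- 1) y))"

definition cauchy_seqs :: "('a, 'm) nspace_scheme \<Rightarrow> (nat \<Rightarrow> 'a) set" where
  "cauchy_seqs A = {s. (\<forall>n. s n \<in> carr A) \<and>
     (\<forall>e>0. \<exists>N. \<forall>m\<ge>N. \<forall>n\<ge>N. ndist A (s m) (s n) < e)}"

definition null_rel :: "('a, 'm) nspace_scheme \<Rightarrow> ((nat \<Rightarrow> 'a) \<times> (nat \<Rightarrow> 'a)) set" where
  "null_rel A = {(s, t). s \<in> cauchy_seqs A \<and> t \<in> cauchy_seqs A \<and>
     (\<lambda>n. ndist A (s n) (t n)) \<longlonglongrightarrow> 0}"

definition completion :: "('a, 'm) nalgebra_scheme \<Rightarrow> (nat \<Rightarrow> 'a) set nalgebra" where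
  "completion A =
     \<lparr> carr = cauchy_seqs A // null_rel A,
       add = (\<lambda>X Y. \<Union>s\<in>X. \<Union>t\<in>Y. null_rel A `` {\<lambda>n. add A (s n) (t n)}),
       scl = (\<lambda>c X. \<Union>s\<in>X. null_rel A `` {\<lambda>n. scl A c (s n)}),
       nrm = (\<lambda>X. THE r. \<forall>s\<in>X. (\<lambda>n. nrm A (s n)) \<longlonglongrightarrow> r),
       mul = (\<lambda>X Y. \<Union>s\<in>X. \<Union>t\<in>Y. null_rel A `` {\<lambda>n. mul A (s n) (t n)}) \<rparr>"

definition proj_tensor ::
  "('a, 'm) nalgebra_scheme \<Rightarrow> ('b, 'n) nalgebra_scheme \<Rightarrow>
   (nat \<Rightarrow> (('a \<times> 'b) \<Rightarrow>\<^sub>0 complex) set) set nalgebra"  (infixl "\<otimes>\<^sub>\<gamma>" 70) where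
  "A \<otimes>\<^sub>\<gamma> B = completion (alg_tensor A B)"

section \<open>Arens regularity\<close>

text \<open>Functionals are extensional (fixed to be \<open>undefined\<close> off the carrier), so that equality of
  functions on the type is equality of functionals on the carrier.\<close>

definition dual :: "('a, 'm) nspace_scheme \<Rightarrow> ('a \<Rightarrow> complex) nspace" where
  "dual A =
     \<lparr> carr = {\<phi> \<in> extensional (carr A).
         (\<forall>x\<in>carr A. \<forall>y\<in>carr A. \<phi> (add A x y) = \<phi> x + \<phi> y) \<and>
         (\<forall>c. \<forall>x\<in>carr A. \<phi> (scl A c x) = c * \<phi> x) \<and>
         (\<exists>K. \<forall>x\<in>carr A. cmod (\<phi> x) \<le> K * nrm A x)},
       add = (\<lambda>\<phi> \<psi>. \<lambda>x\<in>carr A. \<phi> x + \<psi> x),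
       scl = (\<lambda>c \<phi>. \<lambda>x\<in>carr A. c * \<phi> x),
       nrm = (\<lambda>\<phi>. SUP x\<in>{x \<in> carr A. nrm A x \<le> 1}. cmod (\<phi> x)) \<rparr>"

text \<open>In the usual notation the next four functionals are \<open>\<omega>\<^sub>a\<close>, \<open>\<^sub>a\<omega>\<close>, \<open>\<omega>\<^sub>f\<close> and \<open>\<^sub>f\<omega>\<close>,
  for \<open>a \<in> A\<close>, \<open>\<omega> \<in> A\<^sup>*\<close> and \<open>f \<in> A\<^sup>*\<^sup>*\<close>.\<close>

definition elem_right :: "('a, 'm) nalgebra_scheme \<Rightarrow> ('a \<Rightarrow> complex) \<Rightarrow> 'a \<Rightarrow> ('a \<Rightarrow> complex)" where
  "elem_right A \<omega> a = (\<lambda>b\<in>carr A. \<omega> (mul A a b))"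

definition elem_left :: "('a, 'm) nalgebra_scheme \<Rightarrow> 'a \<Rightarrow> ('a \<Rightarrow> complex) \<Rightarrow> ('a \<Rightarrow> complex)" where
  "elem_left A a \<omega> = (\<lambda>b\<in>carr A. \<omega> (mul A b a))"

definition bidual_right ::
  "('a, 'm) nalgebra_scheme \<Rightarrow> ('a \<Rightarrow> complex) \<Rightarrow> (('a \<Rightarrow> complex) \<Rightarrow> complex) \<Rightarrow> ('a \<Rightarrow> complex)" where
  "bidual_right A \<omega> f = (\<lambda>a\<in>carr A. f (elem_left A a \<omega>))"

definition bidual_left ::
  "('a, 'm) nalgebra_scheme \<Rightarrow> (('a \<Rightarrow> complex) \<Rightarrow> complex) \<Rightarrow> ('a \<Rightarrow> complex) \<Rightarrow> ('a \<Rightarrow> complex)" where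
  "bidual_left A f \<omega> = (\<lambda>a\<in>carr A. f (elem_right A \<omega> a))"

definition arens_box ::
  "('a, 'm) nalgebra_scheme \<Rightarrow> (('a \<Rightarrow> complex) \<Rightarrow> complex) \<Rightarrow> (('a \<Rightarrow> complex) \<Rightarrow> complex) \<Rightarrow>
   (('a \<Rightarrow> complex) \<Rightarrow> complex)" where
  "arens_box A f g = (\<lambda>\<omega>\<in>carr (dual A). f (bidual_left A g \<omega>))"

definition arens_diamond ::
  "('a, 'm) nalgebra_scheme \<Rightarrow> (('a \<Rightarrow> complex) \<Rightarrow> complex) \<Rightarrow> (('a \<Rightarrow> complex) \<Rightarrow> complex) \<Rightarrow>
   (('a \<Rightarrow> complex) \<Rightarrow> complex)" where
  "arens_diamond A f g = (\<lambda>\<omega>\<in>carr (dual A). g (bidual_right A \<omega> f))"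

definition arens_regular :: "('a, 'm) nalgebra_scheme \<Rightarrow> bool" where
  "arens_regular A \<longleftrightarrow>
     (\<forall>f\<in>carr (dual (dual A)). \<forall>g\<in>carr (dual (dual A)). arens_box A f g = arens_diamond A f g)"

end

theory Submission
  imports Defs "HOL-Computational_Algebra.Fundamental_Theorem_Algebra"
begin

text \<open>
  Fix orthonormal sequences \<open>e\<close>, \<open>f\<close> in the two Hilbert spaces. The bilinear form
  \<open>\<phi>(x, y) = \<Sum>\<^sub>n\<^sub>\<le>\<^sub>m \<langle>e\<^sub>n, x e\<^sub>m\<rangle> \<langle>f\<^sub>n, y f\<^sub>m\<rangle>\<close> is bounded by the product of the Hilbert--Schmidt norms
  of \<open>x\<close> and \<open>y\<close>, hence by \<open>\<parallel>x\<parallel>\<^sub>p \<parallel>y\<parallel>\<^sub>q\<close> because \<open>p, q \<le> 2\<close>, and so defines a bounded functional \<open>\<omega>\<close> on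
  the projective tensor product. For \<open>a\<^sub>n = e\<^sub>n\<^sub>0 \<otimes> f\<^sub>n\<^sub>0\<close> and \<open>b\<^sub>m = e\<^sub>0\<^sub>m \<otimes> f\<^sub>0\<^sub>m\<close>, with matrix units
  \<open>e\<^sub>i\<^sub>j\<close> and \<open>f\<^sub>i\<^sub>j\<close>, the value \<open>\<omega>(a\<^sub>n b\<^sub>m)\<close> is \<open>1\<close> if \<open>n \<le> m\<close> and \<open>0\<close> otherwise. The two iterated limits
  differ, so weak* cluster points of \<open>(a\<^sub>n)\<close> and \<open>(b\<^sub>m)\<close> in the bidual have different Arens products.
  That the Schatten classes are Banach algebras under composition comes from
  \<open>\<parallel>xy\<parallel>\<^sub>p \<le> \<parallel>xy\<parallel>\<^sub>1 \<le> \<parallel>x\<parallel>\<^sub>2 \<parallel>y\<parallel>\<^sub>2 \<le> \<parallel>x\<parallel>\<^sub>p \<parallel>y\<parallel>\<^sub>p\<close>.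
\<close>

section \<open>Geometry of complex Hilbert spaces\<close>

text \<open>Cutting a matrix down to its upper triangle is unbounded for many operator norms. Here
  it is harmless because the entrywise product of two Hilbert-Schmidt matrices is absolutely
  summable; \<open>p, q \<le> 2\<close> enters through this. The cut itself is what separates the
  two iterated limits. The Schatten norm is built from \<open>THE\<close> and \<open>SOME\<close>
  (absolute value, functional calculus, trace over a chosen basis), so these descriptions must first
  be shown to have a value. In place of spectral theory stands one estimate,
  \<open>norm_poly_op_le\<close>: the norm of \<open>P(S)\<close> is at most the supremum of
  \<open>|P|\<close> on \<open>[0, norm S]\<close>. It rests on factoring polynomials over the
  complex numbers. Comparisons between Schatten norms then become scalar inequalities between powers
  of \<open>t\<close> on that interval, transferred by \<open>fun_op_mono\<close>, and are evaluated
  on finite subsets of one fixed basis. Weak* compactness of the bidual ball yields cluster points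
  rather than limits of subsequences, so limits are taken along filters finer than
  \<open>sequentially\<close>.\<close>

interpretation cvs: vector_space "scaleC :: complex \<Rightarrow> 'a::chilbert_space \<Rightarrow> 'a"
  by unfold_locales (simp_all add: scaleC_add_right scaleC_add_left scaleC_scaleC scaleC_one)

lemma cinner_add_left: "cinner (x + y) z = cinner x z + cinner y (z::'a::chilbert_space)"
  by (metis cinner_add_right cinner_commute complex_cnj_add)

lemma cinner_scaleC_left: "cinner (c *\<^sub>C x) y = cnj c * cinner x (y::'a::chilbert_space)"
  by (metis cinner_commute cinner_scaleC_right complex_cnj_mult)

lemma cinner_zero_right [simp]: "cinner (x::'a::chilbert_space) 0 = 0"
  using cinner_add_right[of x 0 0] by simp

lemma cinner_zero_left [simp]: "cinner 0 (x::'a::chilbert_space) = 0"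
  using cinner_add_left[of 0 0 x] by simp

lemma cinner_minus_right [simp]: "cinner x (- y) = - cinner x (y::'a::chilbert_space)"
  using cinner_add_right[of x y "-y"] by (simp add: eq_neg_iff_add_eq_0 add.commute)

lemma cinner_minus_left [simp]: "cinner (- x) y = - cinner x (y::'a::chilbert_space)"
  by (metis cinner_commute cinner_minus_right complex_cnj_minus)

lemma cinner_diff_right: "cinner x (y - z) = cinner x y - cinner x (z::'a::chilbert_space)"
  using cinner_add_right[of x y "-z"] by simp

lemma cinner_diff_left: "cinner (x - y) z = cinner x z - cinner y (z::'a::chilbert_space)"
  using cinner_add_left[of x "-y" z] by simp

lemma cinner_scaleR_right: "cinner x (r *\<^sub>R y) = of_real r * cinner x (y::'a::chilbert_space)"
  by (simp add: scaleR_scaleC cinner_scaleC_right)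

lemma cinner_scaleR_left: "cinner (r *\<^sub>R x) y = of_real r * cinner x (y::'a::chilbert_space)"
  by (simp add: scaleR_scaleC cinner_scaleC_left)

lemma cinner_sum_right: "cinner (x::'a::chilbert_space) (sum f F) = (\<Sum>i\<in>F. cinner x (f i))"
  by (induction F rule: infinite_finite_induct) (auto simp: cinner_add_right)

lemma cinner_sum_left: "cinner (sum f F) (x::'a::chilbert_space) = (\<Sum>i\<in>F. cinner (f i) x)"
  by (induction F rule: infinite_finite_induct) (auto simp: cinner_add_left)

lemma cinner_self: "cinner x x = of_real ((norm (x::'a::chilbert_space))\<^sup>2)"
proof -
  have "Im (cinner x x) = 0"
    using cinner_commute[of x x] by (metis complex_cnj_cancel_iff Reals_cnj_iff complex_is_Real_iff)
  moreover have "0 \<le> Re (cinner x x)"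
    using norm_ge_zero[of x] unfolding norm_eq_sqrt_cinner by simp
  hence "Re (cinner x x) = (norm x)\<^sup>2"
    unfolding norm_eq_sqrt_cinner by simp
  ultimately show ?thesis by (simp add: complex_eq_iff)
qed

lemma norm_sq_eq_Re_cinner: "(norm (x::'a::chilbert_space))\<^sup>2 = Re (cinner x x)"
  by (simp add: cinner_self)

lemma norm_scaleC: "norm (c *\<^sub>C x) = cmod c * norm (x::'a::chilbert_space)"
proof -
  have "(norm (c *\<^sub>C x))\<^sup>2 = (cmod c * norm x)\<^sup>2"
  proof -
    have "cinner (c *\<^sub>C x) (c *\<^sub>C x) = (c * cnj c) * of_real ((norm x)\<^sup>2)"
      unfolding cinner_scaleC_left cinner_scaleC_right cinner_self[of x] by simp
    also have "\<dots> = of_real ((cmod c * norm x)\<^sup>2)"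
      by (simp add: complex_norm_square[symmetric] power_mult_distrib)
    finally show ?thesis unfolding cinner_self of_real_eq_iff .
  qed
  thus ?thesis by (simp add: power2_eq_iff_nonneg)
qed

lemma norm_add_sq: "(norm (x + y::'a::chilbert_space))\<^sup>2 = (norm x)\<^sup>2 + 2 * Re (cinner x y) + (norm y)\<^sup>2"
proof -
  have "Re (cinner y x) = Re (cinner x y)" by (subst cinner_commute) simp
  thus ?thesis by (simp add: norm_sq_eq_Re_cinner cinner_add_left cinner_add_right)
qed

lemma norm_diff_sq: "(norm (x - y::'a::chilbert_space))\<^sup>2 = (norm x)\<^sup>2 - 2 * Re (cinner x y) + (norm y)\<^sup>2"
  using norm_add_sq[of x "-y"] by simp

text \<open>Pythagoras for the projection of \<open>x\<close> onto the line through
  \<open>z\<close>. Nonnegativity of the left side is Cauchy-Schwarz; the exact amount lost is what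
  makes a closest point orthogonal in \<open>orthogonal_projection_exists\<close>.\<close>

lemma norm_residual_sq:
  fixes x z :: "'a::chilbert_space"
  assumes "z \<noteq> 0"
  shows "(norm (x - (cinner z x / (norm z)\<^sup>2) *\<^sub>C z))\<^sup>2 = (norm x)\<^sup>2 - (cmod (cinner z x) / norm z)\<^sup>2"
proof -
  define c where "c = cinner z x"
  have xz: "cinner x z = cnj c" unfolding c_def by (rule cinner_commute)
  have nz: "norm z > 0" using assms by simp
  have 1: "Re (cinner x ((c / (norm z)\<^sup>2) *\<^sub>C z)) = (cmod c / norm z)\<^sup>2"
    by (simp add: cinner_scaleC_right xz mult.commute[of c] complex_mult_cnj power_divide cmod_power2)
  have 2: "(norm ((c / (norm z)\<^sup>2) *\<^sub>C z))\<^sup>2 = (cmod c / norm z)\<^sup>2"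
    using nz by (simp add: norm_scaleC norm_divide power_divide power_mult_distrib norm_power)
       (simp add: power2_eq_square power4_eq_xxxx)
  show ?thesis unfolding norm_diff_sq c_def[symmetric] 1 2 by simp
qed

lemma cinner_cauchy_schwarz: "cmod (cinner x y) \<le> norm x * norm (y::'a::chilbert_space)"
proof (cases "x = 0")
  case False
  have "0 \<le> (norm y)\<^sup>2 - (cmod (cinner x y) / norm x)\<^sup>2"
    using norm_residual_sq[OF False, of y] by (metis zero_le_power2)
  hence "(cmod (cinner x y) / norm x)\<^sup>2 \<le> (norm y)\<^sup>2" by linarith
  hence "cmod (cinner x y) / norm x \<le> norm y"
    by (rule power2_le_imp_le) simp
  thus ?thesis using False by (simp add: field_simps)
qed auto

lemma bounded_bilinear_cinner: "bounded_bilinear (cinner :: 'a::chilbert_space \<Rightarrow> 'a \<Rightarrow> complex)"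
  by unfold_locales
     (auto simp: cinner_add_left cinner_add_right cinner_scaleR_left cinner_scaleR_right scaleR_conv_of_real
           intro!: exI[of _ 1] cinner_cauchy_schwarz)

lemmas tendsto_cinner [tendsto_intros] = bounded_bilinear.tendsto[OF bounded_bilinear_cinner]

text \<open>The foot \<open>m\<close> is a point of \<open>M\<close> closest to \<open>x\<close>,
  found by completeness; minimality then forces orthogonality.\<close>

lemma orthogonal_projection_exists:
  fixes M :: "'a::chilbert_space set"
  assumes cl: "closed M" and sub: "cvs.subspace M"
  shows "\<exists>m\<in>M. \<forall>z\<in>M. cinner z (x - m) = 0"
proof -
  define d where "d = Inf ((\<lambda>z. (norm (x - z))\<^sup>2) ` M)"
  have M0: "0 \<in> M" using sub by (rule cvs.subspace_0)
  have bdd: "bdd_below ((\<lambda>z. (norm (x - z))\<^sup>2) ` M)" by (rule bdd_belowI2[of _ 0]) simp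
  have d_le: "d \<le> (norm (x - z))\<^sup>2" if "z \<in> M" for z
    unfolding d_def by (rule cInf_lower[OF _ bdd]) (use that in auto)
  \<comment> \<open>Near-minimisers of the squared distance. These closed nested sets have diameters
    tending to 0, so completeness gives them a common point.\<close>
  define S where "S n = {z\<in>M. (norm (x - z))\<^sup>2 \<le> d + 1 / Suc n}" for n
  obtain m where m: "\<And>n. m \<in> S n"
  proof (rule decreasing_closed_nest[of S])
    have S_eq: "S n = M \<inter> {z. (norm (x - z))\<^sup>2 \<le> d + 1 / Suc n}" for n by (auto simp: S_def)
    show "closed (S n)" for n
      unfolding S_eq by (intro closed_Int cl closed_Collect_le continuous_intros)
    show "S n \<noteq> {}" for n
    proof -
      have "\<exists>y\<in>(\<lambda>z. (norm (x - z))\<^sup>2) ` M. y < d + 1 / Suc n"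
        by (rule cInf_lessD) (use M0 in \<open>auto simp: d_def\<close>)
      thus ?thesis by (force simp: S_def)
    qed
    show "S n \<subseteq> S m" if "m \<le> n" for m n
    proof -
      have "1 / real (Suc n) \<le> 1 / real (Suc m)" using that by (simp add: frac_le)
      thus ?thesis unfolding S_def by (auto intro: order_trans)
    qed
    show "\<exists>n. \<forall>u\<in>S n. \<forall>v\<in>S n. dist u v < e" if e: "e > 0" for e
    proof -
      \<comment> \<open>The parallelogram identity below bounds the squared distance of two points
        of \<open>S n\<close> by \<open>4 / Suc n\<close>.\<close>
      obtain n where n: "inverse (real (Suc n)) < e\<^sup>2 / 4" using reals_Archimedean[of "e\<^sup>2/4"] e by auto
      have "dist u v < e" if uv: "u \<in> S n" "v \<in> S n" for u v
      proof -
        \<comment> \<open>The midpoint lies in \<open>M\<close>, so its squared distance to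
          \<open>x\<close> is at least \<open>d\<close>; this is the term subtracted in the
          parallelogram identity.\<close>
        define w where "w = (1/2) *\<^sub>R (u + v)"
        have "w \<in> M" unfolding w_def scaleR_scaleC
          using uv sub by (auto simp: S_def intro!: cvs.subspace_scale cvs.subspace_add)
        hence dw: "d \<le> (norm (x - w))\<^sup>2" by (rule d_le)
        have "2 *\<^sub>R (x - w) = (x - u) + (x - v)" by (simp add: w_def algebra_simps scaleR_2)
        hence "2 * norm (x - w) = norm ((x - u) + (x - v))"
          by (metis norm_scaleR abs_numeral)
        hence a: "4 * (norm (x - w))\<^sup>2 = (norm ((x - u) + (x - v)))\<^sup>2"
          by (metis four_x_squared)
        have "norm (u - v) = norm ((x - u) - (x - v))" by (simp add: norm_minus_commute)
        hence "(norm (u - v))\<^sup>2 = 2 * (norm (x - u))\<^sup>2 + 2 * (norm (x - v))\<^sup>2 - 4 * (norm (x - w))\<^sup>2"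
          unfolding a by (simp only: norm_add_sq norm_diff_sq) simp
        also have "\<dots> \<le> 4 * inverse (real (Suc n))"
          using uv dw by (auto simp: S_def inverse_eq_divide)
        also have "\<dots> < e\<^sup>2" using n by simp
        finally show ?thesis using e by (simp add: dist_norm power_less_imp_less_base)
      qed
      thus ?thesis by blast
    qed
  qed (use that in blast)
  have mM: "m \<in> M" using m by (auto simp: S_def)
  have "(norm (x - m))\<^sup>2 \<le> d"
  proof (rule field_le_epsilon)
    fix e :: real assume "e > 0"
    then obtain n where "inverse (real (Suc n)) < e" using reals_Archimedean by blast
    thus "(norm (x - m))\<^sup>2 \<le> d + e" using m[of n] by (auto simp: S_def inverse_eq_divide)
  qed
  have "cinner z (x - m) = 0" if "z \<in> M" for z
  proof (cases "z = 0")
    case False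
    \<comment> \<open>Correcting \<open>m\<close> by the projection of \<open>x - m\<close> onto
      \<open>z\<close> stays in \<open>M\<close> and lowers the squared distance by exactly the
      quantity that has to vanish.\<close>
    have "m + (cinner z (x - m) / (norm z)\<^sup>2) *\<^sub>C z \<in> M"
      using mM that sub by (auto intro!: cvs.subspace_scale cvs.subspace_add)
    from d_le[OF this] have "d \<le> (norm (x - m - (cinner z (x - m) / (norm z)\<^sup>2) *\<^sub>C z))\<^sup>2"
      by (simp add: diff_diff_eq)
    also have "\<dots> = (norm (x - m))\<^sup>2 - (cmod (cinner z (x - m)) / norm z)\<^sup>2"
      by (rule norm_residual_sq[OF False])
    finally have "(cmod (cinner z (x - m)) / norm z)\<^sup>2 \<le> 0" using \<open>(norm (x - m))\<^sup>2 \<le> d\<close> by linarith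
    hence "cmod (cinner z (x - m)) / norm z = 0" by (simp only: power2_less_eq_zero_iff)
    thus ?thesis using False by simp
  qed auto
  thus ?thesis using mM by blast
qed

lemma bounded_linear_scaleC: "bounded_linear (\<lambda>x. c *\<^sub>C (x::'a::chilbert_space))"
  by (rule bounded_linear_intro[of _ "cmod c"])
     (auto simp: scaleC_add_right scaleR_scaleC scaleC_scaleC mult.commute norm_scaleC)

lemmas tendsto_scaleC [tendsto_intros] = bounded_linear.tendsto[OF bounded_linear_scaleC]

lemma cvs_subspace_closure:
  assumes "cvs.subspace (M::'a::chilbert_space set)"
  shows "cvs.subspace (closure M)"
proof (rule cvs.subspaceI)
  show "0 \<in> closure M" using cvs.subspace_0[OF assms] closure_subset by blast
  show "x + y \<in> closure M" if xy: "x \<in> closure M" "y \<in> closure M" for x y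
  proof -
    obtain f g where "\<And>n. f n \<in> M" "f \<longlonglongrightarrow> x" "\<And>n. g n \<in> M" "g \<longlonglongrightarrow> y"
      using xy unfolding closure_sequential by blast
    thus ?thesis unfolding closure_sequential
      by (intro exI[of _ "\<lambda>n. f n + g n"]) (auto intro: cvs.subspace_add[OF assms] tendsto_add)
  qed
  show "c *\<^sub>C x \<in> closure M" if x: "x \<in> closure M" for c x
  proof -
    obtain f where "\<And>n. f n \<in> M" "f \<longlonglongrightarrow> x" using x unfolding closure_sequential by blast
    thus ?thesis unfolding closure_sequential
      by (intro exI[of _ "\<lambda>n. c *\<^sub>C f n"]) (auto intro: cvs.subspace_scale[OF assms] tendsto_scaleC)
  qed
qed

text \<open>A maximal orthonormal set, from Zorn's lemma, has dense span: otherwise the normalised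
  residual of a point outside the closed span could be added to it. This is what gives the
  \<open>SOME\<close> in \<open>trace_op\<close> a meaning.\<close>

lemma orthonormal_basis_exists: "\<exists>E::'a::chilbert_space set. orthonormal_basis E"
proof -
  define \<O> :: "'a set set" where
    "\<O> = {E. (\<forall>e\<in>E. norm e = 1) \<and> (\<forall>e\<in>E. \<forall>e'\<in>E. e \<noteq> e' \<longrightarrow> cinner e e' = 0)}"
  have "\<exists>M\<in>\<O>. \<forall>X\<in>\<O>. M \<subseteq> X \<longrightarrow> X = M"
  proof (rule subset_Zorn')
    fix C assume C: "subset.chain \<O> C"
    show "\<Union> C \<in> \<O>"
      unfolding \<O>_def
    proof (intro CollectI conjI ballI impI)
      show "norm e = 1" if "e \<in> \<Union>C" for e
        using that C by (auto simp: subset.chain_def \<O>_def)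
      show "cinner e e' = 0" if ee: "e \<in> \<Union>C" "e' \<in> \<Union>C" "e \<noteq> e'" for e e'
      proof -
        obtain A B where AB: "A \<in> C" "B \<in> C" "e \<in> A" "e' \<in> B" using ee by blast
        hence "A \<subseteq> B \<or> B \<subseteq> A" using C by (auto simp: subset.chain_def)
        then obtain D where "D \<in> C" "e \<in> D" "e' \<in> D" using AB by blast
        thus ?thesis using C ee by (auto simp: subset.chain_def \<O>_def)
      qed
    qed
  qed
  then obtain E where E: "E \<in> \<O>" and max: "\<And>X. X \<in> \<O> \<Longrightarrow> E \<subseteq> X \<Longrightarrow> X = E" by blast
  have "closure (cspan E) = UNIV"
  proof (rule ccontr)
    assume "closure (cspan E) \<noteq> UNIV"
    then obtain x where x: "x \<notin> closure (cspan E)" by blast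
    obtain m where m: "m \<in> closure (cspan E)" "\<forall>z\<in>closure (cspan E). cinner z (x - m) = 0"
      using orthogonal_projection_exists[OF closed_closure cvs_subspace_closure[OF cvs.subspace_span]] by blast
    define u where "u = (1 / norm (x - m)) *\<^sub>R (x - m)"
    have ne: "x \<noteq> m" using x m by blast
    have nu: "norm u = 1" using ne by (simp add: u_def)
    have orth: "cinner z u = 0" if "z \<in> E" for z
      using that m(2) closure_subset[of "cspan E"] cvs.span_superset[of E]
      by (auto simp: u_def cinner_scaleR_right)
    have "cinner u z = 0" if "z \<in> E" for z
      using orth[OF that] cinner_commute[of u z] by simp
    hence "insert u E \<in> \<O>" using E orth nu by (auto simp: \<O>_def)
    hence "u \<in> E" using max by blast
    from orth[OF this] nu show False by (simp add: cinner_self)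
  qed
  hence "orthonormal_basis E" using E unfolding orthonormal_basis_def \<O>_def by simp
  thus ?thesis ..
qed

text \<open>The kernel of a nonzero \<open>f\<close> is a closed subspace whose orthogonal
  complement is a line; the representing vector is the suitable multiple of a vector
  \<open>u\<close> on that line.\<close>

lemma riesz_representation:
  fixes f :: "'a::chilbert_space \<Rightarrow> complex"
  assumes add: "\<And>x y. f (x + y) = f x + f y" and scale: "\<And>c x. f (c *\<^sub>C x) = c * f x"
    and bound: "\<And>x. cmod (f x) \<le> K * norm x"
  shows "\<exists>y. \<forall>x. f x = cinner y x"
proof (cases "\<forall>x. f x = 0")
  case False
  then obtain x where x: "f x \<noteq> 0" by blast
  have f0: "f 0 = 0" using scale[of 0 0] by simp
  have fd: "f (a - b) = f a - f b" for a b
    using add[of "a - b" b] by simp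
  have bl: "bounded_linear f"
    by (rule bounded_linear_intro[of _ K]) (auto simp: add scale scaleR_scaleC scaleR_conv_of_real bound mult.commute)
  define M where "M = {z. f z = 0}"
  have "closed M" unfolding M_def
    by (intro closed_Collect_eq continuous_on_const linear_continuous_on bl)
  moreover have "cvs.subspace M"
    by (rule cvs.subspaceI) (auto simp: M_def add scale f0)
  ultimately obtain m where m: "m \<in> M" "\<forall>z\<in>M. cinner z (x - m) = 0"
    using orthogonal_projection_exists by blast
  define u where "u = x - m"
  have fu: "f u = f x" using m by (simp add: u_def fd M_def)
  have u0: "u \<noteq> 0" using fu x f0 by auto
  \<comment> \<open>The scalar is forced by requiring \<open>f u = cinner y u\<close>; the conjugate
    compensates for antilinearity in the first argument.\<close>
  define y where "y = cnj (f u / (norm u)\<^sup>2) *\<^sub>C u"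
  have "f z = cinner y z" for z
  proof -
    \<comment> \<open>Subtracting the right multiple of \<open>u\<close> moves any \<open>z\<close>
      into the kernel, which is orthogonal to \<open>u\<close>.\<close>
    have "z - (f z / f u) *\<^sub>C u \<in> M" using x by (simp add: M_def fd scale fu)
    hence "cinner (z - (f z / f u) *\<^sub>C u) u = 0" using m(2) by (simp add: u_def)
    hence "cinner u (z - (f z / f u) *\<^sub>C u) = 0" using cinner_commute by (metis complex_cnj_zero)
    hence "cinner u z = (f z / f u) * (norm u)\<^sup>2" by (simp add: cinner_diff_right cinner_scaleC_right cinner_self)
    thus ?thesis unfolding y_def cinner_scaleC_left using u0 x fu by simp
  qed
  thus ?thesis by blast
qed (auto intro!: exI[of _ 0])

section \<open>Bounded operators\<close>

lemma bounded_opsD: "T \<in> bounded_ops \<Longrightarrow> T (c *\<^sub>C x) = c *\<^sub>C T x"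
  by (simp add: bounded_ops_def)

lemma bounded_ops_closed [intro]:
  assumes "S \<in> bounded_ops" "T \<in> bounded_ops"
  shows "S o\<^sub>L T \<in> bounded_ops" "S + T \<in> bounded_ops" "S - T \<in> bounded_ops" "r *\<^sub>R S \<in> bounded_ops"
  using assms by (auto simp: bounded_ops_def blinfun.add_left blinfun.diff_left blinfun.scaleR_left
      scaleC_add_right cvs.scale_right_diff_distrib scaleR_scaleC scaleC_scaleC mult.commute)

lemma id_blinfun_bounded_ops [simp, intro]: "id_blinfun \<in> bounded_ops" "0 \<in> bounded_ops"
  by (auto simp: bounded_ops_def)

lemma op_scaleC_apply: "blinfun_apply (op_scaleC c T) x = c *\<^sub>C blinfun_apply T x"
proof -
  have "bounded_linear (\<lambda>x. c *\<^sub>C blinfun_apply T x)"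
    by (rule bounded_linear_compose[OF bounded_linear_scaleC blinfun.bounded_linear_right])
  thus ?thesis by (simp add: op_scaleC_def bounded_linear_Blinfun_apply)
qed

lemma op_scaleC_bounded_ops: "T \<in> bounded_ops \<Longrightarrow> op_scaleC c T \<in> bounded_ops"
  by (simp add: bounded_ops_def op_scaleC_apply scaleC_scaleC mult.commute)

lemma blinfun_ext_cinner:
  fixes S T :: "'a::chilbert_space \<Rightarrow>\<^sub>L 'a"
  assumes "\<And>x y. cinner (S x) y = cinner (T x) y"
  shows "S = T"
proof (rule blinfun_eqI)
  fix x
  have "cinner (S x - T x) (S x - T x) = 0"
    using assms[of x "S x - T x"] by (simp add: cinner_diff_left)
  thus "S x = T x" by (simp add: cinner_self)
qed

lemma adjoint_exists:
  assumes T: "T \<in> bounded_ops"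
  shows "\<exists>S\<in>bounded_ops. \<forall>x y. cinner (blinfun_apply S x) y = cinner x (blinfun_apply T y)"
proof -
  have "\<exists>z. \<forall>y. cinner x (T y) = cinner z y" for x
  proof (rule riesz_representation)
    show "cmod (cinner x (T y)) \<le> (norm x * norm T) * norm y" for y
      using order_trans[OF cinner_cauchy_schwarz[of x "T y"]
          mult_left_mono[OF norm_blinfun[of T y] norm_ge_zero[of x]]] by (simp add: mult.assoc)
    show "cinner x (T (c *\<^sub>C y)) = c * cinner x (T y)" for c y
      by (simp add: bounded_opsD[OF T] cinner_scaleC_right)
    show "cinner x (T (y + z)) = cinner x (T y) + cinner x (T z)" for y z
      by (simp add: blinfun.add_right cinner_add_right)
  qed
  then obtain g where g: "\<And>x y. cinner (g x) y = cinner x (T y)" by metis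
  have ext: "a = b" if "\<And>y. cinner a y = cinner b y" for a b :: 'a
  proof -
    have "cinner (a - b) (a - b) = 0" using that[of "a - b"] by (simp add: cinner_diff_left)
    thus ?thesis by (simp add: cinner_self)
  qed
  have "bounded_linear g"
  proof (rule bounded_linear_intro[of _ "norm T"])
    show "g (x + y) = g x + g y" for x y by (rule ext) (simp add: g cinner_add_left)
    show "g (r *\<^sub>R x) = r *\<^sub>R g x" for r x by (rule ext) (simp add: g cinner_scaleR_left)
    show "norm (g x) \<le> norm x * norm T" for x
    proof -
      have "(norm (g x))\<^sup>2 = cmod (cinner x (T (g x)))" by (simp add: g[symmetric] cinner_self norm_power)
      also have "\<dots> \<le> norm x * norm (T (g x))" by (rule cinner_cauchy_schwarz)
      also have "\<dots> \<le> norm x * (norm T * norm (g x))" by (intro mult_left_mono norm_blinfun) auto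
      finally have "norm (g x) * norm (g x) \<le> (norm x * norm T) * norm (g x)"
        by (simp add: power2_eq_square mult.assoc)
      thus ?thesis by (cases "g x = 0") (auto simp: mult_le_cancel_right)
    qed
  qed
  then obtain S where S: "g = blinfun_apply S" by (metis bounded_linear_Blinfun_apply)
  have "S (c *\<^sub>C x) = c *\<^sub>C S x" for c x
    unfolding S[symmetric] by (rule ext) (simp add: g cinner_scaleC_left)
  thus ?thesis using g unfolding S bounded_ops_def by blast
qed

lemma adjoint_op:
  assumes "T \<in> bounded_ops"
  shows adjoint_op_bounded_ops: "adjoint_op T \<in> bounded_ops"
    and cinner_adjoint_left: "cinner (adjoint_op T x) y = cinner x (T y)"
    and cinner_adjoint_right: "cinner x (adjoint_op T y) = cinner (T x) y"
proof -
  have "\<exists>!S. S \<in> bounded_ops \<and> (\<forall>x y. cinner (blinfun_apply S x) y = cinner x (blinfun_apply T y))"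
    using adjoint_exists[OF assms] by (auto intro: blinfun_ext_cinner)
  from theI'[OF this] show 1: "adjoint_op T \<in> bounded_ops"
    and 2: "cinner (adjoint_op T x) y = cinner x (T y)" for x y
    unfolding adjoint_op_def by auto
  show "cinner x (adjoint_op T y) = cinner (T x) y"
    using 2[of y x] cinner_commute by metis
qed

lemma adjoint_op_unique:
  fixes S T :: "'a::chilbert_space \<Rightarrow>\<^sub>L 'a"
  assumes "T \<in> bounded_ops" "\<And>x y. cinner (S x) y = cinner x (T y)"
  shows "adjoint_op T = S"
  by (rule blinfun_ext_cinner) (simp add: assms cinner_adjoint_left)

lemma positive_op_bounded_ops: "positive_op S \<Longrightarrow> S \<in> bounded_ops"
  by (simp add: positive_op_def)

lemma positive_op_cinner_real: "positive_op S \<Longrightarrow> cinner x (S x) = of_real (Re (cinner x (S x)))"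
  by (auto simp: positive_op_def complex_eq_iff complex_nonneg_Reals_iff)

lemma positive_op_nonneg: "positive_op S \<Longrightarrow> 0 \<le> Re (cinner x (S x))"
  by (auto simp: positive_op_def complex_nonneg_Reals_iff)

text \<open>Polarisation: reality of the quadratic form at \<open>x + y\<close> compares the
  imaginary parts of the two sides, and at \<open>x + \<i> *\<^sub>C y\<close> the real
  parts.\<close>

lemma positive_op_selfadjoint:
  assumes S: "positive_op (S::'a::chilbert_space \<Rightarrow>\<^sub>L 'a)"
  shows "cinner (S x) y = cinner x (S y)"
proof -
  have b: "S \<in> bounded_ops" and im: "Im (cinner x (S x)) = 0" for x
    using S by (auto simp: positive_op_def complex_nonneg_Reals_iff)
  have "Im (cinner x (S y)) + Im (cinner y (S x)) = 0"
    using im[of "x + y"] im[of x] im[of y]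
    by (simp add: blinfun.add_right cinner_add_left cinner_add_right)
  moreover have "Re (cinner x (S y)) - Re (cinner y (S x)) = 0"
    using im[of "x + \<i> *\<^sub>C y"] im[of x] im[of y]
    by (simp add: blinfun.add_right cinner_add_left cinner_add_right bounded_opsD[OF b]
        cinner_scaleC_left cinner_scaleC_right)
  ultimately have "cinner x (S y) = cnj (cinner y (S x))" by (simp add: complex_eq_iff)
  thus ?thesis by (metis cinner_commute)
qed

lemma positive_opI:
  assumes "S \<in> bounded_ops" "\<And>x y. cinner (S x) y = cinner x (S y)" "\<And>x. 0 \<le> Re (cinner x (S x))"
  shows "positive_op S"
proof -
  have "Im (cinner x (S x)) = 0" for x
    using assms(2)[of x x] cinner_commute[of "S x" x] by (simp add: complex_eq_iff)
  thus ?thesis using assms by (auto simp: positive_op_def complex_nonneg_Reals_iff)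
qed

lemma Re_cinner_le_norm:
  "Re (cinner x (blinfun_apply S x)) \<le> norm S * (norm (x::'a::chilbert_space))\<^sup>2"
proof -
  have "Re (cinner x (S x)) \<le> norm x * norm (S x)"
    using cinner_cauchy_schwarz[of x "S x"] complex_Re_le_cmod order_trans by blast
  also have "\<dots> \<le> norm x * (norm S * norm x)" by (intro mult_left_mono norm_blinfun) auto
  finally show ?thesis by (simp add: power2_eq_square mult_ac)
qed

section \<open>Functional calculus of positive operators\<close>

lemma poly_op_eq_sum:
  assumes "degree P \<le> n"
  shows "poly_op P S = (\<Sum>i\<le>n. coeff P i *\<^sub>R (blinfun_compose S ^^ i) id_blinfun)"
  unfolding poly_op_def
  by (rule sum.mono_neutral_left) (use assms in \<open>auto simp: coeff_eq_0\<close>)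

lemma poly_op_add: "poly_op (P + Q) S = poly_op P S + poly_op Q S"
proof -
  define n where "n = max (degree P) (degree Q)"
  have "degree (P + Q) \<le> n" "degree P \<le> n" "degree Q \<le> n"
    by (auto simp: n_def degree_add_le)
  thus ?thesis by (simp add: poly_op_eq_sum scaleR_add_left sum.distrib)
qed

lemma poly_op_smult: "poly_op (smult c P) S = c *\<^sub>R poly_op P S"
  by (simp add: poly_op_eq_sum[of _ "degree P"] scaleR_sum_right)

lemma poly_op_0 [simp]: "poly_op 0 S = 0"
  by (simp add: poly_op_def)

lemma poly_op_diff: "poly_op (P - Q) S = poly_op P S - poly_op Q S"
  using poly_op_add[of "P - Q" Q S] by (simp add: algebra_simps)

lemma blinfun_compose_sum_right: "S o\<^sub>L (\<Sum>i\<in>I. f i) = (\<Sum>i\<in>I. S o\<^sub>L f i)"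
  by (rule bounded_bilinear.sum_right[OF bounded_bilinear_blinfun_compose])

lemma id_blinfun_compose [simp]: "id_blinfun o\<^sub>L S = S" "S o\<^sub>L id_blinfun = S"
  by (auto intro: blinfun_eqI)

text \<open>Horner's rule. It lets later facts about \<open>poly_op\<close> be proved by induction
  on the coefficients.\<close>

lemma poly_op_pCons: "poly_op (pCons a P) S = a *\<^sub>R id_blinfun + (S o\<^sub>L poly_op P S)"
proof -
  have "poly_op (pCons a P) S = (\<Sum>i\<le>Suc (degree P). coeff (pCons a P) i *\<^sub>R (blinfun_compose S ^^ i) id_blinfun)"
    by (rule poly_op_eq_sum) (rule degree_pCons_le)
  also have "\<dots> = a *\<^sub>R id_blinfun + (\<Sum>i\<le>degree P. (S o\<^sub>L (coeff P i *\<^sub>R (blinfun_compose S ^^ i) id_blinfun)))"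
    by (subst sum.atMost_Suc_shift)
       (simp add: bounded_bilinear.scaleR_right[OF bounded_bilinear_blinfun_compose])
  finally show ?thesis unfolding blinfun_compose_sum_right[symmetric] poly_op_def[of P, symmetric] .
qed

lemma poly_op_pCons_apply: "poly_op (pCons a P) S x = a *\<^sub>R x + S (poly_op P S x)"
  by (simp add: poly_op_pCons blinfun.add_left blinfun.scaleR_left)

lemma poly_op_mult: "poly_op (P * Q) S = poly_op P S o\<^sub>L poly_op Q S"
proof (induction P)
  case (pCons a P)
  show ?case
    by (rule blinfun_eqI)
       (simp add: mult_pCons_left poly_op_add poly_op_smult poly_op_pCons_apply blinfun.add_left
         blinfun.scaleR_left pCons.IH)
qed auto

lemma poly_op_pcompose: "poly_op (pcompose P Q) S = poly_op P (poly_op Q S)"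
proof (induction P)
  case (pCons a P)
  show ?case
    by (rule blinfun_eqI)
       (simp add: pcompose_pCons poly_op_add poly_op_mult poly_op_pCons_apply blinfun.add_left
         blinfun.scaleR_left pCons.IH)
qed auto

lemma poly_op_const: "poly_op [:c:] S = c *\<^sub>R id_blinfun"
  by (simp add: poly_op_pCons)

lemma poly_op_bounded_ops: "S \<in> bounded_ops \<Longrightarrow> poly_op P S \<in> bounded_ops"
  by (induction P) (auto simp: poly_op_pCons)

lemma poly_op_commute: "poly_op P S (S x) = S (poly_op P S x)"
proof -
  have "poly_op (P * [:0, 1:]) S = poly_op ([:0, 1:] * P) S" by (simp only: mult.commute)
  from arg_cong[OF this, of "\<lambda>T. blinfun_apply T x"] show ?thesis
    by (simp only: poly_op_mult blinfun_apply_blinfun_compose) (simp add: poly_op_pCons)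
qed

lemma poly_op_selfadjoint:
  assumes "positive_op (S :: 'a::chilbert_space \<Rightarrow>\<^sub>L 'a)"
  shows "cinner (poly_op P S x) y = cinner x (poly_op P S y)"
proof (induction P arbitrary: x y)
  case (pCons a P)
  show ?case
    by (simp add: poly_op_pCons_apply cinner_add_left cinner_add_right cinner_scaleR_left
        cinner_scaleR_right positive_op_selfadjoint[OF assms] pCons.IH poly_op_commute)
qed auto

text \<open>Complex coefficients are needed so that a polynomial splits into linear factors.
  Evaluating at a vector makes \<open>*\<^sub>C\<close> available for them, since the type of
  bounded maps is only a real vector space.\<close>

definition cpoly_apply :: "complex poly \<Rightarrow> ('a::chilbert_space \<Rightarrow>\<^sub>L 'a) \<Rightarrow> 'a \<Rightarrow> 'a" where
  "cpoly_apply P S x = (\<Sum>i\<le>degree P. coeff P i *\<^sub>C (blinfun_compose S ^^ i) id_blinfun x)"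

lemma cpoly_apply_eq_sum:
  assumes "degree P \<le> n"
  shows "cpoly_apply P S x = (\<Sum>i\<le>n. coeff P i *\<^sub>C (blinfun_compose S ^^ i) id_blinfun x)"
  unfolding cpoly_apply_def
  by (rule sum.mono_neutral_left) (use assms in \<open>auto simp: coeff_eq_0\<close>)

lemma cpoly_apply_add: "cpoly_apply (P + Q) S x = cpoly_apply P S x + cpoly_apply Q S x"
proof -
  define n where "n = max (degree P) (degree Q)"
  have "degree (P + Q) \<le> n" "degree P \<le> n" "degree Q \<le> n"
    by (auto simp: n_def degree_add_le)
  thus ?thesis by (simp add: cpoly_apply_eq_sum scaleC_add_left sum.distrib)
qed

lemma cpoly_apply_smult: "cpoly_apply (smult c P) S x = c *\<^sub>C cpoly_apply P S x"
  by (simp add: cpoly_apply_eq_sum[of _ "degree P"] cvs.scale_sum_right)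

lemma cpoly_apply_pCons:
  assumes "S \<in> bounded_ops"
  shows "cpoly_apply (pCons a P) S x = a *\<^sub>C x + S (cpoly_apply P S x)"
proof -
  have "cpoly_apply (pCons a P) S x
      = (\<Sum>i\<le>Suc (degree P). coeff (pCons a P) i *\<^sub>C (blinfun_compose S ^^ i) id_blinfun x)"
    by (rule cpoly_apply_eq_sum) (rule degree_pCons_le)
  also have "\<dots> = a *\<^sub>C x + (\<Sum>i\<le>degree P. S (coeff P i *\<^sub>C (blinfun_compose S ^^ i) id_blinfun x))"
    by (subst sum.atMost_Suc_shift) (simp add: bounded_opsD[OF assms])
  finally show ?thesis by (simp add: cpoly_apply_def blinfun.sum_right)
qed

lemma cpoly_apply_linear_factor:
  assumes "S \<in> bounded_ops"
  shows "cpoly_apply ([:- z, 1:] * Q) S x = S (cpoly_apply Q S x) - z *\<^sub>C cpoly_apply Q S x"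
proof -
  have "[:- z, 1:] * Q = smult (- z) Q + pCons 0 Q" by simp
  thus ?thesis by (simp only: cpoly_apply_add cpoly_apply_smult cpoly_apply_pCons[OF assms]) simp
qed

lemma cpoly_apply_of_real: "cpoly_apply (map_poly of_real P) S x = poly_op P S x"
  by (simp add: cpoly_apply_def poly_op_def blinfun.sum_left blinfun.scaleR_left scaleR_scaleC
      degree_map_poly coeff_map_poly)

text \<open>By the fundamental theorem of algebra \<open>P(S)\<close> is a product of factors
  \<open>S - z\<close> over the zeros of \<open>P\<close>, up to a nonzero constant, and lower
  bounds of the factors multiply.\<close>

lemma cpoly_apply_bounded_below:
  assumes S: "S \<in> bounded_ops" and "P \<noteq> 0"
    and "\<And>z. poly P z = 0 \<Longrightarrow> \<exists>c>0. \<forall>x. c * norm x \<le> norm (S x - z *\<^sub>C x)"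
  shows "\<exists>c>0. \<forall>x. c * norm x \<le> norm (cpoly_apply P S x)"
  using assms(2,3)
proof (induction "degree P" arbitrary: P rule: less_induct)
  case less
  show ?case
  proof (cases "degree P = 0")
    case True
    then obtain a where P: "P = [:a:]" by (metis degree_eq_zeroE)
    have "cpoly_apply P S x = a *\<^sub>C x" for x by (simp add: P cpoly_apply_def)
    thus ?thesis using less.prems(1) by (intro exI[of _ "cmod a"]) (auto simp: P norm_scaleC)
  next
    case False
    then obtain z where z: "poly P z = 0"
      using fundamental_theorem_of_algebra[of P] constant_degree[of P] by auto
    then obtain Q where Q: "P = [:- z, 1:] * Q" by (auto simp: poly_eq_0_iff_dvd)
    have Q0: "Q \<noteq> 0" using less.prems(1) Q by auto
    have "degree P = Suc (degree Q)" using Q0 unfolding Q by (subst degree_mult_eq) auto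
    moreover have "poly P w = 0" if "poly Q w = 0" for w using that by (simp add: Q)
    ultimately obtain c where c: "c > 0" "\<And>x. c * norm x \<le> norm (cpoly_apply Q S x)"
      using less.hyps[of Q] Q0 less.prems(2) by auto
    obtain d where d: "d > 0" "\<And>x. d * norm x \<le> norm (S x - z *\<^sub>C x)"
      using less.prems(2)[OF z] by auto
    have "(d * c) * norm x \<le> norm (cpoly_apply P S x)" for x
    proof -
      have "d * (c * norm x) \<le> d * norm (cpoly_apply Q S x)"
        using c(2)[of x] d(1) by (intro mult_left_mono) auto
      also have "\<dots> \<le> norm (cpoly_apply P S x)"
        unfolding Q cpoly_apply_linear_factor[OF S] by (rule d(2))
      finally show ?thesis by (simp add: mult.assoc)
    qed
    thus ?thesis using c(1) d(1) by (intro exI[of _ "d * c"]) auto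
  qed
qed

text \<open>A numerical range argument: the Rayleigh quotient \<open>t\<close> of \<open>x\<close>
  lies in \<open>[0, norm S]\<close>, so \<open>cinner x (S x - z *\<^sub>C x)\<close> has modulus
  at least the distance \<open>c\<close> from \<open>z\<close> to this interval, times the squared
  norm of \<open>x\<close>. Cauchy-Schwarz does the rest.\<close>

lemma positive_op_bounded_below:
  assumes S: "positive_op S" and z: "z \<notin> of_real ` {0..norm S}"
  shows "\<exists>c>0. \<forall>x. c * norm x \<le> norm (S x - z *\<^sub>C x)"
proof -
  have "closed (complex_of_real ` {0..norm S})"
    by (intro compact_imp_closed compact_continuous_image continuous_intros compact_Icc)
  then obtain c where c: "c > 0" "\<And>w. w \<in> complex_of_real ` {0..norm S} \<Longrightarrow> c \<le> dist z w"
    using separate_point_closed[of "complex_of_real ` {0..norm S}" z] z by metis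
  have "c * norm x \<le> norm (S x - z *\<^sub>C x)" for x
  proof (cases "x = 0")
    case False
    define t where "t = Re (cinner x (S x)) / (norm x)\<^sup>2"
    have n: "norm x > 0" using False by simp
    have "t \<in> {0..norm S}"
      using positive_op_nonneg[OF S, of x] Re_cinner_le_norm[of x S] n
      by (auto simp: t_def divide_le_eq)
    hence "c \<le> cmod (z - of_real t)" using c(2) by (auto simp: dist_norm)
    hence "c * (norm x)\<^sup>2 \<le> cmod (z - of_real t) * (norm x)\<^sup>2" by (intro mult_right_mono) auto
    also have "\<dots> = cmod ((of_real t - z) * of_real ((norm x)\<^sup>2))"
      by (simp add: norm_mult norm_minus_commute norm_power)
    also have "(of_real t - z) * of_real ((norm x)\<^sup>2) = cinner x (S x - z *\<^sub>C x)"
    proof -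
      have "of_real t * of_real ((norm x)\<^sup>2) = cinner x (S x)"
        using n unfolding t_def of_real_mult[symmetric]
        by (subst positive_op_cinner_real[OF S]) simp
      thus ?thesis
        unfolding cinner_diff_right cinner_scaleC_right cinner_self[of x] by (simp add: algebra_simps)
    qed
    also have "cmod \<dots> \<le> norm x * norm (S x - z *\<^sub>C x)" by (rule cinner_cauchy_schwarz)
    finally show ?thesis using n by (simp add: power2_eq_square mult_ac)
  qed auto
  thus ?thesis using c(1) by blast
qed

text \<open>The operator inequality \<open>B B \<le> K B\<close>, read off from positivity of the
  quadratic form of \<open>B\<close> at \<open>x - B x / K\<close>.\<close>

lemma positive_op_norm_sq_le:
  assumes B: "positive_op B" and K: "norm B \<le> K" "0 < K"
  shows "(norm (B x))\<^sup>2 \<le> K * Re (cinner x (B x))"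
proof -
  define y where "y = x - (1 / K) *\<^sub>R B x"
  have 1: "cinner x (B (B x)) = of_real ((norm (B x))\<^sup>2)"
    unfolding cinner_self[symmetric] by (rule positive_op_selfadjoint[OF B, symmetric])
  have "0 \<le> Re (cinner y (B y))" by (rule positive_op_nonneg[OF B])
  also have "Re (cinner y (B y)) = Re (cinner x (B x)) - (2 / K) * (norm (B x))\<^sup>2
      + (1 / K)\<^sup>2 * Re (cinner (B x) (B (B x)))"
    unfolding y_def using K(2)
    by (simp add: cinner_diff_left cinner_diff_right cinner_scaleR_left cinner_scaleR_right
        blinfun.diff_right blinfun.scaleR_right 1 cinner_self[of "B x"])
       (simp add: field_simps power2_eq_square)
  also have "\<dots> \<le> Re (cinner x (B x)) - (2 / K) * (norm (B x))\<^sup>2 + (1 / K)\<^sup>2 * (K * (norm (B x))\<^sup>2)"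
    using order_trans[OF Re_cinner_le_norm[of "B x" B] mult_right_mono[OF K(1), of "(norm (B x))\<^sup>2"]]
    by (intro add_left_mono mult_left_mono) auto
  also have "\<dots> = Re (cinner x (B x)) - (norm (B x))\<^sup>2 / K"
    using K(2) by (simp add: power2_eq_square field_simps)
  finally show ?thesis using K(2) by (simp add: field_simps)
qed

text \<open>If the infimum \<open>l\<close> of the quadratic form of \<open>P(S)\<close> were negative, then \<open>P - l\<close> would have no
  zero in \<open>[0, \<parallel>S\<parallel>]\<close>, so that \<open>P(S) - l\<close> would be bounded below, against the choice of \<open>l\<close>.\<close>

lemma poly_op_positive:
  assumes S: "positive_op S" and P: "\<And>t. 0 \<le> t \<Longrightarrow> t \<le> norm S \<Longrightarrow> 0 \<le> poly P t"
  shows "positive_op (poly_op P S)"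
proof (rule positive_opI)
  note Sb = positive_op_bounded_ops[OF S]
  show "poly_op P S \<in> bounded_ops" by (rule poly_op_bounded_ops[OF Sb])
  show "cinner (poly_op P S x) y = cinner x (poly_op P S y)" for x y
    by (rule poly_op_selfadjoint[OF S])
  show "0 \<le> Re (cinner x (poly_op P S x))" for x
  proof (rule ccontr)
    define q where "q x = Re (cinner x (poly_op P S x))" for x :: 'a
    have q_scale: "q (r *\<^sub>R y) = r\<^sup>2 * q y" for r y
      by (simp add: q_def cinner_scaleR_left cinner_scaleR_right blinfun.scaleR_right power2_eq_square)
    assume "\<not> 0 \<le> Re (cinner x (poly_op P S x))"
    hence neg: "q x < 0" by (simp add: q_def)
    hence x0: "x \<noteq> 0" by (auto simp: q_def)
    define I where "I = q ` {y. norm y = 1}"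
    define u where "u = (1 / norm x) *\<^sub>R x"
    have u: "norm u = 1" using x0 by (simp add: u_def)
    have qu: "q u < 0" using neg x0 by (simp add: u_def q_scale mult_pos_neg)
    have bdd: "bdd_below I" unfolding I_def
    proof (rule bdd_belowI2[of _ "- norm (poly_op P S)"])
      fix y :: 'a assume "y \<in> {y. norm y = 1}"
      thus "- norm (poly_op P S) \<le> q y"
        using Re_cinner_le_norm[of y "- poly_op P S"] by (simp add: q_def blinfun.minus_left)
    qed
    define l where "l = Inf I"
    have l_le: "l \<le> q y" if "norm y = 1" for y
      unfolding l_def by (rule cInf_lower[OF _ bdd]) (use that in \<open>auto simp: I_def\<close>)
    have l0: "l < 0" using l_le[OF u] qu by simp
    define Q where "Q = P - [:l:]"
    define B where "B = poly_op Q S"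
    have qB: "Re (cinner y (B y)) = q y - l * (norm y)\<^sup>2" for y
      by (simp add: B_def Q_def poly_op_diff poly_op_const blinfun.diff_left blinfun.scaleR_left
          cinner_diff_right cinner_scaleR_right q_def cinner_self)
    have Bpos: "positive_op B"
    proof (rule positive_opI)
      show "B \<in> bounded_ops" unfolding B_def by (rule poly_op_bounded_ops[OF Sb])
      show "cinner (B x) y = cinner x (B y)" for x y
        unfolding B_def by (rule poly_op_selfadjoint[OF S])
      show "0 \<le> Re (cinner y (B y))" for y
      proof (cases "y = 0")
        case False
        have "l \<le> q ((1 / norm y) *\<^sub>R y)" by (rule l_le) (use False in simp)
        thus ?thesis using False by (simp add: qB q_scale power_divide field_simps)
      qed auto
    qed
    have Qpos: "poly Q t > 0" if "t \<in> {0..norm S}" for t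
      using P[of t] that l0 by (simp add: Q_def)
    have "Q \<noteq> 0" using Qpos[of 0] by auto
    moreover have "z \<notin> of_real ` {0..norm S}" if "poly (map_poly of_real Q) z = 0" for z :: complex
    proof
      assume "z \<in> of_real ` {0..norm S}"
      then obtain t where t: "z = of_real t" "t \<in> {0..norm S}" by blast
      have "poly (map_poly of_real Q) (of_real t :: complex) = of_real (poly Q t)"
        by (simp add: poly_altdef degree_map_poly coeff_map_poly)
      thus False using that t Qpos[OF t(2)] by simp
    qed
    ultimately obtain c where c: "c > 0" "\<And>y. c * norm y \<le> norm (cpoly_apply (map_poly of_real Q) S y)"
      using cpoly_apply_bounded_below[OF Sb, of "map_poly of_real Q"] positive_op_bounded_below[OF S]
      by (metis map_poly_eq_0_iff of_real_0 of_real_eq_0_iff)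
    \<comment> \<open>The summand 1 keeps \<open>K\<close> positive even when \<open>B\<close>
      vanishes.\<close>
    define K where "K = norm B + 1"
    have K: "norm B \<le> K" "0 < K" by (auto simp: K_def add_nonneg_pos)
    \<comment> \<open>A lower bound on \<open>norm (B y)\<close> becomes a lower bound on the form
      of \<open>B = P(S) - l\<close> through \<open>B B \<le> K B\<close>. So the form of
      \<open>P(S)\<close> stays a fixed gap above its own infimum \<open>l\<close>.\<close>
    have "l + c\<^sup>2 / K \<le> q y" if y: "norm y = 1" for y
    proof -
      have "c\<^sup>2 \<le> (norm (B y))\<^sup>2"
        using c(1) c(2)[of y] y by (intro power_mono) (auto simp: cpoly_apply_of_real B_def)
      also have "\<dots> \<le> K * (q y - l)"
        using positive_op_norm_sq_le[OF Bpos K, of y] y by (simp add: qB)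
      finally show ?thesis using K(2) by (simp add: field_simps)
    qed
    hence "l + c\<^sup>2 / K \<le> l"
      unfolding l_def[of] I_def by (intro cINF_greatest) (use u in auto)
    moreover have "c\<^sup>2 / K > 0" using c(1) K(2) by simp
    ultimately show False by linarith
  qed
qed

text \<open>The polynomial \<open>M\<^sup>2 - P\<^sup>2\<close> is nonnegative on
  \<open>[0, norm S]\<close>, hence positive at \<open>S\<close>; by self-adjointness of
  \<open>P(S)\<close> this is the norm bound. It makes uniform approximation of functions pass to
  convergence of operators.\<close>

lemma norm_poly_op_le:
  assumes S: "positive_op S" and M: "0 \<le> M"
    and P: "\<And>t. 0 \<le> t \<Longrightarrow> t \<le> norm S \<Longrightarrow> \<bar>poly P t\<bar> \<le> M"
  shows "norm (poly_op P S) \<le> M"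
proof (rule norm_blinfun_bound[OF M])
  fix x
  have "positive_op (poly_op ([:M\<^sup>2:] - P * P) S)"
  proof (rule poly_op_positive[OF S])
    fix t assume "0 \<le> t" "t \<le> norm S"
    from power_mono[OF P[OF this], of 2] show "0 \<le> poly ([:M\<^sup>2:] - P * P) t"
      by (simp add: power2_eq_square)
  qed
  from positive_op_nonneg[OF this, of x]
  have "Re (cinner x (poly_op P S (poly_op P S x))) \<le> M\<^sup>2 * (norm x)\<^sup>2"
    by (simp add: poly_op_diff poly_op_mult poly_op_const blinfun.diff_left blinfun.scaleR_left
        cinner_diff_right cinner_scaleR_right cinner_self[of x])
  hence "(norm (poly_op P S x))\<^sup>2 \<le> (M * norm x)\<^sup>2"
    unfolding poly_op_selfadjoint[OF S, symmetric] norm_sq_eq_Re_cinner[of "poly_op P S x"]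
    by (simp add: power_mult_distrib)
  thus "norm (poly_op P S x) \<le> M * norm x"
    by (rule power2_le_imp_le) (use M in simp)
qed

section \<open>Continuous functions of a positive operator by uniform approximation\<close>

lemma poly_uniform_approximation:
  assumes "continuous_on {0..b} (f :: real \<Rightarrow> real)"
  shows "\<exists>P. uniform_limit {0..b} (\<lambda>n. poly (P n)) f sequentially"
proof -
  have "\<exists>P. \<forall>t\<in>{0..b}. \<bar>f t - poly P t\<bar> < inverse (Suc n)" for n
  proof -
    obtain g where g: "real_polynomial_function g" "\<And>t. t \<in> {0..b} \<Longrightarrow> \<bar>f t - g t\<bar> < inverse (Suc n)"
      using Stone_Weierstrass_real_polynomial_function[OF compact_Icc assms, of "inverse (Suc n)"] by auto
    obtain a m where gm: "g = (\<lambda>t. \<Sum>i\<le>m. a i * t ^ i)"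
      using g(1) unfolding real_polynomial_function_iff_sum by blast
    have "g = poly (\<Sum>i\<le>m. monom (a i) i)" unfolding gm by (rule ext) (simp add: poly_sum poly_monom)
    thus ?thesis using g(2) by blast
  qed
  then obtain P where P: "\<And>n t. t \<in> {0..b} \<Longrightarrow> \<bar>f t - poly (P n) t\<bar> < inverse (Suc n)" by metis
  have "uniform_limit {0..b} (\<lambda>n. poly (P n)) f sequentially"
  proof (rule uniform_limitI)
    fix e :: real assume "e > 0"
    then obtain N where N: "inverse (real (Suc N)) < e" using reals_Archimedean by blast
    show "\<forall>\<^sub>F n in sequentially. \<forall>t\<in>{0..b}. dist (poly (P n) t) (f t) < e"
      using eventually_ge_at_top[of N]
    proof eventually_elim
      case (elim n)
      hence "inverse (real (Suc n)) \<le> inverse (real (Suc N))" by simp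
      hence "inverse (real (Suc n)) < e" using N by linarith
      show ?case
      proof
        fix t assume "t \<in> {0..b}"
        from P[OF this, of n] show "dist (poly (P n) t) (f t) < e"
          using \<open>inverse (real (Suc n)) < e\<close> by (simp only: dist_real_def abs_minus_commute)
      qed
    qed
  qed
  thus ?thesis by blast
qed

abbreviation poly_approx :: "('a::chilbert_space \<Rightarrow>\<^sub>L 'a) \<Rightarrow> (nat \<Rightarrow> real poly) \<Rightarrow> (real \<Rightarrow> real) \<Rightarrow> bool" where
  "poly_approx S P f \<equiv> uniform_limit {0..norm S} (\<lambda>n. poly (P n)) f sequentially"

text \<open>With \<open>Q = P\<close> this is the Cauchy property; with two different sequences it
  shows that the limit does not depend on the approximation, as the \<open>THE\<close> in
  \<open>fun_op\<close> demands.\<close>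

lemma poly_op_approx_dist:
  assumes S: "positive_op S"
    and P: "poly_approx S P f"
    and Q: "poly_approx S Q f"
    and "e > 0"
  shows "\<exists>N. \<forall>m\<ge>N. \<forall>n\<ge>N. dist (poly_op (P m) S) (poly_op (Q n) S) < e"
proof -
  \<comment> \<open>Two errors of \<open>e / 4\<close> give only a weak bound \<open>e / 2\<close>
    on the operator norm, which still leaves room for the strict bound \<open>e\<close>.\<close>
  have "e / 4 > 0" using assms by simp
  from eventually_conj[OF uniform_limitD[OF P this] uniform_limitD[OF Q this]]
  obtain N where "\<forall>n\<ge>N. (\<forall>t\<in>{0..norm S}. dist (poly (P n) t) (f t) < e / 4) \<and>
      (\<forall>t\<in>{0..norm S}. dist (poly (Q n) t) (f t) < e / 4)"
    unfolding eventually_sequentially by blast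
  hence N: "\<And>n t. n \<ge> N \<Longrightarrow> t \<in> {0..norm S} \<Longrightarrow> dist (poly (P n) t) (f t) < e / 4"
    "\<And>n t. n \<ge> N \<Longrightarrow> t \<in> {0..norm S} \<Longrightarrow> dist (poly (Q n) t) (f t) < e / 4"
    by blast+
  have "dist (poly_op (P m) S) (poly_op (Q n) S) < e" if "m \<ge> N" "n \<ge> N" for m n
  proof -
    have "norm (poly_op (P m - Q n) S) \<le> e / 2"
    proof (rule norm_poly_op_le[OF S])
      fix t assume "0 \<le> t" "t \<le> norm S"
      thus "\<bar>poly (P m - Q n) t\<bar> \<le> e / 2"
        using N(1)[OF that(1), of t] N(2)[OF that(2), of t] unfolding dist_real_def poly_diff
        by (simp add: abs_if split: if_splits)
    qed (use assms in auto)
    thus ?thesis using \<open>e > 0\<close> by (simp add: dist_norm poly_op_diff)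
  qed
  thus ?thesis by blast
qed

lemma fun_op_tendsto:
  assumes S: "positive_op S" and f: "continuous_on {0..norm S} f"
    and P: "poly_approx S P f"
  shows "(\<lambda>n. poly_op (P n) S) \<longlonglongrightarrow> fun_op f S"
proof -
  have "Cauchy (\<lambda>n. poly_op (P n) S)"
    unfolding Cauchy_def using poly_op_approx_dist[OF S P P] by blast
  then obtain R where R: "(\<lambda>n. poly_op (P n) S) \<longlonglongrightarrow> R"
    using Cauchy_convergent convergent_def by blast
  have lim: "(\<lambda>n. poly_op (Q n) S) \<longlonglongrightarrow> R"
    if Q: "poly_approx S Q f" for Q
  proof (rule LIMSEQ_I)
    fix e :: real assume "e > 0"
    hence e2: "e / 2 > 0" by simp
    obtain N where N: "\<And>m n. m \<ge> N \<Longrightarrow> n \<ge> N \<Longrightarrow> dist (poly_op (P m) S) (poly_op (Q n) S) < e / 2"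
      using poly_op_approx_dist[OF S P Q e2] by blast
    obtain M where M: "\<And>n. n \<ge> M \<Longrightarrow> norm (poly_op (P n) S - R) < e / 2"
      using LIMSEQ_D[OF R e2] by blast
    have "norm (poly_op (Q n) S - R) < e" if "n \<ge> max N M" for n
    proof -
      have "dist (poly_op (P n) S) (poly_op (Q n) S) < e / 2" "dist (poly_op (P n) S) R < e / 2"
        using N[of n n] M[of n] that by (auto simp: dist_norm)
      from dist_triangle_half_r[OF this] show ?thesis by (simp add: dist_norm)
    qed
    thus "\<exists>N. \<forall>n\<ge>N. norm (poly_op (Q n) S - R) < e" by blast
  qed
  have "fun_op f S = R"
    unfolding fun_op_def
  proof (rule the_equality)
    \<comment> \<open>The given \<open>P\<close> is itself an approximating sequence, so the
      universally quantified condition is not vacuous and pins down \<open>R'\<close>.\<close>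
    show "R' = R" if "\<forall>P. poly_approx S P f
      \<longrightarrow> (\<lambda>n. poly_op (P n) S) \<longlonglongrightarrow> R'" for R'
      using that P R LIMSEQ_unique by blast
  qed (use lim in blast)
  thus ?thesis using R by simp
qed

lemma fun_op_poly: "positive_op S \<Longrightarrow> fun_op (poly P) S = poly_op P S"
  using fun_op_tendsto[of S "poly P" "\<lambda>_. P"]
  by (simp add: LIMSEQ_const_iff uniform_limit_const continuous_on_poly continuous_on_id)

lemma fun_op_cong: "(\<And>t. 0 \<le> t \<Longrightarrow> t \<le> norm S \<Longrightarrow> f t = g t) \<Longrightarrow> fun_op f S = fun_op g S"
proof -
  assume "\<And>t. 0 \<le> t \<Longrightarrow> t \<le> norm S \<Longrightarrow> f t = g t"
  hence "poly_approx S P f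
      \<longleftrightarrow> poly_approx S P g" for P
    by (intro uniform_limit_cong') auto
  thus ?thesis by (simp add: fun_op_def)
qed

lemma fun_op_add:
  assumes S: "positive_op S" and f: "continuous_on {0..norm S} f" and g: "continuous_on {0..norm S} g"
  shows "fun_op (\<lambda>t. f t + g t) S = fun_op f S + fun_op g S"
proof -
  obtain P Q where P: "poly_approx S P f"
    and Q: "poly_approx S Q g"
    using poly_uniform_approximation f g by blast
  have "uniform_limit {0..norm S} (\<lambda>n. poly (P n + Q n)) (\<lambda>t. f t + g t) sequentially"
    using uniform_limit_add[OF P Q] by (simp add: poly_add[THEN ext])
  from fun_op_tendsto[OF S continuous_on_add[OF f g] this]
  have "(\<lambda>n. poly_op (P n) S + poly_op (Q n) S) \<longlonglongrightarrow> fun_op (\<lambda>t. f t + g t) S"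
    by (simp add: poly_op_add)
  moreover have "(\<lambda>n. poly_op (P n) S + poly_op (Q n) S) \<longlonglongrightarrow> fun_op f S + fun_op g S"
    by (intro tendsto_add fun_op_tendsto S f g P Q)
  ultimately show ?thesis by (rule LIMSEQ_unique)
qed

lemma fun_op_mult:
  assumes S: "positive_op S" and f: "continuous_on {0..norm S} f" and g: "continuous_on {0..norm S} g"
  shows "fun_op (\<lambda>t. f t * g t) S = fun_op f S o\<^sub>L fun_op g S"
proof -
  obtain P Q where P: "poly_approx S P f"
    and Q: "poly_approx S Q g"
    using poly_uniform_approximation f g by blast
  have "uniform_limit {0..norm S} (\<lambda>n. poly (P n * Q n)) (\<lambda>t. f t * g t) sequentially"
    using uniform_lim_mult[OF P Q] compact_imp_bounded[OF compact_continuous_image[OF f compact_Icc]]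
      compact_imp_bounded[OF compact_continuous_image[OF g compact_Icc]] by (simp add: poly_mult[THEN ext])
  from fun_op_tendsto[OF S continuous_on_mult[OF f g] this]
  have "(\<lambda>n. poly_op (P n) S o\<^sub>L poly_op (Q n) S) \<longlonglongrightarrow> fun_op (\<lambda>t. f t * g t) S"
    by (simp add: poly_op_mult)
  moreover have "(\<lambda>n. poly_op (P n) S o\<^sub>L poly_op (Q n) S) \<longlonglongrightarrow> (fun_op f S o\<^sub>L fun_op g S)"
    by (intro bounded_bilinear.tendsto[OF bounded_bilinear_blinfun_compose] fun_op_tendsto S f g P Q)
  ultimately show ?thesis by (rule LIMSEQ_unique)
qed

lemma tendsto_blinfun_apply: "T \<longlonglongrightarrow> R \<Longrightarrow> (\<lambda>n. blinfun_apply (T n) x) \<longlonglongrightarrow> blinfun_apply R x"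
  by (rule bounded_linear.tendsto[OF blinfun.bounded_linear_left])

lemma
  assumes S: "positive_op S" and f: "continuous_on {0..norm S} f"
  shows fun_op_bounded_ops: "fun_op f S \<in> bounded_ops"
    and fun_op_selfadjoint: "cinner (fun_op f S x) y = cinner x (fun_op f S y)"
proof -
  obtain P where P: "poly_approx S P f"
    using poly_uniform_approximation[OF f] by blast
  note lim = tendsto_blinfun_apply[OF fun_op_tendsto[OF S f P]]
  show "fun_op f S \<in> bounded_ops"
    unfolding bounded_ops_def
  proof (intro CollectI allI)
    fix c x
    have "(\<lambda>n. poly_op (P n) S (c *\<^sub>C x)) \<longlonglongrightarrow> c *\<^sub>C fun_op f S x"
      using tendsto_scaleC[OF lim, of c x]
      by (simp add: bounded_opsD[OF poly_op_bounded_ops[OF positive_op_bounded_ops[OF S]]])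
    thus "fun_op f S (c *\<^sub>C x) = c *\<^sub>C fun_op f S x"
      using LIMSEQ_unique lim by blast
  qed
  have "(\<lambda>n. cinner (poly_op (P n) S x) y) \<longlonglongrightarrow> cinner (fun_op f S x) y"
    by (intro tendsto_cinner lim tendsto_const)
  moreover have "(\<lambda>n. cinner (poly_op (P n) S x) y) \<longlonglongrightarrow> cinner x (fun_op f S y)"
    unfolding poly_op_selfadjoint[OF S] by (intro tendsto_cinner lim tendsto_const)
  ultimately show "cinner (fun_op f S x) y = cinner x (fun_op f S y)" by (rule LIMSEQ_unique)
qed

text \<open>\<open>f(S)\<close> is the square of the self-adjoint operator obtained from the square
  root of \<open>f\<close>.\<close>

lemma fun_op_positive:
  assumes S: "positive_op S" and f: "continuous_on {0..norm S} f"
    and nn: "\<And>t. 0 \<le> t \<Longrightarrow> t \<le> norm S \<Longrightarrow> 0 \<le> f t"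
  shows "positive_op (fun_op f S)"
proof (rule positive_opI)
  have r: "continuous_on {0..norm S} (\<lambda>t. sqrt (f t))" by (intro continuous_intros f)
  have "fun_op f S = fun_op (\<lambda>t. sqrt (f t) * sqrt (f t)) S"
    by (rule fun_op_cong) (simp add: nn)
  hence eq: "fun_op f S = fun_op (\<lambda>t. sqrt (f t)) S o\<^sub>L fun_op (\<lambda>t. sqrt (f t)) S"
    using fun_op_mult[OF S r r] by simp
  show "0 \<le> Re (cinner x (fun_op f S x))" for x
    unfolding eq blinfun_apply_blinfun_compose fun_op_selfadjoint[OF S r, symmetric] cinner_self by simp
qed (use fun_op_bounded_ops[OF S f] fun_op_selfadjoint[OF S f] in auto)

text \<open>The way in which scalar inequalities on \<open>[0, norm S]\<close> become inequalities
  between diagonal entries, and after summation between traces.\<close>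

lemma fun_op_mono:
  assumes S: "positive_op S" and f: "continuous_on {0..norm S} f" and g: "continuous_on {0..norm S} g"
    and le: "\<And>t. 0 \<le> t \<Longrightarrow> t \<le> norm S \<Longrightarrow> f t \<le> g t"
  shows "Re (cinner x (fun_op f S x)) \<le> Re (cinner x (fun_op g S x))"
proof -
  have h: "continuous_on {0..norm S} (\<lambda>t. g t - f t)" by (intro continuous_intros f g)
  have "fun_op g S = fun_op f S + fun_op (\<lambda>t. g t - f t) S"
    using fun_op_add[OF S f h] by simp
  moreover have "0 \<le> Re (cinner x (fun_op (\<lambda>t. g t - f t) S x))"
    by (intro positive_op_nonneg fun_op_positive S h) (simp add: le)
  ultimately show ?thesis by (simp add: blinfun.add_left cinner_add_right)
qed

lemma fun_op_id: "positive_op S \<Longrightarrow> fun_op (\<lambda>t. t) S = S"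
  using fun_op_poly[of S "[:0, 1:]"] fun_op_cong[of S "poly [:0, 1:]" "\<lambda>t. t"]
  by (simp add: poly_op_pCons)

lemma fun_op_const: "positive_op S \<Longrightarrow> fun_op (\<lambda>t. c) S = c *\<^sub>R id_blinfun"
  using fun_op_poly[of S "[:c:]"] fun_op_cong[of S "poly [:c:]" "\<lambda>t. c"]
  by (simp add: poly_op_pCons)

lemma fun_op_cmult:
  assumes "positive_op S" "continuous_on {0..norm S} f"
  shows "fun_op (\<lambda>t. c * f t) S = c *\<^sub>R fun_op f S"
  using fun_op_mult[OF assms(1) continuous_on_const assms(2), of c] fun_op_const[OF assms(1), of c]
  by (simp add: bounded_bilinear.scaleR_left[OF bounded_bilinear_blinfun_compose])

lemma positive_op_scaleR: "positive_op S \<Longrightarrow> 0 \<le> r \<Longrightarrow> positive_op (r *\<^sub>R S)"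
  by (rule positive_opI)
     (auto simp: positive_op_bounded_ops blinfun.scaleR_left cinner_scaleR_left cinner_scaleR_right
       positive_op_selfadjoint positive_op_nonneg)

lemma fun_op_scaleR:
  assumes S: "positive_op S" and r: "0 \<le> r" and f: "continuous_on {0..r * norm S} f"
  shows "fun_op f (r *\<^sub>R S) = fun_op (\<lambda>t. f (r * t)) S"
proof -
  obtain P where P: "uniform_limit {0..r * norm S} (\<lambda>n. poly (P n)) f sequentially"
    using poly_uniform_approximation f by blast
  have maps: "(\<lambda>t. r * t) \<in> {0..norm S} \<rightarrow> {0..r * norm S}" using r by (auto intro: mult_left_mono)
  have "uniform_limit {0..norm S} (\<lambda>n. poly (pcompose (P n) [:0, r:])) (\<lambda>t. f (r * t)) sequentially"
    using uniform_limit_compose'[OF P maps] by (simp add: poly_pcompose[THEN ext] mult.commute)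
  moreover have "continuous_on {0..norm S} (\<lambda>t. f (r * t))"
    by (rule continuous_on_compose2[OF f]) (use maps in \<open>auto intro!: continuous_intros\<close>)
  ultimately have "(\<lambda>n. poly_op (pcompose (P n) [:0, r:]) S) \<longlonglongrightarrow> fun_op (\<lambda>t. f (r * t)) S"
    by (intro fun_op_tendsto S)
  moreover have "poly_op [:0, r:] S = r *\<^sub>R S"
    by (simp add: poly_op_pCons bounded_bilinear.scaleR_right[OF bounded_bilinear_blinfun_compose])
  moreover have "(\<lambda>n. poly_op (P n) (r *\<^sub>R S)) \<longlonglongrightarrow> fun_op f (r *\<^sub>R S)"
    using f P r by (intro fun_op_tendsto positive_op_scaleR S) auto
  ultimately show ?thesis by (simp add: poly_op_pcompose LIMSEQ_unique)
qed

section \<open>Existence and uniqueness of positive square roots\<close>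

lemma positive_sqrt_exists:
  assumes A: "positive_op A"
  shows "\<exists>S. positive_op S \<and> S o\<^sub>L S = A"
proof -
  have c: "continuous_on {0..norm A} sqrt" by (intro continuous_intros)
  have "fun_op sqrt A o\<^sub>L fun_op sqrt A = fun_op (\<lambda>t. t) A"
    unfolding fun_op_mult[OF A c c, symmetric] by (rule fun_op_cong) simp
  thus ?thesis using fun_op_positive[OF A c] fun_op_id[OF A] by auto
qed

text \<open>If polynomials \<open>P n\<close> tend to \<open>sqrt\<close>, then \<open>P n\<close>
  applied to \<open>S o\<^sub>L S\<close> tends to \<open>S\<close>, for any positive
  \<open>S\<close>. Two roots with the same square are therefore limits of the same
  sequence.\<close>

lemma positive_sqrt_unique:
  assumes S1: "positive_op S1" and S2: "positive_op S2" and eq: "S1 o\<^sub>L S1 = S2 o\<^sub>L S2"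
  shows "S1 = S2"
proof -
  \<comment> \<open>Large enough that squaring maps both \<open>[0, norm S1]\<close> and
    \<open>[0, norm S2]\<close> into \<open>[0, b]\<close>, so that one approximating sequence
    serves both operators.\<close>
  define b where "b = (max (norm S1) (norm S2))\<^sup>2"
  obtain P where P: "uniform_limit {0..b} (\<lambda>n. poly (P n)) sqrt sequentially"
    using poly_uniform_approximation[of b sqrt] continuous_on_real_sqrt[OF continuous_on_id] by blast
  have lim: "(\<lambda>n. poly_op (P n) (S o\<^sub>L S)) \<longlonglongrightarrow> S"
    if S: "positive_op S" "norm S \<le> max (norm S1) (norm S2)" for S :: "'a \<Rightarrow>\<^sub>L 'a"
  proof -
    have maps: "(\<lambda>t. t\<^sup>2) \<in> {0..norm S} \<rightarrow> {0..b}"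
      using S(2) by (auto simp: b_def intro!: power_mono)
    have "uniform_limit {0..norm S} (\<lambda>n. poly (pcompose (P n) [:0, 0, 1:])) (\<lambda>t. sqrt (t\<^sup>2)) sequentially"
      using uniform_limit_compose'[OF P maps] by (simp add: poly_pcompose[THEN ext] power2_eq_square)
    moreover have "continuous_on {0..norm S} (\<lambda>t. sqrt (t\<^sup>2))" by (intro continuous_intros)
    ultimately have "(\<lambda>n. poly_op (pcompose (P n) [:0, 0, 1:]) S) \<longlonglongrightarrow> fun_op (\<lambda>t. sqrt (t\<^sup>2)) S"
      by (intro fun_op_tendsto S)
    moreover have "fun_op (\<lambda>t. sqrt (t\<^sup>2)) S = S"
      using fun_op_cong[of S "\<lambda>t. sqrt (t\<^sup>2)" "\<lambda>t. t"] fun_op_id[OF S(1)] by simp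
    moreover have "poly_op [:0, 0, 1:] S = S o\<^sub>L S" by (simp add: poly_op_pCons)
    ultimately show ?thesis by (simp add: poly_op_pcompose)
  qed
  show ?thesis using LIMSEQ_unique[OF lim[OF S1] lim[OF S2, folded eq]] by simp
qed

section \<open>The absolute value\<close>

lemma positive_adjoint_compose:
  assumes T: "T \<in> bounded_ops"
  shows "positive_op (adjoint_op T o\<^sub>L T)"
  by (rule positive_opI)
     (auto simp: cinner_adjoint_left[OF T] cinner_adjoint_right[OF T] adjoint_op_bounded_ops T cinner_self)

lemma abs_op:
  assumes T: "T \<in> bounded_ops"
  shows positive_abs_op: "positive_op (abs_op T)"
    and abs_op_square: "abs_op T o\<^sub>L abs_op T = adjoint_op T o\<^sub>L T"
proof -
  have "\<exists>!S. positive_op S \<and> S o\<^sub>L S = adjoint_op T o\<^sub>L T"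
    using positive_sqrt_exists[OF positive_adjoint_compose[OF T]] positive_sqrt_unique by metis
  from theI'[OF this] show "positive_op (abs_op T)" "abs_op T o\<^sub>L abs_op T = adjoint_op T o\<^sub>L T"
    by (auto simp: abs_op_def)
qed

lemma abs_op_eqI:
  assumes "T \<in> bounded_ops" "positive_op S" "S o\<^sub>L S = adjoint_op T o\<^sub>L T"
  shows "abs_op T = S"
  using positive_sqrt_unique positive_abs_op abs_op_square assms by metis

lemma norm_abs_op_apply:
  assumes T: "T \<in> bounded_ops"
  shows "norm (abs_op T x) = norm (T x)"
proof -
  have "cinner (abs_op T x) (abs_op T x) = cinner x ((abs_op T o\<^sub>L abs_op T) x)"
    by (simp add: positive_op_selfadjoint[OF positive_abs_op[OF T]])
  also have "\<dots> = cinner (T x) (T x)"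
    unfolding abs_op_square[OF T] by (simp add: cinner_adjoint_right[OF T])
  finally have "(norm (abs_op T x))\<^sup>2 = (norm (T x))\<^sup>2" unfolding cinner_self of_real_eq_iff .
  thus ?thesis by (simp add: power2_eq_iff_nonneg)
qed

lemma abs_op_scaleC:
  assumes T: "T \<in> bounded_ops"
  shows "abs_op (op_scaleC c T) = cmod c *\<^sub>R abs_op T"
proof (rule abs_op_eqI)
  show cT: "op_scaleC c T \<in> bounded_ops" by (rule op_scaleC_bounded_ops[OF T])
  show "positive_op (cmod c *\<^sub>R abs_op T)" by (intro positive_op_scaleR positive_abs_op T) simp
  have sq: "abs_op T (abs_op T x) = adjoint_op T (T x)" for x
    using arg_cong[OF abs_op_square[OF T], of "\<lambda>A. blinfun_apply A x"] by simp
  have adj: "adjoint_op (op_scaleC c T) = op_scaleC (cnj c) (adjoint_op T)"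
    by (rule adjoint_op_unique[OF cT])
       (simp add: op_scaleC_apply cinner_scaleC_left cinner_scaleC_right cinner_adjoint_left[OF T])
  have cc: "complex_of_real (cmod c) * complex_of_real (cmod c) = c * cnj c"
    by (simp add: complex_norm_square[symmetric] power2_eq_square)
  show "(cmod c *\<^sub>R abs_op T) o\<^sub>L (cmod c *\<^sub>R abs_op T) = adjoint_op (op_scaleC c T) o\<^sub>L op_scaleC c T"
    by (rule blinfun_eqI)
       (simp add: adj op_scaleC_apply blinfun.scaleR_left blinfun.scaleR_right sq scaleR_scaleC
         scaleC_scaleC bounded_opsD[OF adjoint_op_bounded_ops[OF T]]
         bounded_opsD[OF positive_op_bounded_ops[OF positive_abs_op[OF T]]] cc mult.commute[of "cnj c"])
qed

section \<open>Orthonormal expansions\<close>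

text \<open>The very \<open>SOME\<close> term that occurs in \<open>trace_op\<close>, so that traces
  are literally sums over \<open>onb\<close>. One basis per space is thereby fixed for everything
  that follows.\<close>

definition onb :: "'a::chilbert_space set" where
  "onb = (SOME E. orthonormal_basis E)"

lemma orthonormal_basis_onb: "orthonormal_basis onb"
  unfolding onb_def using orthonormal_basis_exists by (rule someI_ex)

lemma norm_onb: "e \<in> onb \<Longrightarrow> norm e = 1"
  and cinner_onb: "e \<in> onb \<Longrightarrow> e' \<in> onb \<Longrightarrow> cinner e e' = (if e = e' then 1 else 0)"
  and closure_cspan_onb: "closure (cspan onb) = UNIV"
  using orthonormal_basis_onb by (auto simp: orthonormal_basis_def cinner_self)

lemma cinner_sum_onb:
  assumes "finite F" "F \<subseteq> onb" "e \<in> F"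
  shows "cinner e (\<Sum>f\<in>F. c f *\<^sub>C f) = c e"
proof -
  have "cinner e (\<Sum>f\<in>F. c f *\<^sub>C f) = (\<Sum>f\<in>F. if f = e then c f else 0)"
    unfolding cinner_sum_right cinner_scaleC_right
    by (rule sum.cong) (use assms(2,3) in \<open>auto simp: cinner_onb subset_iff\<close>)
  thus ?thesis using assms by simp
qed

lemma norm_sum_onb_sq:
  assumes "finite F" "F \<subseteq> onb"
  shows "(norm (\<Sum>f\<in>F. c f *\<^sub>C f))\<^sup>2 = (\<Sum>f\<in>F. (cmod (c f))\<^sup>2)"
proof -
  have "cinner (\<Sum>f\<in>F. c f *\<^sub>C f) (\<Sum>f\<in>F. c f *\<^sub>C f) = (\<Sum>f\<in>F. cnj (c f) * c f)"
    unfolding cinner_sum_left[of _ F] cinner_scaleC_left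
    by (rule sum.cong) (use cinner_sum_onb[OF assms] in auto)
  also have "\<dots> = of_real (\<Sum>f\<in>F. (cmod (c f))\<^sup>2)"
    by (simp add: complex_norm_square mult.commute del: of_real_power)
  finally show ?thesis unfolding cinner_self of_real_eq_iff .
qed

definition onb_proj :: "'a::chilbert_space set \<Rightarrow> 'a \<Rightarrow> 'a" where
  "onb_proj F v = (\<Sum>e\<in>F. cinner e v *\<^sub>C e)"

lemma norm_onb_residual_sq:
  assumes F: "finite F" "F \<subseteq> onb"
  shows "(norm (v - onb_proj F v))\<^sup>2 = (norm v)\<^sup>2 - (\<Sum>e\<in>F. (cmod (cinner e v))\<^sup>2)"
proof -
  have "cinner v (onb_proj F v) = (\<Sum>e\<in>F. cinner e v * cnj (cinner e v))"
    unfolding onb_proj_def cinner_sum_right cinner_scaleC_right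
    by (rule sum.cong) (simp_all add: cinner_commute[of v])
  also have "\<dots> = of_real (\<Sum>e\<in>F. (cmod (cinner e v))\<^sup>2)"
    by (simp add: complex_norm_square del: of_real_power)
  finally have "Re (cinner v (onb_proj F v)) = (\<Sum>e\<in>F. (cmod (cinner e v))\<^sup>2)" by simp
  thus ?thesis unfolding norm_diff_sq using norm_sum_onb_sq[OF F, of "\<lambda>e. cinner e v"]
    by (simp add: onb_proj_def)
qed

lemma bessel_ineq:
  assumes "finite F" "F \<subseteq> onb"
  shows "(\<Sum>e\<in>F. (cmod (cinner e v))\<^sup>2) \<le> (norm v)\<^sup>2"
  using norm_onb_residual_sq[OF assms, of v] zero_le_power2[of "norm (v - onb_proj F v)"] by linarith

lemma onb_expansion:
  fixes v :: "'a::chilbert_space"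
  assumes "v \<in> cspan onb"
  obtains F c where "finite F" "F \<subseteq> onb" "v = (\<Sum>e\<in>F. c e *\<^sub>C e)"
  using assms unfolding cvs.span_explicit by auto

text \<open>Take \<open>w\<close> in the span close to \<open>v\<close>, and let \<open>F\<close> be
  the basis vectors occurring in \<open>w\<close>. Projection onto \<open>F\<close> fixes
  \<open>w\<close>, so the residual of \<open>v\<close> equals that of \<open>v - w\<close> and is
  no longer than \<open>v - w\<close>. This finite form of Parseval replaces infinite
  expansions.\<close>

lemma parseval_approx:
  fixes v :: "'a::chilbert_space"
  assumes "0 < \<epsilon>"
  shows "\<exists>F. finite F \<and> F \<subseteq> onb \<and> (norm v)\<^sup>2 \<le> (\<Sum>e\<in>F. (cmod (cinner e v))\<^sup>2) + \<epsilon>"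
proof -
  have "v \<in> closure (cspan onb)" by (simp add: closure_cspan_onb)
  then obtain w where w: "w \<in> cspan onb" "dist w v < sqrt \<epsilon>"
    unfolding closure_approachable using assms real_sqrt_gt_zero by blast
  obtain F c where F: "finite F" "F \<subseteq> onb" and wF: "w = (\<Sum>e\<in>F. c e *\<^sub>C e)"
    using onb_expansion[OF w(1)] .
  have "onb_proj F w = w"
    unfolding onb_proj_def by (simp add: wF cinner_sum_onb[OF F])
  hence "v - onb_proj F v = (v - w) - onb_proj F (v - w)"
    by (simp add: onb_proj_def cinner_diff_right cvs.scale_left_diff_distrib sum_subtractf)
  hence "(norm (v - onb_proj F v))\<^sup>2 \<le> (norm (v - w))\<^sup>2"
    unfolding \<open>v - onb_proj F v = _\<close> norm_onb_residual_sq[OF F] by (simp add: sum_nonneg)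
  also have "\<dots> \<le> (sqrt \<epsilon>)\<^sup>2"
    using w(2) by (intro power_mono) (auto simp: dist_norm norm_minus_commute)
  also have "\<dots> = \<epsilon>" using assms by simp
  finally show ?thesis using F norm_onb_residual_sq[OF F, of v] by (intro exI[of _ F]) auto
qed

text \<open>For a finite \<open>onb\<close> the approximate Parseval identity becomes exact, so
  every vector equals its projection and the basis spans algebraically, which is the sense of
  dimension in the hypothesis.\<close>

lemma infinite_onb:
  assumes "infinite_dimensional TYPE('a::chilbert_space)"
  shows "infinite (onb :: 'a set)"
proof
  assume fin: "finite (onb :: 'a set)"
  have "v \<in> cspan onb" for v :: 'a
  proof -
    have "(norm v)\<^sup>2 \<le> (\<Sum>e\<in>onb. (cmod (cinner e v))\<^sup>2)"
    proof (rule field_le_epsilon)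
      fix \<epsilon> :: real assume "0 < \<epsilon>"
      from parseval_approx[OF this, of v] obtain F where F: "finite F" "F \<subseteq> onb"
        "(norm v)\<^sup>2 \<le> (\<Sum>e\<in>F. (cmod (cinner e v))\<^sup>2) + \<epsilon>" by blast
      moreover have "(\<Sum>e\<in>F. (cmod (cinner e v))\<^sup>2) \<le> (\<Sum>e\<in>onb. (cmod (cinner e v))\<^sup>2)"
        by (rule sum_mono2) (use fin F in auto)
      ultimately show "(norm v)\<^sup>2 \<le> (\<Sum>e\<in>onb. (cmod (cinner e v))\<^sup>2) + \<epsilon>" by linarith
    qed
    hence "(norm (v - onb_proj onb v))\<^sup>2 \<le> 0" by (simp only: norm_onb_residual_sq[OF fin order_refl])
    hence "v = onb_proj onb v" by simp
    moreover have "onb_proj onb v \<in> cspan onb"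
      unfolding onb_proj_def by (intro cvs.span_sum cvs.span_scale cvs.span_base)
    ultimately show ?thesis by simp
  qed
  thus False using assms fin unfolding infinite_dimensional_def by blast
qed

section \<open>Hilbert--Schmidt and trace bounds\<close>

text \<open>\<open>c\<close> bounds the square of the Hilbert-Schmidt norm. Bounding finite partial
  sums keeps summability questions out of the estimates.\<close>

definition hs_le :: "('a::chilbert_space \<Rightarrow>\<^sub>L 'a) \<Rightarrow> real \<Rightarrow> bool" where
  "hs_le T c \<longleftrightarrow> (\<forall>F. finite F \<longrightarrow> F \<subseteq> onb \<longrightarrow> (\<Sum>e\<in>F. (norm (T e))\<^sup>2) \<le> c)"

text \<open>Meant for positive \<open>R\<close>, where \<open>trace_op_le_iff\<close> identifies it
  with a bound on the extended real trace.\<close>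

definition trace_le :: "('a::chilbert_space \<Rightarrow>\<^sub>L 'a) \<Rightarrow> real \<Rightarrow> bool" where
  "trace_le R c \<longleftrightarrow> (\<forall>F. finite F \<longrightarrow> F \<subseteq> onb \<longrightarrow> (\<Sum>e\<in>F. Re (cinner e (R e))) \<le> c)"

lemma hs_leI: "(\<And>F. finite F \<Longrightarrow> F \<subseteq> onb \<Longrightarrow> (\<Sum>e\<in>F. (norm (blinfun_apply T e))\<^sup>2) \<le> c) \<Longrightarrow> hs_le T c"
  and hs_leD: "hs_le T c \<Longrightarrow> finite F \<Longrightarrow> F \<subseteq> onb \<Longrightarrow> (\<Sum>e\<in>F. (norm (blinfun_apply T e))\<^sup>2) \<le> c"
  by (auto simp: hs_le_def)

lemma trace_leI: "(\<And>F. finite F \<Longrightarrow> F \<subseteq> onb \<Longrightarrow> (\<Sum>e\<in>F. Re (cinner e (blinfun_apply R e))) \<le> c) \<Longrightarrow> trace_le R c"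
  and trace_leD: "trace_le R c \<Longrightarrow> finite F \<Longrightarrow> F \<subseteq> onb \<Longrightarrow> (\<Sum>e\<in>F. Re (cinner e (blinfun_apply R e))) \<le> c"
  by (auto simp: trace_le_def)

lemma trace_le_nonneg: "trace_le R c \<Longrightarrow> 0 \<le> c"
  using trace_leD[of R c "{}"] by simp

lemma hs_le_mono: "hs_le T c \<Longrightarrow> c \<le> d \<Longrightarrow> hs_le T d"
  by (auto simp: hs_le_def intro: order_trans)

lemma trace_op_eq_SUP:
  "trace_op R = (SUP F\<in>{F. finite F \<and> F \<subseteq> onb}. \<Sum>e\<in>F. ennreal (Re (cinner e (blinfun_apply R e))))"
  unfolding trace_op_def onb_def[symmetric] by (rule nonneg_infsum_complete) simp

lemma trace_op_le_iff:
  assumes R: "positive_op R" and c: "0 \<le> c"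
  shows "trace_op R \<le> ennreal c \<longleftrightarrow> trace_le R c"
proof -
  have "(\<Sum>e\<in>F. ennreal (Re (cinner e (blinfun_apply R e)))) = ennreal (\<Sum>e\<in>F. Re (cinner e (blinfun_apply R e)))" for F
    by (rule sum_ennreal) (rule positive_op_nonneg[OF R])
  thus ?thesis unfolding trace_op_eq_SUP SUP_le_iff trace_le_def using c
    by (auto simp: ennreal_le_iff)
qed

text \<open>The operator norm is at most the Hilbert-Schmidt norm: Cauchy-Schwarz on finite
  combinations of basis vectors, then density of their span.\<close>

lemma norm_sq_le_of_hs_le:
  assumes T: "T \<in> bounded_ops" and hs: "hs_le T c"
  shows "(norm (T v))\<^sup>2 \<le> c * (norm v)\<^sup>2"
proof -
  have "cspan onb \<subseteq> {v. (norm (T v))\<^sup>2 \<le> c * (norm v)\<^sup>2}"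
  proof
    fix v :: 'a assume "v \<in> cspan onb"
    then obtain F a where F: "finite F" "F \<subseteq> onb" and v: "v = (\<Sum>e\<in>F. a e *\<^sub>C e)"
      by (rule onb_expansion)
    have "norm (T v) \<le> (\<Sum>e\<in>F. cmod (a e) * norm (T e))"
      unfolding v blinfun.sum_right
      by (rule order_trans[OF norm_sum]) (simp add: bounded_opsD[OF T] norm_scaleC)
    hence "(norm (T v))\<^sup>2 \<le> (\<Sum>e\<in>F. cmod (a e) * norm (T e))\<^sup>2" by (rule power_mono) simp
    also have "\<dots> \<le> (\<Sum>e\<in>F. (cmod (a e))\<^sup>2) * (\<Sum>e\<in>F. (norm (T e))\<^sup>2)"
      by (rule Cauchy_Schwarz_ineq_sum)
    also have "\<dots> \<le> (\<Sum>e\<in>F. (cmod (a e))\<^sup>2) * c"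
      by (intro mult_left_mono hs_leD[OF hs F] sum_nonneg) simp
    finally show "v \<in> {v. (norm (T v))\<^sup>2 \<le> c * (norm v)\<^sup>2}"
      by (simp add: v norm_sum_onb_sq[OF F] mult.commute)
  qed
  moreover have "closed {v. (norm (T v))\<^sup>2 \<le> c * (norm v)\<^sup>2}"
    by (intro closed_Collect_le continuous_intros)
  ultimately show ?thesis using closure_minimal closure_cspan_onb by blast
qed

text \<open>Both Hilbert-Schmidt norms are the double sum of squared matrix entries. With finite
  sums one direction of Parseval is available only up to an error, while Bessel covers the other
  after the summations are exchanged.\<close>

lemma hs_le_adjoint:
  assumes T: "T \<in> bounded_ops" and hs: "hs_le T c"
  shows "hs_le (adjoint_op T) c"
proof (rule hs_leI)
  fix G :: "'a set" assume G: "finite G" "G \<subseteq> onb"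
  show "(\<Sum>f\<in>G. (norm (adjoint_op T f))\<^sup>2) \<le> c"
  proof (rule field_le_epsilon)
    fix \<epsilon> :: real assume "0 < \<epsilon>"
    \<comment> \<open>The permitted error is shared among the elements of \<open>G\<close>; adding 1
      covers the empty \<open>G\<close>.\<close>
    define d where "d = \<epsilon> / (real (card G) + 1)"
    have d: "0 < d" "real (card G) * d \<le> \<epsilon>"
      using \<open>0 < \<epsilon>\<close> by (auto simp: d_def field_simps)
    have "\<forall>f. \<exists>K. finite K \<and> K \<subseteq> onb \<and>
        (norm (adjoint_op T f))\<^sup>2 \<le> (\<Sum>e\<in>K. (cmod (cinner e (adjoint_op T f)))\<^sup>2) + d"
      using parseval_approx[OF d(1)] by blast
    from choice[OF this] obtain K where K: "\<And>f. finite (K f)" "\<And>f. K f \<subseteq> onb"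
      "\<And>f. (norm (adjoint_op T f))\<^sup>2 \<le> (\<Sum>e\<in>K f. (cmod (cinner e (adjoint_op T f)))\<^sup>2) + d"
      by blast
    \<comment> \<open>One finite set of basis vectors that is good for all \<open>f \<in> G\<close>
      at once, so that the two sums can be swapped.\<close>
    define F where "F = (\<Union>f\<in>G. K f)"
    have F: "finite F" "F \<subseteq> onb" using G K by (auto simp: F_def)
    have "(norm (adjoint_op T f))\<^sup>2 \<le> (\<Sum>e\<in>F. (cmod (cinner f (T e)))\<^sup>2) + d" if "f \<in> G" for f
    proof -
      have "(\<Sum>e\<in>K f. (cmod (cinner e (adjoint_op T f)))\<^sup>2) \<le> (\<Sum>e\<in>F. (cmod (cinner e (adjoint_op T f)))\<^sup>2)"
        by (rule sum_mono2) (use F that in \<open>auto simp: F_def\<close>)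
      also have "\<dots> = (\<Sum>e\<in>F. (cmod (cinner f (T e)))\<^sup>2)"
        unfolding cinner_adjoint_right[OF T] by (subst cinner_commute) simp
      finally show ?thesis using K(3)[of f] by linarith
    qed
    hence "(\<Sum>f\<in>G. (norm (adjoint_op T f))\<^sup>2) \<le> (\<Sum>f\<in>G. (\<Sum>e\<in>F. (cmod (cinner f (T e)))\<^sup>2) + d)"
      by (rule sum_mono)
    also have "\<dots> = (\<Sum>e\<in>F. \<Sum>f\<in>G. (cmod (cinner f (T e)))\<^sup>2) + real (card G) * d"
      unfolding sum.distrib by (subst sum.swap) simp
    also have "\<dots> \<le> (\<Sum>e\<in>F. (norm (T e))\<^sup>2) + \<epsilon>"
      by (intro add_mono sum_mono bessel_ineq G d)
    also have "\<dots> \<le> c + \<epsilon>" using hs_leD[OF hs F] by simp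
    finally show "(\<Sum>f\<in>G. (norm (adjoint_op T f))\<^sup>2) \<le> c + \<epsilon>" .
  qed
qed

lemma cinner_positive_square:
  "positive_op S \<Longrightarrow> cinner x (S (S x)) = of_real ((norm (blinfun_apply S x))\<^sup>2)"
  by (simp only: positive_op_selfadjoint[symmetric] cinner_self)

text \<open>A self-improving bound: \<open>S S \<le> b S\<close> with \<open>b = norm S\<close>
  gives a squared Hilbert-Schmidt norm of at most \<open>b * c\<close>. This dominates
  \<open>b * b\<close>, and \<open>b\<close> cancels.\<close>

lemma norm_le_of_trace_le:
  assumes S: "positive_op S" and tr: "trace_le S c"
  shows "norm S \<le> c"
proof -
  define b where "b = norm S"
  have "hs_le S (b * c)"
  proof (rule hs_leI)
    fix F :: "'a set" assume F: "finite F" "F \<subseteq> onb"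
    have "(norm (S e))\<^sup>2 \<le> b * Re (cinner e (S e))" for e
    proof (cases "b = 0")
      case True
      thus ?thesis by (simp add: b_def)
    qed (intro positive_op_norm_sq_le S, auto simp: b_def)
    hence "(\<Sum>e\<in>F. (norm (S e))\<^sup>2) \<le> (\<Sum>e\<in>F. b * Re (cinner e (S e)))" by (intro sum_mono)
    also have "\<dots> \<le> b * c"
      unfolding sum_distrib_left[symmetric] by (intro mult_left_mono trace_leD[OF tr F]) (simp add: b_def)
    finally show "(\<Sum>e\<in>F. (norm (S e))\<^sup>2) \<le> b * c" .
  qed
  from norm_sq_le_of_hs_le[OF positive_op_bounded_ops[OF S] this]
  have "norm (S v) \<le> sqrt (b * c) * norm v" for v
    using real_le_rsqrt[of "norm (S v)"] by (fastforce simp: real_sqrt_mult)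
  hence "b \<le> sqrt (b * c)"
    unfolding b_def using trace_le_nonneg[OF tr] by (intro norm_blinfun_bound) auto
  hence "b\<^sup>2 \<le> (sqrt (b * c))\<^sup>2" by (intro power_mono) (auto simp: b_def)
  hence "b * b \<le> b * c" using trace_le_nonneg[OF tr] by (simp add: power2_eq_square b_def)
  thus ?thesis using trace_le_nonneg[OF tr] by (cases "b = 0") (auto simp: b_def mult_le_cancel_left)
qed

lemma continuous_on_powr_const: "0 < p \<Longrightarrow> continuous_on {0..b} (\<lambda>t::real. t powr p)"
  by (rule continuous_on_powr') (auto intro: continuous_intros)

lemma fun_op_square: "positive_op S \<Longrightarrow> fun_op (\<lambda>t. t * t) S = S o\<^sub>L S"
  using fun_op_mult[of S "\<lambda>t. t" "\<lambda>t. t"] fun_op_id[of S] by (simp add: continuous_on_id)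

text \<open>The \<open>p\<close>-norm is at most the trace norm: \<open>norm S \<le> c\<close>, so
  \<open>t powr p \<le> c powr (p - 1) * t\<close> on the interval that matters.\<close>

lemma trace_le_powr:
  assumes S: "positive_op S" and tr: "trace_le S c" and p: "1 \<le> p"
  shows "trace_le (fun_op (\<lambda>t. t powr p) S) (c powr p)"
proof (rule trace_leI)
  fix F :: "'a set" assume F: "finite F" "F \<subseteq> onb"
  have c: "0 \<le> c" "norm S \<le> c" using trace_le_nonneg[OF tr] norm_le_of_trace_le[OF S tr] .
  have "Re (cinner e (fun_op (\<lambda>t. t powr p) S e)) \<le> c powr (p - 1) * Re (cinner e (S e))" for e
  proof -
    have "Re (cinner e (fun_op (\<lambda>t. t powr p) S e)) \<le> Re (cinner e (fun_op (\<lambda>t. c powr (p - 1) * t) S e))"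
    proof (rule fun_op_mono[OF S])
      fix t assume t: "0 \<le> t" "t \<le> norm S"
      have "t powr p = t powr (p - 1) * t"
        using t(1) powr_add[of t "p - 1" 1] by (cases "t = 0") auto
      also have "\<dots> \<le> c powr (p - 1) * t"
        using t c p by (intro mult_right_mono powr_mono2) auto
      finally show "t powr p \<le> c powr (p - 1) * t" .
    qed (use p in \<open>auto intro!: continuous_intros continuous_on_powr_const\<close>)
    also have "fun_op (\<lambda>t. c powr (p - 1) * t) S = c powr (p - 1) *\<^sub>R S"
      using fun_op_cmult[OF S continuous_on_id] fun_op_id[OF S] by simp
    finally show ?thesis by (simp add: blinfun.scaleR_left cinner_scaleR_right)
  qed
  hence "(\<Sum>e\<in>F. Re (cinner e (fun_op (\<lambda>t. t powr p) S e))) \<le> c powr (p - 1) * (\<Sum>e\<in>F. Re (cinner e (S e)))"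
    unfolding sum_distrib_left by (intro sum_mono)
  also have "\<dots> \<le> c powr (p - 1) * c" by (intro mult_left_mono trace_leD[OF tr F]) simp
  also have "\<dots> = c powr p" using c(1) powr_add[of c "p - 1" 1] by (cases "c = 0") auto
  finally show "(\<Sum>e\<in>F. Re (cinner e (fun_op (\<lambda>t. t powr p) S e))) \<le> c powr p" .
qed

text \<open>The 2-norm is at most the \<open>p\<close>-norm, where \<open>c\<close> stands for the
  \<open>p\<close>-th power of the latter. On \<open>[0, b]\<close> one has
  \<open>t * t \<le> b powr (2 - p) * t powr p\<close>, and \<open>p \<le> 2\<close> makes the
  exponent \<open>2 - p\<close> nonnegative. It remains to bound \<open>b\<close> by
  \<open>c powr (1 / p)\<close>.\<close>

lemma hs_le_of_trace_powr_le:
  assumes T: "T \<in> bounded_ops" and tr: "trace_le (fun_op (\<lambda>t. t powr p) (abs_op T)) c"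
    and p: "1 \<le> p" "p \<le> 2"
  shows "hs_le T ((c powr (1 / p))\<^sup>2)"
proof -
  define S where "S = abs_op T"
  define b where "b = norm S"
  have S: "positive_op S" unfolding S_def by (rule positive_abs_op[OF T])
  have b0: "0 \<le> b" by (simp add: b_def)
  have c0: "0 \<le> c" by (rule trace_le_nonneg[OF tr])
  have cont: "continuous_on {0..norm S} (\<lambda>t. t powr p)" using p by (intro continuous_on_powr_const) simp
  have hs: "hs_le T (b powr (2 - p) * c)"
  proof (rule hs_leI)
    fix F :: "'a set" assume F: "finite F" "F \<subseteq> onb"
    have "(norm (T e))\<^sup>2 \<le> b powr (2 - p) * Re (cinner e (fun_op (\<lambda>t. t powr p) S e))" for e
    proof -
      have "(norm (T e))\<^sup>2 = Re (cinner e (fun_op (\<lambda>t. t * t) S e))"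
        by (simp add: fun_op_square[OF S] cinner_positive_square[OF S])
           (simp add: S_def norm_abs_op_apply[OF T])
      also have "\<dots> \<le> Re (cinner e (fun_op (\<lambda>t. b powr (2 - p) * t powr p) S e))"
      proof (rule fun_op_mono[OF S])
        fix t assume t: "0 \<le> t" "t \<le> norm S"
        have "t * t = t powr (2 - p) * t powr p"
          using t(1) by (cases "t = 0") (auto simp: powr_add[symmetric] power2_eq_square)
        also have "\<dots> \<le> b powr (2 - p) * t powr p"
          using t p by (intro mult_right_mono powr_mono2) (auto simp: b_def)
        finally show "t * t \<le> b powr (2 - p) * t powr p" .
      qed (auto intro!: continuous_intros cont)
      also have "fun_op (\<lambda>t. b powr (2 - p) * t powr p) S = b powr (2 - p) *\<^sub>R fun_op (\<lambda>t. t powr p) S"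
        by (rule fun_op_cmult[OF S cont])
      finally show ?thesis by (simp add: blinfun.scaleR_left cinner_scaleR_right)
    qed
    hence "(\<Sum>e\<in>F. (norm (T e))\<^sup>2) \<le> b powr (2 - p) * (\<Sum>e\<in>F. Re (cinner e (fun_op (\<lambda>t. t powr p) S e)))"
      unfolding sum_distrib_left by (intro sum_mono)
    also have "\<dots> \<le> b powr (2 - p) * c"
      using trace_leD[OF tr F] by (intro mult_left_mono) (auto simp: S_def)
    finally show "(\<Sum>e\<in>F. (norm (T e))\<^sup>2) \<le> b powr (2 - p) * c" .
  qed
  have "norm (S v) \<le> sqrt (b powr (2 - p) * c) * norm v" for v
  proof -
    have "norm (S v) \<le> sqrt (b powr (2 - p) * c * (norm v)\<^sup>2)"
      using norm_sq_le_of_hs_le[OF T hs, of v] unfolding S_def norm_abs_op_apply[OF T]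
      by (rule real_le_rsqrt)
    thus ?thesis by (simp add: real_sqrt_mult)
  qed
  \<comment> \<open>Bootstrap: the operator norm \<open>b\<close> is at most the Hilbert-Schmidt
    bound just found, which itself contains \<open>b\<close>. Cancelling
    \<open>b powr (2 - p)\<close> will leave \<open>b powr p \<le> c\<close>.\<close>
  hence "b \<le> sqrt (b powr (2 - p) * c)"
    unfolding b_def using c0 by (intro norm_blinfun_bound) auto
  hence "b\<^sup>2 \<le> (sqrt (b powr (2 - p) * c))\<^sup>2" using b0 by (intro power_mono) auto
  hence bc: "b\<^sup>2 \<le> b powr (2 - p) * c" using c0 by simp
  have "b powr (2 - p) * c \<le> (c powr (1 / p))\<^sup>2"
  proof (cases "b = 0")
    case False
    have "b powr (2 - p) * b powr p \<le> b powr (2 - p) * c"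
      using bc b0 False by (simp add: powr_add[symmetric])
    hence "b powr p \<le> c" using False by simp
    hence "(b powr p) powr (1 / p) \<le> c powr (1 / p)" using p by (intro powr_mono2) auto
    hence "b \<le> c powr (1 / p)" using p b0 False by (simp add: powr_powr)
    hence "b powr (2 - p) \<le> (c powr (1 / p)) powr (2 - p)" using p b0 by (intro powr_mono2) auto
    hence "b powr (2 - p) * c \<le> (c powr (1 / p)) powr (2 - p) * c" using c0 by (intro mult_right_mono)
    also have "\<dots> = (c powr (1 / p)) powr (2 - p) * (c powr (1 / p)) powr p"
      using p c0 by (simp add: powr_powr)
    also have "\<dots> = (c powr (1 / p))\<^sup>2"
      using c0 by (cases "c = 0") (auto simp: powr_add[symmetric])
    finally show ?thesis .
  qed auto
  with hs show ?thesis by (rule hs_le_mono)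
qed

lemma adjoint_contraction:
  assumes V: "V \<in> bounded_ops" and le: "\<And>x. norm (V x) \<le> norm x"
  shows "norm (adjoint_op V x) \<le> norm x"
proof -
  have "(norm (adjoint_op V x))\<^sup>2 = cmod (cinner x (V (adjoint_op V x)))"
    by (simp add: cinner_adjoint_left[OF V, symmetric] cinner_self norm_power)
  also have "\<dots> \<le> norm x * norm (adjoint_op V x)"
    by (intro order_trans[OF cinner_cauchy_schwarz] mult_left_mono le) simp
  finally show ?thesis by (cases "adjoint_op V x = 0") (auto simp: power2_eq_square)
qed

text \<open>In place of the polar decomposition \<open>XY = V|XY|\<close> with a partial isometry, take the contraction
  \<open>V = XY (|XY| + \<epsilon>)\<^sup>-\<^sup>1\<close>, for which \<open>V\<^sup>*XY \<ge> |XY| - \<epsilon>\<close>.\<close>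

lemma trace_le_abs_compose:
  assumes X: "X \<in> bounded_ops" and Y: "Y \<in> bounded_ops"
    and a: "0 \<le> a" "hs_le X (a\<^sup>2)" and b: "0 \<le> b" "hs_le Y (b\<^sup>2)"
  shows "trace_le (abs_op (X o\<^sub>L Y)) (a * b)"
proof (rule trace_leI)
  fix F :: "'a set" assume F: "finite F" "F \<subseteq> onb"
  define T where "T = X o\<^sub>L Y"
  define S where "S = abs_op T"
  have T: "T \<in> bounded_ops" unfolding T_def using X Y by (rule bounded_ops_closed)
  have S: "positive_op S" unfolding S_def by (rule positive_abs_op[OF T])
  have SS: "S (S x) = adjoint_op T (T x)" for x
    using arg_cong[OF abs_op_square[OF T], of "\<lambda>A. blinfun_apply A x"] by (simp add: S_def)
  show "(\<Sum>e\<in>F. Re (cinner e (abs_op (X o\<^sub>L Y) e))) \<le> a * b"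
  proof (rule field_le_epsilon)
    fix \<epsilon> :: real assume "0 < \<epsilon>"
    \<comment> \<open>The shift in the approximate polar decomposition. It is incurred once for each
      element of \<open>F\<close>, and the total must not exceed the allowed error, also for empty
      \<open>F\<close>.\<close>
    define d where "d = \<epsilon> / (real (card F) + 1)"
    have d: "0 < d" "real (card F) * d \<le> \<epsilon>"
      using \<open>0 < \<epsilon>\<close> by (auto simp: d_def field_simps)
    \<comment> \<open>\<open>G\<close> below is the inverse of \<open>S + d\<close>, obtained from
      the functional calculus; the contraction property of \<open>V = T o\<^sub>L G\<close> comes
      from \<open>t / (t + d) \<le> 1\<close>.\<close>
    define g where "g t = 1 / (t + d)" for t :: real
    have gc: "continuous_on {0..norm S} g"
      unfolding g_def using d by (intro continuous_intros) auto
    have ic: "continuous_on {0..norm S} (\<lambda>t. t)" by (rule continuous_on_id)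
    define G where "G = fun_op g S"
    have G: "G \<in> bounded_ops" unfolding G_def by (rule fun_op_bounded_ops[OF S gc])
    define V where "V = T o\<^sub>L G"
    have V: "V \<in> bounded_ops" unfolding V_def using T G by (rule bounded_ops_closed)
    have SG: "S o\<^sub>L G = fun_op (\<lambda>t. t * g t) S"
      unfolding G_def fun_op_mult[OF S ic gc] fun_op_id[OF S] ..
    have Vle: "norm (V x) \<le> norm x" for x
    proof -
      have tg: "continuous_on {0..norm S} (\<lambda>t. t * g t)" by (intro continuous_intros gc)
      have "(norm (V x))\<^sup>2 = (norm ((S o\<^sub>L G) x))\<^sup>2"
        by (simp add: V_def S_def norm_abs_op_apply[OF T])
      also have "\<dots> = Re (cinner x (fun_op (\<lambda>t. (t * g t) * (t * g t)) S x))"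
        unfolding SG fun_op_mult[OF S tg tg] norm_sq_eq_Re_cinner
        by (simp add: fun_op_selfadjoint[OF S tg])
      also have "\<dots> \<le> Re (cinner x (fun_op (\<lambda>t. 1) S x))"
      proof (rule fun_op_mono[OF S])
        fix t :: real assume t: "0 \<le> t"
        have "0 \<le> t * g t" "t * g t \<le> 1" using t d by (auto simp: g_def)
        thus "(t * g t) * (t * g t) \<le> 1" by (simp add: mult_le_one)
      qed (intro continuous_intros gc)+
      also have "\<dots> = (norm x)\<^sup>2" by (simp add: fun_op_const[OF S] norm_sq_eq_Re_cinner)
      finally show ?thesis by (rule power2_le_imp_le) simp
    qed
    \<comment> \<open>The adjoint of \<open>V\<close> applied to \<open>X Y\<close> is
      \<open>W Y\<close>. Moving \<open>W\<close> to the other side of the inner product leaves two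
      Hilbert-Schmidt factors, to which Cauchy-Schwarz applies.\<close>
    define W where "W = adjoint_op V o\<^sub>L X"
    have W: "W \<in> bounded_ops" unfolding W_def using adjoint_op_bounded_ops[OF V] X by (rule bounded_ops_closed)
    have "hs_le W (a\<^sup>2)"
    proof (rule hs_leI)
      fix F :: "'a set" assume F: "finite F" "F \<subseteq> onb"
      have "(\<Sum>e\<in>F. (norm (W e))\<^sup>2) \<le> (\<Sum>e\<in>F. (norm (X e))\<^sup>2)"
        unfolding W_def blinfun_apply_blinfun_compose
        by (intro sum_mono power_mono adjoint_contraction V Vle) simp
      thus "(\<Sum>e\<in>F. (norm (W e))\<^sup>2) \<le> a\<^sup>2" using hs_leD[OF a(2) F] by linarith
    qed
    hence Wadj: "hs_le (adjoint_op W) (a\<^sup>2)" by (rule hs_le_adjoint[OF W])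
    have key: "Re (cinner e (S e)) \<le> norm (adjoint_op W e) * norm (Y e) + d" if "e \<in> F" for e
    proof -
      have ne: "norm e = 1" using norm_onb F that by blast
      have tc: "continuous_on {0..norm S} (\<lambda>t. t * t * g t + d)" by (intro continuous_intros gc)
      have ttc: "continuous_on {0..norm S} (\<lambda>t. g t * (t * t))" by (intro continuous_intros gc)
      have "Re (cinner e (S e)) = Re (cinner e (fun_op (\<lambda>t. t) S e))" by (simp add: fun_op_id[OF S])
      also have "\<dots> \<le> Re (cinner e (fun_op (\<lambda>t. g t * (t * t) + d) S e))"
      proof (rule fun_op_mono[OF S])
        fix t :: real assume t: "0 \<le> t"
        \<comment> \<open>The scalar form of the lower bound on the adjoint of \<open>V\<close>
          times \<open>T\<close>: \<open>t - d\<close> is at most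
          \<open>t * t / (t + d)\<close>.\<close>
        have "t * (t + d) \<le> t * t + d * (t + d)" using d by (simp add: algebra_simps)
        thus "t \<le> g t * (t * t) + d" using t d by (simp add: g_def field_simps)
      qed (intro continuous_intros gc)+
      also have "fun_op (\<lambda>t. g t * (t * t) + d) S = (G o\<^sub>L (S o\<^sub>L S)) + d *\<^sub>R id_blinfun"
        using fun_op_add[OF S ttc continuous_on_const, of d] fun_op_mult[OF S gc, of "\<lambda>t. t * t"]
        by (simp add: fun_op_const[OF S] fun_op_square[OF S] G_def continuous_intros)
      also have "Re (cinner e (blinfun_apply \<dots> e)) = Re (cinner e (G (S (S e)))) + d"
        by (simp add: blinfun.add_left blinfun.scaleR_left cinner_add_right cinner_scaleR_right cinner_self ne)
      also have "cinner e (G (S (S e))) = cinner (adjoint_op W e) (Y e)"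
      proof -
        have "cinner e (G (S (S e))) = cinner (V e) (T e)"
          unfolding SS fun_op_selfadjoint[OF S gc, folded G_def, symmetric] cinner_adjoint_right[OF T]
          by (simp add: V_def)
        also have "\<dots> = cinner e (W (Y e))"
          unfolding W_def blinfun_apply_blinfun_compose cinner_adjoint_right[OF V] by (simp add: T_def)
        finally show ?thesis unfolding cinner_adjoint_left[OF W] .
      qed
      also have "Re \<dots> \<le> norm (adjoint_op W e) * norm (Y e)"
        using cinner_cauchy_schwarz complex_Re_le_cmod order_trans by blast
      finally show ?thesis by simp
    qed
    have "(\<Sum>e\<in>F. norm (adjoint_op W e) * norm (Y e))\<^sup>2
        \<le> (\<Sum>e\<in>F. (norm (adjoint_op W e))\<^sup>2) * (\<Sum>e\<in>F. (norm (Y e))\<^sup>2)"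
      by (rule Cauchy_Schwarz_ineq_sum)
    also have "\<dots> \<le> a\<^sup>2 * b\<^sup>2"
      by (intro mult_mono hs_leD[OF Wadj F] hs_leD[OF b(2) F] sum_nonneg) auto
    finally have "(\<Sum>e\<in>F. norm (adjoint_op W e) * norm (Y e))\<^sup>2 \<le> (a * b)\<^sup>2"
      by (simp add: power_mult_distrib)
    hence 1: "(\<Sum>e\<in>F. norm (adjoint_op W e) * norm (Y e)) \<le> a * b"
      by (rule power2_le_imp_le) (use a b in simp)
    have "(\<Sum>e\<in>F. Re (cinner e (S e))) \<le> (\<Sum>e\<in>F. norm (adjoint_op W e) * norm (Y e) + d)"
      by (rule sum_mono) (rule key)
    also have "\<dots> \<le> a * b + \<epsilon>" using 1 d(2) by (simp add: sum.distrib)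
    finally show "(\<Sum>e\<in>F. Re (cinner e (abs_op (X o\<^sub>L Y) e))) \<le> a * b + \<epsilon>" by (simp add: S_def T_def)
  qed
qed

section \<open>Schatten classes\<close>

lemma schatten_simps:
  "carr (schatten p) = {T \<in> bounded_ops. schatten_trace p T < \<infinity>}"
  "add (schatten p) = (+)" "scl (schatten p) = op_scaleC" "mul (schatten p) = (o\<^sub>L)"
  "nrm (schatten p) T = enn2real (schatten_trace p T) powr (1 / p)"
  by (simp_all add: schatten_def)

lemma positive_powr_abs_op:
  "T \<in> bounded_ops \<Longrightarrow> 0 < p \<Longrightarrow> positive_op (fun_op (\<lambda>t. t powr p) (abs_op T))"
  by (intro fun_op_positive positive_abs_op continuous_on_powr_const) auto

lemma hs_le_schatten:
  assumes "T \<in> carr (schatten p)" "1 \<le> p" "p \<le> 2"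
  shows "hs_le T ((nrm (schatten p) T)\<^sup>2)"
proof -
  have T: "T \<in> bounded_ops" "schatten_trace p T < \<infinity>" using assms(1) by (auto simp: schatten_simps)
  \<comment> \<open>\<open>enn2real\<close> sends infinity to 0, so finiteness, which is membership
    in the carrier, is what makes this identity true.\<close>
  have "schatten_trace p T = ennreal (enn2real (schatten_trace p T))" using T(2) by (simp add: infinity_ennreal_def)
  hence "trace_le (fun_op (\<lambda>t. t powr p) (abs_op T)) (enn2real (schatten_trace p T))"
    using trace_op_le_iff[OF positive_powr_abs_op[OF T(1)], of p "enn2real (schatten_trace p T)"] assms
    unfolding schatten_trace_def by simp
  from hs_le_of_trace_powr_le[OF T(1) this assms(2,3)] show ?thesis by (simp add: schatten_simps)
qed

text \<open>The trace norm dominates every \<open>p\<close>-norm. Products and rank-one operators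
  are placed in the Schatten classes by this criterion.\<close>

lemma schatten_of_trace_le:
  assumes T: "T \<in> bounded_ops" and tr: "trace_le (abs_op T) c" and p: "1 \<le> p"
  shows "T \<in> carr (schatten p)"
    and "nrm (schatten p) T \<le> c"
proof -
  have le: "schatten_trace p T \<le> ennreal (c powr p)"
    unfolding schatten_trace_def using p
    by (subst trace_op_le_iff) (auto intro: positive_powr_abs_op T trace_le_powr positive_abs_op tr)
  thus "T \<in> carr (schatten p)" using T by (auto simp: schatten_simps infinity_ennreal_def intro: le_less_trans)
  have "enn2real (schatten_trace p T) \<le> c powr p" using enn2real_mono[OF le] by simp
  hence "enn2real (schatten_trace p T) powr (1 / p) \<le> (c powr p) powr (1 / p)"
    using p by (intro powr_mono2) auto
  thus "nrm (schatten p) T \<le> c" using p trace_le_nonneg[OF tr] by (simp add: schatten_simps powr_powr)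
qed

lemma schatten_nrm_nonneg: "0 \<le> nrm (schatten p) T"
  by (simp add: schatten_simps)

lemma schatten_mul:
  assumes X: "X \<in> carr (schatten p)" and Y: "Y \<in> carr (schatten p)" and p: "1 \<le> p" "p \<le> 2"
  shows "mul (schatten p) X Y \<in> carr (schatten p)"
    and "nrm (schatten p) (mul (schatten p) X Y) \<le> nrm (schatten p) X * nrm (schatten p) Y"
proof -
  let ?N = "nrm (schatten p)"
  have b: "X \<in> bounded_ops" "Y \<in> bounded_ops" using X Y by (auto simp: schatten_simps)
  have "trace_le (abs_op (X o\<^sub>L Y)) (?N X * ?N Y)"
    by (intro trace_le_abs_compose b schatten_nrm_nonneg hs_le_schatten X Y p)
  from schatten_of_trace_le[OF bounded_ops_closed(1)[OF b] this p(1)]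
  show "mul (schatten p) X Y \<in> carr (schatten p)"
    and "?N (mul (schatten p) X Y) \<le> ?N X * ?N Y"
    unfolding schatten_simps(4) .
qed

lemma schatten_trace_scaleC:
  assumes T: "T \<in> bounded_ops" and p: "0 < p"
  shows "schatten_trace p (op_scaleC c T) = ennreal (cmod c powr p) * schatten_trace p T"
proof -
  note S = positive_abs_op[OF T]
  define R where "R = fun_op (\<lambda>t. t powr p) (abs_op T)"
  have R: "positive_op R" unfolding R_def by (rule positive_powr_abs_op[OF T p])
  have "fun_op (\<lambda>t. t powr p) (abs_op (op_scaleC c T)) = fun_op (\<lambda>t. (cmod c * t) powr p) (abs_op T)"
    unfolding abs_op_scaleC[OF T] using p by (intro fun_op_scaleR[OF S] continuous_on_powr_const) auto
  also have "\<dots> = fun_op (\<lambda>t. cmod c powr p * t powr p) (abs_op T)"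
    by (rule fun_op_cong) (simp add: powr_mult)
  also have "\<dots> = cmod c powr p *\<^sub>R R"
    unfolding R_def by (rule fun_op_cmult[OF S continuous_on_powr_const[OF p]])
  finally have eq: "fun_op (\<lambda>t. t powr p) (abs_op (op_scaleC c T)) = cmod c powr p *\<^sub>R R" .
  have "schatten_trace p (op_scaleC c T)
      = (\<Sum>\<^sub>\<infinity>e\<in>onb. ennreal (cmod c powr p) * ennreal (Re (cinner e (R e))))"
    unfolding schatten_trace_def trace_op_def onb_def[symmetric] eq
    by (simp add: blinfun.scaleR_left cinner_scaleR_right ennreal_mult positive_op_nonneg[OF R])
  also have "\<dots> = ennreal (cmod c powr p) * schatten_trace p T"
    unfolding schatten_trace_def trace_op_eq_SUP R_def[symmetric]
    by (subst nonneg_infsum_complete) (auto simp: sum_distrib_left[symmetric] SUP_mult_left_ennreal)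
  finally show ?thesis .
qed

lemma schatten_scl:
  assumes T: "T \<in> carr (schatten p)" and p: "1 \<le> p"
  shows "scl (schatten p) c T \<in> carr (schatten p)"
    and "nrm (schatten p) (scl (schatten p) c T) = cmod c * nrm (schatten p) T"
proof -
  have b: "T \<in> bounded_ops" "schatten_trace p T < \<infinity>" using T by (auto simp: schatten_simps)
  have eq: "schatten_trace p (op_scaleC c T) = ennreal (cmod c powr p) * schatten_trace p T"
    using p by (intro schatten_trace_scaleC b) simp
  show "scl (schatten p) c T \<in> carr (schatten p)"
    using b by (simp add: schatten_simps eq op_scaleC_bounded_ops infinity_ennreal_def ennreal_mult_less_top)
  show "nrm (schatten p) (scl (schatten p) c T) = cmod c * nrm (schatten p) T"
    using p by (simp add: schatten_simps eq enn2real_mult powr_mult powr_powr)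
qed

section \<open>Rank-one operators as matrix units\<close>

definition rank_one :: "'a::chilbert_space \<Rightarrow> 'a \<Rightarrow> ('a \<Rightarrow>\<^sub>L 'a)" where
  "rank_one u v = Blinfun (\<lambda>x. cinner v x *\<^sub>C u)"

lemma rank_one_apply: "blinfun_apply (rank_one u v) x = cinner v x *\<^sub>C u"
proof -
  have "bounded_linear (\<lambda>x. cinner v x *\<^sub>C u)"
    by (rule bounded_linear_intro[of _ "norm v * norm u"])
       (auto simp: cinner_add_right scaleC_add_left cinner_scaleC_right scaleR_scaleC scaleC_scaleC norm_scaleC
         intro: order_trans[OF mult_right_mono[OF cinner_cauchy_schwarz]])
  thus ?thesis by (simp add: rank_one_def bounded_linear_Blinfun_apply)
qed

lemma rank_one_bounded_ops: "rank_one u v \<in> bounded_ops"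
  by (simp add: bounded_ops_def rank_one_apply cinner_scaleC_right scaleC_scaleC)

lemma rank_one_compose: "rank_one u v o\<^sub>L rank_one v w = op_scaleC (cinner v v) (rank_one u w)"
  by (rule blinfun_eqI) (simp add: rank_one_apply op_scaleC_apply cinner_scaleC_right scaleC_scaleC mult.commute)

text \<open>For unit vectors the absolute value of \<open>rank_one u v\<close> is the projection
  \<open>rank_one v v\<close>, and Bessel's inequality for \<open>v\<close> bounds its trace by
  1.\<close>

lemma rank_one_schatten:
  assumes uv: "norm u = 1" "norm v = 1" and p: "1 \<le> p"
  shows "rank_one u v \<in> carr (schatten p)" and "nrm (schatten p) (rank_one u v) \<le> 1"
proof -
  have adj: "adjoint_op (rank_one u v) = rank_one v u"
    by (rule adjoint_op_unique[OF rank_one_bounded_ops])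
       (simp add: rank_one_apply cinner_scaleC_left cinner_scaleC_right cinner_commute[of _ u, symmetric])
  have form: "Re (cinner x (rank_one v v x)) = (cmod (cinner x v))\<^sup>2" for x
  proof -
    have "cinner x (rank_one v v x) = cinner x v * cnj (cinner x v)"
      unfolding rank_one_apply cinner_scaleC_right cinner_commute[of v x] by (rule mult.commute)
    thus ?thesis unfolding complex_norm_square[symmetric] by simp
  qed
  have pos: "positive_op (rank_one v v)"
  proof (rule positive_opI[OF rank_one_bounded_ops])
    show "cinner (rank_one v v x) y = cinner x (rank_one v v y)" for x y
      by (simp add: rank_one_apply cinner_scaleC_left cinner_scaleC_right cinner_commute[of _ v, symmetric])
    show "0 \<le> Re (cinner x (rank_one v v x))" for x
      unfolding form by simp
  qed
  have abs: "abs_op (rank_one u v) = rank_one v v"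
    by (rule abs_op_eqI[OF rank_one_bounded_ops pos], unfold adj, rule blinfun_eqI)
       (simp add: rank_one_apply cinner_scaleC_right cinner_self uv)
  have "trace_le (rank_one v v) 1"
  proof (rule trace_leI)
    fix F :: "'a set" assume F: "finite F" "F \<subseteq> onb"
    show "(\<Sum>e\<in>F. Re (cinner e (rank_one v v e))) \<le> 1"
      unfolding form using bessel_ineq[OF F, of v] uv by simp
  qed
  hence "trace_le (abs_op (rank_one u v)) 1" by (simp add: abs)
  from schatten_of_trace_le[OF rank_one_bounded_ops this p]
  show "rank_one u v \<in> carr (schatten p)" and "nrm (schatten p) (rank_one u v) \<le> 1" .
qed

section \<open>Arens products and iterated limits\<close>

text \<open>Closure under addition is left out: a tensor factor need not have it, since sums in the tensor
  product are formal.\<close>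

locale carrier_algebra =
  fixes A :: "('a, 'm) nalgebra_scheme"
  assumes scl_closed: "x \<in> carr A \<Longrightarrow> scl A c x \<in> carr A"
    and mul_closed: "x \<in> carr A \<Longrightarrow> y \<in> carr A \<Longrightarrow> mul A x y \<in> carr A"
    and nrm_nonneg: "x \<in> carr A \<Longrightarrow> 0 \<le> nrm A x"
    and nrm_scl_le: "x \<in> carr A \<Longrightarrow> nrm A (scl A c x) \<le> cmod c * nrm A x"
    and nrm_mul_le: "x \<in> carr A \<Longrightarrow> y \<in> carr A \<Longrightarrow> nrm A (mul A x y) \<le> nrm A x * nrm A y"
    and add_mul: "x \<in> carr A \<Longrightarrow> x' \<in> carr A \<Longrightarrow> y \<in> carr A \<Longrightarrow>
      mul A (add A x x') y = add A (mul A x y) (mul A x' y)"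
    and mul_add: "x \<in> carr A \<Longrightarrow> y \<in> carr A \<Longrightarrow> y' \<in> carr A \<Longrightarrow>
      mul A x (add A y y') = add A (mul A x y) (mul A x y')"
    and scl_mul: "x \<in> carr A \<Longrightarrow> y \<in> carr A \<Longrightarrow> mul A (scl A c x) y = scl A c (mul A x y)"
    and mul_scl: "x \<in> carr A \<Longrightarrow> y \<in> carr A \<Longrightarrow> mul A x (scl A c y) = scl A c (mul A x y)"

locale add_closed_algebra = carrier_algebra +
  assumes add_closed: "x \<in> carr A \<Longrightarrow> y \<in> carr A \<Longrightarrow> add A x y \<in> carr A"

lemma dual_simps:
  "add (dual A) \<phi> \<psi> = (\<lambda>x\<in>carr A. \<phi> x + \<psi> x)"
  "scl (dual A) c \<phi> = (\<lambda>x\<in>carr A. c * \<phi> x)"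
  "nrm (dual A) \<phi> = (SUP x\<in>{x \<in> carr A. nrm A x \<le> 1}. cmod (\<phi> x))"
  by (simp_all add: dual_def)

lemma dualI:
  assumes "\<phi> \<in> extensional (carr A)"
    "\<And>x y. x \<in> carr A \<Longrightarrow> y \<in> carr A \<Longrightarrow> \<phi> (add A x y) = \<phi> x + \<phi> y"
    "\<And>c x. x \<in> carr A \<Longrightarrow> \<phi> (scl A c x) = c * \<phi> x"
    "\<And>x. x \<in> carr A \<Longrightarrow> cmod (\<phi> x) \<le> K * nrm A x"
  shows "\<phi> \<in> carr (dual A)"
proof -
  have "\<exists>K. \<forall>x\<in>carr A. cmod (\<phi> x) \<le> K * nrm A x" using assms(4) by blast
  thus ?thesis using assms(1-3) by (simp add: dual_def)
qed

lemma
  assumes "\<phi> \<in> carr (dual A)"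
  shows dual_add: "x \<in> carr A \<Longrightarrow> y \<in> carr A \<Longrightarrow> \<phi> (add A x y) = \<phi> x + \<phi> y"
    and dual_scl: "x \<in> carr A \<Longrightarrow> \<phi> (scl A c x) = c * \<phi> x"
  using assms by (auto simp: dual_def)

text \<open>\<open>dual\<close> puts no sign on the constant, so it is replaced by its absolute
  value. Nonnegativity of the norm is a premise on \<open>x\<close>, because the lemma is also
  applied to functionals on \<open>dual A\<close>, where it has to be proved separately.\<close>

lemma dual_bounded:
  assumes "\<phi> \<in> carr (dual A)"
  obtains K where "0 \<le> K" "\<And>x. x \<in> carr A \<Longrightarrow> 0 \<le> nrm A x \<Longrightarrow> cmod (\<phi> x) \<le> K * nrm A x"
proof -
  have "\<exists>K. \<forall>x\<in>carr A. cmod (\<phi> x) \<le> K * nrm A x" using assms by (simp add: dual_def)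
  then obtain K where K: "\<And>x. x \<in> carr A \<Longrightarrow> cmod (\<phi> x) \<le> K * nrm A x" by blast
  show thesis
  proof (rule that[of "\<bar>K\<bar>"])
    fix x assume "x \<in> carr A" "0 \<le> nrm A x"
    thus "cmod (\<phi> x) \<le> \<bar>K\<bar> * nrm A x"
      using K[of x] mult_right_mono[OF abs_ge_self[of K], of "nrm A x"] by linarith
  qed simp
qed

context add_closed_algebra
begin

lemma dual_add_closed:
  assumes "\<phi> \<in> carr (dual A)" "\<psi> \<in> carr (dual A)"
  shows "add (dual A) \<phi> \<psi> \<in> carr (dual A)"
proof -
  obtain K where K: "\<And>x. x \<in> carr A \<Longrightarrow> 0 \<le> nrm A x \<Longrightarrow> cmod (\<phi> x) \<le> K * nrm A x"
    using dual_bounded[OF assms(1)] by metis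
  obtain L where L: "\<And>x. x \<in> carr A \<Longrightarrow> 0 \<le> nrm A x \<Longrightarrow> cmod (\<psi> x) \<le> L * nrm A x"
    using dual_bounded[OF assms(2)] by metis
  show ?thesis unfolding dual_simps
  proof (rule dualI[where K = "K + L"])
    fix x assume "x \<in> carr A"
    thus "cmod ((\<lambda>x\<in>carr A. \<phi> x + \<psi> x) x) \<le> (K + L) * nrm A x"
      using norm_triangle_le[of "\<phi> x" "\<psi> x", OF add_mono[OF K L]] nrm_nonneg[of x]
      by (simp add: algebra_simps)
  qed (auto simp: dual_add[OF assms(1)] dual_add[OF assms(2)] dual_scl[OF assms(1)] dual_scl[OF assms(2)]
      add_closed scl_closed algebra_simps)
qed

lemma dual_scl_closed:
  assumes "\<phi> \<in> carr (dual A)"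
  shows "scl (dual A) c \<phi> \<in> carr (dual A)"
proof -
  obtain K where K: "\<And>x. x \<in> carr A \<Longrightarrow> 0 \<le> nrm A x \<Longrightarrow> cmod (\<phi> x) \<le> K * nrm A x"
    using dual_bounded[OF assms(1)] by metis
  show ?thesis unfolding dual_simps
  proof (rule dualI[where K = "cmod c * K"])
    fix x assume "x \<in> carr A"
    thus "cmod ((\<lambda>x\<in>carr A. c * \<phi> x) x) \<le> cmod c * K * nrm A x"
      using mult_left_mono[OF K[of x], of "cmod c"] nrm_nonneg[of x] by (simp add: norm_mult mult.assoc)
  qed (auto simp: dual_add[OF assms(1)] dual_scl[OF assms(1)] add_closed scl_closed algebra_simps)
qed

lemma dual_apply_le_nrm:
  assumes "\<phi> \<in> carr (dual A)" "x \<in> carr A" "nrm A x \<le> 1"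
  shows "cmod (\<phi> x) \<le> nrm (dual A) \<phi>"
proof -
  obtain K where K: "0 \<le> K" "\<And>x. x \<in> carr A \<Longrightarrow> 0 \<le> nrm A x \<Longrightarrow> cmod (\<phi> x) \<le> K * nrm A x"
    using dual_bounded[OF assms(1)] by metis
  \<comment> \<open>Over the reals \<open>SUP\<close> is a supremum only for sets bounded above,
    hence the appeal to boundedness of \<open>\<phi>\<close>.\<close>
  have "bdd_above ((\<lambda>x. cmod (\<phi> x)) ` {x \<in> carr A. nrm A x \<le> 1})"
  proof (rule bdd_aboveI2[of _ _ K])
    fix x assume "x \<in> {x \<in> carr A. nrm A x \<le> 1}"
    thus "cmod (\<phi> x) \<le> K"
      using K(2)[of x] nrm_nonneg[of x] mult_left_mono[of "nrm A x" 1 K] K(1) by auto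
  qed
  thus ?thesis unfolding dual_simps by (rule cSUP_upper2) (use assms in auto)
qed

text \<open>The element \<open>z\<close> witnesses that the unit ball is nonempty, without which the
  real \<open>SUP\<close> has no useful upper bound.\<close>

lemma nrm_dual_le:
  assumes "z \<in> carr A" "nrm A z \<le> 1" "0 \<le> C" "\<And>x. x \<in> carr A \<Longrightarrow> cmod (\<phi> x) \<le> C * nrm A x"
  shows "nrm (dual A) \<phi> \<le> C"
  unfolding dual_simps
proof (rule cSUP_least)
  show "{x \<in> carr A. nrm A x \<le> 1} \<noteq> {}" using assms(1,2) by blast
  fix x assume "x \<in> {x \<in> carr A. nrm A x \<le> 1}"
  thus "cmod (\<phi> x) \<le> C"
    using assms(4)[of x] mult_left_mono[of "nrm A x" 1 C] assms(3) by auto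
qed

lemma elem_right_bound:
  assumes \<omega>: "\<omega> \<in> carr (dual A)"
  obtains K where "0 \<le> K" "\<And>a b. a \<in> carr A \<Longrightarrow> b \<in> carr A \<Longrightarrow> cmod (\<omega> (mul A a b)) \<le> K * nrm A a * nrm A b"
proof -
  obtain K where K: "0 \<le> K" "\<And>x. x \<in> carr A \<Longrightarrow> 0 \<le> nrm A x \<Longrightarrow> cmod (\<omega> x) \<le> K * nrm A x"
    using dual_bounded[OF \<omega>] by metis
  show thesis
  proof (rule that[OF K(1)])
    fix a b assume ab: "a \<in> carr A" "b \<in> carr A"
    have "cmod (\<omega> (mul A a b)) \<le> K * nrm A (mul A a b)" using ab by (intro K mul_closed nrm_nonneg)
    also have "\<dots> \<le> K * (nrm A a * nrm A b)" by (intro mult_left_mono nrm_mul_le ab K)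
    finally show "cmod (\<omega> (mul A a b)) \<le> K * nrm A a * nrm A b" by (simp add: mult.assoc)
  qed
qed

lemma elem_right_dual:
  assumes \<omega>: "\<omega> \<in> carr (dual A)" and a: "a \<in> carr A"
  shows "elem_right A \<omega> a \<in> carr (dual A)"
proof -
  obtain K where K: "\<And>a b. a \<in> carr A \<Longrightarrow> b \<in> carr A \<Longrightarrow> cmod (\<omega> (mul A a b)) \<le> K * nrm A a * nrm A b"
    using elem_right_bound[OF \<omega>] by metis
  show ?thesis
    by (rule dualI[where K = "K * nrm A a"])
       (auto simp: elem_right_def a mul_add mul_scl dual_add[OF \<omega>] dual_scl[OF \<omega>] add_closed scl_closed
         mul_closed K)
qed

lemma elem_left_dual:
  assumes \<omega>: "\<omega> \<in> carr (dual A)" and a: "a \<in> carr A"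
  shows "elem_left A a \<omega> \<in> carr (dual A)"
proof -
  obtain K where K: "\<And>a b. a \<in> carr A \<Longrightarrow> b \<in> carr A \<Longrightarrow> cmod (\<omega> (mul A a b)) \<le> K * nrm A a * nrm A b"
    using elem_right_bound[OF \<omega>] by metis
  show ?thesis
  proof (rule dualI[where K = "K * nrm A a"])
    show "cmod (elem_left A a \<omega> x) \<le> K * nrm A a * nrm A x" if "x \<in> carr A" for x
      using K[OF that a] that by (simp add: elem_left_def mult_ac)
  qed (auto simp: elem_left_def a add_mul scl_mul dual_add[OF \<omega>] dual_scl[OF \<omega>] add_closed scl_closed mul_closed)
qed

text \<open>The common core of \<open>bidual_left\<close> and \<open>bidual_right\<close>:
  \<open>F\<close> is a bounded linear map from the algebra to its dual, namely
  \<open>elem_right\<close> or \<open>elem_left\<close> with \<open>\<omega>\<close> fixed.\<close>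

lemma bidual_compose_dual:
  assumes F: "\<And>a. a \<in> carr A \<Longrightarrow> F a \<in> carr (dual A)"
    and add: "\<And>a a'. a \<in> carr A \<Longrightarrow> a' \<in> carr A \<Longrightarrow> F (add A a a') = add (dual A) (F a) (F a')"
    and scl: "\<And>c a. a \<in> carr A \<Longrightarrow> F (scl A c a) = scl (dual A) c (F a)"
    and K: "0 \<le> K" "\<And>a x. a \<in> carr A \<Longrightarrow> x \<in> carr A \<Longrightarrow> cmod (F a x) \<le> K * nrm A a * nrm A x"
    and g: "g \<in> carr (dual (dual A))" and z: "z \<in> carr A" "nrm A z \<le> 1"
  shows "(\<lambda>a\<in>carr A. g (F a)) \<in> carr (dual A)"
proof -
  obtain L where L: "0 \<le> L" "\<And>\<phi>. \<phi> \<in> carr (dual A) \<Longrightarrow> 0 \<le> nrm (dual A) \<phi> \<Longrightarrow> cmod (g \<phi>) \<le> L * nrm (dual A) \<phi>"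
    using dual_bounded[OF g] by metis
  show ?thesis
  proof (rule dualI[where K = "L * K"])
    fix a assume a: "a \<in> carr A"
    have "nrm (dual A) (F a) \<le> K * nrm A a"
      by (rule nrm_dual_le[OF z]) (use K a nrm_nonneg in auto)
    \<comment> \<open>The value at \<open>z\<close> lies below the dual norm, which is therefore
      nonnegative as the bound for \<open>g\<close> requires.\<close>
    moreover have "0 \<le> nrm (dual A) (F a)"
      using dual_apply_le_nrm[OF F[OF a] z] norm_ge_zero order_trans by blast
    ultimately have "cmod (g (F a)) \<le> L * (K * nrm A a)"
      using L(2)[OF F[OF a]] mult_left_mono[OF _ L(1)] order_trans by blast
    thus "cmod ((\<lambda>a\<in>carr A. g (F a)) a) \<le> L * K * nrm A a" by (simp add: a mult.assoc)
  qed (auto simp: add scl add_closed scl_closed dual_add[OF g] dual_scl[OF g] F)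
qed

lemma bidual_left_dual:
  assumes \<omega>: "\<omega> \<in> carr (dual A)" and g: "g \<in> carr (dual (dual A))" and z: "z \<in> carr A" "nrm A z \<le> 1"
  shows "bidual_left A g \<omega> \<in> carr (dual A)"
proof -
  obtain K where K: "0 \<le> K" "\<And>a b. a \<in> carr A \<Longrightarrow> b \<in> carr A \<Longrightarrow> cmod (\<omega> (mul A a b)) \<le> K * nrm A a * nrm A b"
    using elem_right_bound[OF \<omega>] by metis
  show ?thesis
    unfolding bidual_left_def
  proof (rule bidual_compose_dual[OF elem_right_dual[OF \<omega>] _ _ K(1) _ g z])
    fix a assume a: "a \<in> carr A"
    show "elem_right A \<omega> (add A a a') = add (dual A) (elem_right A \<omega> a) (elem_right A \<omega> a')" if "a' \<in> carr A" for a'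
      unfolding dual_simps elem_right_def
      by (rule restrict_ext) (use a that in \<open>auto simp: add_mul mul_closed dual_add[OF \<omega>]\<close>)
    show "elem_right A \<omega> (scl A c a) = scl (dual A) c (elem_right A \<omega> a)" for c
      unfolding dual_simps elem_right_def
      by (rule restrict_ext) (use a in \<open>auto simp: scl_mul mul_closed dual_scl[OF \<omega>]\<close>)
    show "cmod (elem_right A \<omega> a x) \<le> K * nrm A a * nrm A x" if "x \<in> carr A" for x
      using K(2)[OF a that] that by (simp add: elem_right_def)
  qed
qed

lemma bidual_right_dual:
  assumes \<omega>: "\<omega> \<in> carr (dual A)" and g: "g \<in> carr (dual (dual A))" and z: "z \<in> carr A" "nrm A z \<le> 1"
  shows "bidual_right A \<omega> g \<in> carr (dual A)"
proof -
  obtain K where K: "0 \<le> K" "\<And>a b. a \<in> carr A \<Longrightarrow> b \<in> carr A \<Longrightarrow> cmod (\<omega> (mul A a b)) \<le> K * nrm A a * nrm A b"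
    using elem_right_bound[OF \<omega>] by metis
  show ?thesis
    unfolding bidual_right_def
  proof (rule bidual_compose_dual[OF elem_left_dual[OF \<omega>] _ _ K(1) _ g z])
    fix a assume a: "a \<in> carr A"
    show "elem_left A (add A a a') \<omega> = add (dual A) (elem_left A a \<omega>) (elem_left A a' \<omega>)" if "a' \<in> carr A" for a'
      unfolding dual_simps elem_left_def
      by (rule restrict_ext) (use a that in \<open>auto simp: mul_add mul_closed dual_add[OF \<omega>]\<close>)
    show "elem_left A (scl A c a) \<omega> = scl (dual A) c (elem_left A a \<omega>)" for c
      unfolding dual_simps elem_left_def
      by (rule restrict_ext) (use a in \<open>auto simp: mul_scl mul_closed dual_scl[OF \<omega>]\<close>)
    show "cmod (elem_left A a \<omega> x) \<le> K * nrm A a * nrm A x" if "x \<in> carr A" for x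
      using K(2)[OF that a] that by (simp add: elem_left_def mult_ac)
  qed
qed

end

text \<open>Tychonoff's theorem for a product of closed discs, the compactness behind
  Banach-Alaoglu.\<close>

lemma compact_cball_pi: "compact {h :: 'i \<Rightarrow> complex. \<forall>i. cmod (h i) \<le> B i}"
proof -
  have eq: "{h :: 'i \<Rightarrow> complex. \<forall>i. cmod (h i) \<le> B i} = PiE UNIV (\<lambda>i. cball 0 (B i))"
    by (auto simp: PiE_def Pi_def)
  have "compactin (product_topology (\<lambda>i. euclidean) UNIV) (PiE UNIV (\<lambda>i::'i. cball (0::complex) (B i)))"
    unfolding compactin_PiE by simp
  thus ?thesis unfolding eq by (simp add: euclidean_product_topology)
qed

text \<open>A cluster point is an honest limit along a finer filter, which plays the part of a
  convergent subnet.\<close>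

lemma cluster_point_filter:
  fixes X :: "nat \<Rightarrow> 'b::topological_space"
  assumes "compact U" "\<And>n. X n \<in> U"
  obtains l G where "l \<in> U" "G \<noteq> bot" "G \<le> sequentially" "(X \<longlongrightarrow> l) G"
proof -
  have "filtermap X sequentially \<noteq> bot" by (simp add: filtermap_bot_iff)
  moreover have "eventually (\<lambda>x. x \<in> U) (filtermap X sequentially)" by (simp add: eventually_filtermap assms(2))
  ultimately obtain l where l: "l \<in> U" "inf (nhds l) (filtermap X sequentially) \<noteq> bot"
    using assms(1) unfolding compact_filter by blast
  \<comment> \<open>Tails of the sequence intersected with the index sets on which \<open>X\<close>
    is near \<open>l\<close>; these intersections are nonempty because \<open>l\<close> is a cluster
    point.\<close>
  define G where "G = inf sequentially (filtercomap X (nhds l))"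
  have "G \<noteq> bot"
  proof
    assume "G = bot"
    hence "eventually (\<lambda>_. False) G" by simp
    then obtain P Q where PQ: "eventually P sequentially" "eventually Q (filtercomap X (nhds l))"
      "\<And>n. P n \<Longrightarrow> Q n \<Longrightarrow> False"
      unfolding G_def eventually_inf by blast
    then obtain R where R: "eventually R (nhds l)" "\<And>n. R (X n) \<Longrightarrow> Q n"
      unfolding eventually_filtercomap by blast
    have "eventually (\<lambda>x. \<not> R x) (filtermap X sequentially)"
      unfolding eventually_filtermap using PQ(1) by eventually_elim (use R PQ in blast)
    hence "eventually (\<lambda>_. False) (inf (nhds l) (filtermap X sequentially))"
      unfolding eventually_inf using R(1) by blast
    thus False using l(2) by (simp add: trivial_limit_def)
  qed
  moreover have "G \<le> sequentially" by (simp add: G_def)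
  moreover have "(X \<longlongrightarrow> l) G"
    by (rule tendsto_mono[of G "filtercomap X (nhds l)"]) (auto simp: G_def filterlim_filtercomap)
  ultimately show thesis using that[OF l(1)] by blast
qed

context add_closed_algebra
begin

text \<open>Banach-Alaoglu for the evaluations at \<open>a n\<close>. A single filter
  \<open>G\<close> serves all functionals, because convergence in the product topology is
  simultaneous in all coordinates.\<close>

lemma bidual_cluster_point:
  fixes a :: "nat \<Rightarrow> 'a"
  assumes a: "\<And>n. a n \<in> carr A" "\<And>n. nrm A (a n) \<le> 1"
  shows "\<exists>f\<in>carr (dual (dual A)). \<exists>G. G \<noteq> bot \<and> G \<le> sequentially \<and>
    (\<forall>\<phi>\<in>carr (dual A). ((\<lambda>n. \<phi> (a n)) \<longlongrightarrow> f \<phi>) G)"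
proof -
  \<comment> \<open>Coordinates off the dual are pinned to 0, so that the box is compact in the full
    function type.\<close>
  define B where "B \<phi> = (if \<phi> \<in> carr (dual A) then nrm (dual A) \<phi> else 0)" for \<phi>
  define X where "X n = (\<lambda>\<phi>. if \<phi> \<in> carr (dual A) then \<phi> (a n) else 0)" for n
  have "X n \<in> {h. \<forall>\<phi>. cmod (h \<phi>) \<le> B \<phi>}" for n
    by (auto simp: X_def B_def intro: dual_apply_le_nrm a)
  then obtain h G where "h \<in> {h. \<forall>\<phi>. cmod (h \<phi>) \<le> B \<phi>}" and G: "G \<noteq> bot" "G \<le> sequentially"
    and lim: "(X \<longlongrightarrow> h) G"
    by (rule cluster_point_filter[OF compact_cball_pi])
  hence h: "cmod (h \<phi>) \<le> B \<phi>" for \<phi> by blast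
  \<comment> \<open>Off the carrier the value changes from 0 to \<open>undefined\<close>, as
    extensionality of bidual elements requires.\<close>
  define f where "f = (\<lambda>\<phi>\<in>carr (dual A). h \<phi>)"
  have lim\<phi>: "((\<lambda>n. \<phi> (a n)) \<longlongrightarrow> f \<phi>) G" if \<phi>: "\<phi> \<in> carr (dual A)" for \<phi>
  proof -
    have "((\<lambda>n. X n \<phi>) \<longlongrightarrow> h \<phi>) G"
      by (rule continuous_on_tendsto_compose[OF continuous_on_product_coordinates lim]) auto
    thus ?thesis using \<phi> by (simp add: X_def f_def)
  qed
  have "f \<in> carr (dual (dual A))"
  proof (rule dualI[where K = 1])
    fix \<phi> \<psi> assume d: "\<phi> \<in> carr (dual A)" "\<psi> \<in> carr (dual A)"
    have "((\<lambda>n. \<phi> (a n) + \<psi> (a n)) \<longlongrightarrow> f (add (dual A) \<phi> \<psi>)) G"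
      using lim\<phi>[OF dual_add_closed[OF d]] by (simp add: dual_simps a)
    from tendsto_unique[OF G(1) this tendsto_add[OF lim\<phi>[OF d(1)] lim\<phi>[OF d(2)]]]
    show "f (add (dual A) \<phi> \<psi>) = f \<phi> + f \<psi>" .
  next
    fix c \<phi> assume d: "\<phi> \<in> carr (dual A)"
    have "((\<lambda>n. c * \<phi> (a n)) \<longlongrightarrow> f (scl (dual A) c \<phi>)) G"
      using lim\<phi>[OF dual_scl_closed[OF d]] by (simp add: dual_simps a)
    from tendsto_unique[OF G(1) this tendsto_mult_left[OF lim\<phi>[OF d]]]
    show "f (scl (dual A) c \<phi>) = c * f \<phi>" .
  next
    fix \<phi> assume d: "\<phi> \<in> carr (dual A)"
    show "cmod (f \<phi>) \<le> 1 * nrm (dual A) \<phi>" using h[of \<phi>] d by (simp add: f_def B_def)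
  qed (simp add: f_def)
  thus ?thesis using G lim\<phi> by blast
qed

text \<open>On cluster points the Arens products are iterated limits of
  \<open>\<omega> (mul A (a n) (b m))\<close>. The box product takes the limit in \<open>m\<close>
  first, where eventually \<open>n \<le> m\<close>, and gives 1; the diamond product takes the limit
  in \<open>n\<close> first and gives 0.\<close>

theorem not_arens_regular_of_iterated_limits:
  fixes a b :: "nat \<Rightarrow> 'a"
  assumes \<omega>: "\<omega> \<in> carr (dual A)"
    and a: "\<And>n. a n \<in> carr A" "\<And>n. nrm A (a n) \<le> 1"
    and b: "\<And>n. b n \<in> carr A" "\<And>n. nrm A (b n) \<le> 1"
    and ab: "\<And>n m. \<omega> (mul A (a n) (b m)) = (if n \<le> m then 1 else 0)"
  shows "\<not> arens_regular A"
proof -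
  obtain f F where f: "f \<in> carr (dual (dual A))" and F: "F \<noteq> bot" "F \<le> sequentially"
    and flim: "\<And>\<phi>. \<phi> \<in> carr (dual A) \<Longrightarrow> ((\<lambda>n. \<phi> (a n)) \<longlongrightarrow> f \<phi>) F"
    using bidual_cluster_point[of a, OF a] by blast
  obtain g G where g: "g \<in> carr (dual (dual A))" and G: "G \<noteq> bot" "G \<le> sequentially"
    and glim: "\<And>\<phi>. \<phi> \<in> carr (dual A) \<Longrightarrow> ((\<lambda>n. \<phi> (b n)) \<longlongrightarrow> g \<phi>) G"
    using bidual_cluster_point[of b, OF b] by blast
  have left: "bidual_left A g \<omega> (a n) = 1" for n
  proof -
    have "((\<lambda>m. elem_right A \<omega> (a n) (b m)) \<longlongrightarrow> g (elem_right A \<omega> (a n))) G"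
      by (rule glim[OF elem_right_dual[OF \<omega> a(1)]])
    moreover have "((\<lambda>m. elem_right A \<omega> (a n) (b m)) \<longlongrightarrow> 1) G"
    proof (rule tendsto_eventually)
      have "eventually (\<lambda>m. n \<le> m) G" using G(2) eventually_ge_at_top by (rule filter_leD)
      thus "eventually (\<lambda>m. elem_right A \<omega> (a n) (b m) = 1) G"
        by eventually_elim (simp add: elem_right_def b ab)
    qed
    ultimately show ?thesis using tendsto_unique[OF G(1)] by (simp add: bidual_left_def a)
  qed
  hence box: "arens_box A f g \<omega> = 1"
    using flim[OF bidual_left_dual[OF \<omega> g a]] \<omega> F(1)
    by (simp add: arens_box_def left tendsto_const_iff)
  have right: "bidual_right A \<omega> f (b m) = 0" for m
  proof -
    have "((\<lambda>n. elem_left A (b m) \<omega> (a n)) \<longlongrightarrow> f (elem_left A (b m) \<omega>)) F"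
      by (rule flim[OF elem_left_dual[OF \<omega> b(1)]])
    moreover have "((\<lambda>n. elem_left A (b m) \<omega> (a n)) \<longlongrightarrow> 0) F"
    proof (rule tendsto_eventually)
      have "eventually (\<lambda>n. m < n) F" using F(2) eventually_gt_at_top by (rule filter_leD)
      thus "eventually (\<lambda>n. elem_left A (b m) \<omega> (a n) = 0) F"
        by eventually_elim (simp add: elem_left_def a ab)
    qed
    ultimately show ?thesis using tendsto_unique[OF F(1)] by (simp add: bidual_right_def b)
  qed
  hence "arens_diamond A f g \<omega> = 0"
    using glim[OF bidual_right_dual[OF \<omega> f a]] \<omega> G(1)
    by (simp add: arens_diamond_def right tendsto_const_iff)
  with box have "arens_box A f g \<noteq> arens_diamond A f g" by auto
  thus ?thesis using f g unfolding arens_regular_def by blast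
qed

end

section \<open>Completions\<close>

abbreviation dif :: "('a, 'm) nspace_scheme \<Rightarrow> 'a \<Rightarrow> 'a \<Rightarrow> 'a" where
  "dif A x y \<equiv> add A x (scl A (- 1) y)"

text \<open>The vector space axioms enter the completion only through identities between differences,
  which are immediate for a quotient of a vector space.\<close>

locale seminormed_algebra = add_closed_algebra +
  assumes nrm_add_le: "x \<in> carr A \<Longrightarrow> y \<in> carr A \<Longrightarrow> nrm A (add A x y) \<le> nrm A x + nrm A y"
    and nrm_dif_self: "x \<in> carr A \<Longrightarrow> nrm A (dif A x x) = 0"
    and dif_swap: "x \<in> carr A \<Longrightarrow> y \<in> carr A \<Longrightarrow> dif A y x = scl A (- 1) (dif A x y)"
    and dif_dif: "x \<in> carr A \<Longrightarrow> y \<in> carr A \<Longrightarrow> z \<in> carr A \<Longrightarrow>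
      dif A x z = add A (dif A x y) (dif A y z)"
    and dif_add_cancel: "x \<in> carr A \<Longrightarrow> y \<in> carr A \<Longrightarrow> add A (dif A x y) y = x"
    and dif_add: "x \<in> carr A \<Longrightarrow> y \<in> carr A \<Longrightarrow> x' \<in> carr A \<Longrightarrow> y' \<in> carr A \<Longrightarrow>
      dif A (add A x x') (add A y y') = add A (dif A x y) (dif A x' y')"
    and dif_scl: "x \<in> carr A \<Longrightarrow> y \<in> carr A \<Longrightarrow> dif A (scl A c x) (scl A c y) = scl A c (dif A x y)"
    and dif_mul: "x \<in> carr A \<Longrightarrow> y \<in> carr A \<Longrightarrow> x' \<in> carr A \<Longrightarrow> y' \<in> carr A \<Longrightarrow>
      dif A (mul A x x') (mul A y y') = add A (mul A (dif A x y) x') (mul A y (dif A x' y'))"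
begin

lemma dif_closed: "x \<in> carr A \<Longrightarrow> y \<in> carr A \<Longrightarrow> dif A x y \<in> carr A"
  by (intro add_closed scl_closed)

lemma ndist_nonneg: "x \<in> carr A \<Longrightarrow> y \<in> carr A \<Longrightarrow> 0 \<le> ndist A x y"
  unfolding ndist_def by (intro nrm_nonneg dif_closed)

lemma ndist_self: "x \<in> carr A \<Longrightarrow> ndist A x x = 0"
  unfolding ndist_def by (rule nrm_dif_self)

lemma ndist_commute:
  assumes "x \<in> carr A" "y \<in> carr A"
  shows "ndist A x y = ndist A y x"
  using nrm_scl_le[OF dif_closed[OF assms], of "- 1"] nrm_scl_le[OF dif_closed[OF assms(2,1)], of "- 1"]
  unfolding ndist_def dif_swap[OF assms, symmetric] dif_swap[OF assms(2,1), symmetric] by simp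

lemma ndist_triangle:
  assumes "x \<in> carr A" "y \<in> carr A" "z \<in> carr A"
  shows "ndist A x z \<le> ndist A x y + ndist A y z"
  unfolding ndist_def dif_dif[OF assms] by (intro nrm_add_le dif_closed assms)

lemma nrm_diff_le:
  assumes "x \<in> carr A" "y \<in> carr A"
  shows "\<bar>nrm A x - nrm A y\<bar> \<le> ndist A x y"
proof -
  have *: "nrm A x \<le> ndist A x y + nrm A y" if "x \<in> carr A" "y \<in> carr A" for x y
    using nrm_add_le[OF dif_closed[OF that] that(2)] unfolding dif_add_cancel[OF that] ndist_def .
  show ?thesis using *[OF assms] *[OF assms(2,1)] ndist_commute[OF assms] by linarith
qed

lemma ndist_add:
  assumes "x \<in> carr A" "y \<in> carr A" "x' \<in> carr A" "y' \<in> carr A"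
  shows "ndist A (add A x x') (add A y y') \<le> ndist A x y + ndist A x' y'"
  unfolding ndist_def dif_add[OF assms] by (intro nrm_add_le dif_closed assms)

lemma ndist_scl:
  assumes "x \<in> carr A" "y \<in> carr A"
  shows "ndist A (scl A c x) (scl A c y) \<le> cmod c * ndist A x y"
  unfolding ndist_def dif_scl[OF assms] by (intro nrm_scl_le dif_closed assms)

lemma ndist_mul:
  assumes "x \<in> carr A" "y \<in> carr A" "x' \<in> carr A" "y' \<in> carr A"
  shows "ndist A (mul A x x') (mul A y y') \<le> ndist A x y * nrm A x' + nrm A y * ndist A x' y'"
  unfolding ndist_def dif_mul[OF assms]
  by (intro order_trans[OF nrm_add_le] add_mono nrm_mul_le mul_closed dif_closed assms)

abbreviation seqs where "seqs \<equiv> cauchy_seqs A"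

lemma cauchy_carr: "s \<in> seqs \<Longrightarrow> s n \<in> carr A"
  by (simp add: cauchy_seqs_def)

lemma cauchy_seqsD: "s \<in> seqs \<Longrightarrow> 0 < e \<Longrightarrow> \<exists>N. \<forall>m\<ge>N. \<forall>n\<ge>N. ndist A (s m) (s n) < e"
  by (simp add: cauchy_seqs_def)

text \<open>Two dominating sequences let one criterion cover binary operations; unary ones use the
  same sequence twice. \<open>null_rel_dominated\<close> is the counterpart showing that operations
  respect equivalence.\<close>

lemma cauchy_seqs_dominated:
  assumes s: "s \<in> seqs" and s': "s' \<in> seqs" and t: "\<And>n. t n \<in> carr A" and C: "0 \<le> C"
    and le: "\<And>m n. ndist A (t m) (t n) \<le> C * (ndist A (s m) (s n) + ndist A (s' m) (s' n))"
  shows "t \<in> seqs"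
  unfolding cauchy_seqs_def
proof (intro CollectI conjI allI impI t)
  fix e :: real assume "0 < e"
  \<comment> \<open>Half for each dominating sequence, with \<open>C + 1\<close> in the denominator
    since \<open>C\<close> may be 0; then \<open>C * (e / (C + 1)) < e\<close>.\<close>
  hence d: "0 < e / (2 * (C + 1))" using C by simp
  from cauchy_seqsD[OF s d] obtain N where N: "\<forall>m\<ge>N. \<forall>n\<ge>N. ndist A (s m) (s n) < e / (2 * (C + 1))" ..
  from cauchy_seqsD[OF s' d] obtain M where M: "\<forall>m\<ge>M. \<forall>n\<ge>M. ndist A (s' m) (s' n) < e / (2 * (C + 1))" ..
  have "ndist A (t m) (t n) < e" if "m \<ge> max N M" "n \<ge> max N M" for m n
  proof -
    have "ndist A (s m) (s n) + ndist A (s' m) (s' n) < e / (2 * (C + 1)) + e / (2 * (C + 1))"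
      using N M that by (intro add_strict_mono) auto
    also have "\<dots> = e / (C + 1)"
      using add_divide_distrib[of e e "2 * (C + 1)"] mult_divide_mult_cancel_left[of 2 e "C + 1"] by simp
    finally have "C * (ndist A (s m) (s n) + ndist A (s' m) (s' n)) \<le> C * (e / (C + 1))"
      using C by (intro mult_left_mono) auto
    also have "\<dots> < e" using C \<open>0 < e\<close> by (simp add: field_simps)
    finally show ?thesis using le[of m n] by linarith
  qed
  thus "\<exists>N. \<forall>m\<ge>N. \<forall>n\<ge>N. ndist A (t m) (t n) < e" by blast
qed

lemma null_rel_dominated:
  assumes s: "(s, u) \<in> null_rel A" and s': "(s', u') \<in> null_rel A"
    and t: "t \<in> seqs" "v \<in> seqs"
    and le: "\<And>n. ndist A (t n) (v n) \<le> C * (ndist A (s n) (u n) + ndist A (s' n) (u' n))"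
  shows "(t, v) \<in> null_rel A"
proof -
  have lim: "(\<lambda>n. C * (ndist A (s n) (u n) + ndist A (s' n) (u' n))) \<longlonglongrightarrow> C * (0 + 0)"
    using s s' by (intro tendsto_intros) (auto simp: null_rel_def)
  have "(\<lambda>n. ndist A (t n) (v n)) \<longlonglongrightarrow> 0"
  proof (rule tendsto_sandwich[OF always_eventually always_eventually tendsto_const])
    show "\<forall>n. 0 \<le> ndist A (t n) (v n)" by (intro allI ndist_nonneg cauchy_carr t)
    show "\<forall>n. ndist A (t n) (v n) \<le> C * (ndist A (s n) (u n) + ndist A (s' n) (u' n))" by (intro allI le)
    show "(\<lambda>n. C * (ndist A (s n) (u n) + ndist A (s' n) (u' n))) \<longlonglongrightarrow> 0" using lim by simp
  qed
  thus ?thesis using t by (simp add: null_rel_def)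
qed

lemma Cauchy_nrm: "s \<in> seqs \<Longrightarrow> Cauchy (\<lambda>n. nrm A (s n))"
proof (rule metric_CauchyI)
  fix e :: real assume s: "s \<in> seqs" and "0 < e"
  then obtain N where N: "\<forall>m\<ge>N. \<forall>n\<ge>N. ndist A (s m) (s n) < e" using cauchy_seqsD by blast
  have "dist (nrm A (s m)) (nrm A (s n)) < e" if "m \<ge> N" "n \<ge> N" for m n
    using nrm_diff_le[OF cauchy_carr[OF s] cauchy_carr[OF s], of m n] N that
    unfolding dist_real_def by (meson le_less_trans)
  thus "\<exists>N. \<forall>m\<ge>N. \<forall>n\<ge>N. dist (nrm A (s m)) (nrm A (s n)) < e" by blast
qed

lemma cauchy_bounded:
  assumes "s \<in> seqs"
  obtains B where "0 \<le> B" "\<And>n. nrm A (s n) \<le> B"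
proof -
  have "Bseq (\<lambda>n. nrm A (s n))" by (rule Cauchy_Bseq[OF Cauchy_nrm[OF assms]])
  then obtain B where "0 < B" "\<And>n. norm (nrm A (s n)) \<le> B" unfolding Bseq_def by blast
  hence "0 \<le> B" "\<And>n. nrm A (s n) \<le> B" by (auto intro: order_trans[OF abs_ge_self] less_imp_le)
  thus thesis by (rule that)
qed

lemma cauchy_const: "x \<in> carr A \<Longrightarrow> (\<lambda>_. x) \<in> seqs"
  by (simp add: cauchy_seqs_def ndist_self)

lemma cauchy_add:
  "s \<in> seqs \<Longrightarrow> t \<in> seqs \<Longrightarrow> (\<lambda>n. add A (s n) (t n)) \<in> seqs"
  by (rule cauchy_seqs_dominated[where s = s and s' = t and C = 1])
     (auto intro: add_closed ndist_add cauchy_carr)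

lemma cauchy_scl:
  "s \<in> seqs \<Longrightarrow> (\<lambda>n. scl A c (s n)) \<in> seqs"
proof (rule cauchy_seqs_dominated[where s = s and s' = s and C = "cmod c"])
  assume s: "s \<in> seqs"
  show "ndist A (scl A c (s m)) (scl A c (s n)) \<le> cmod c * (ndist A (s m) (s n) + ndist A (s m) (s n))" for m n
    using ndist_scl[OF cauchy_carr[OF s] cauchy_carr[OF s], of c m n]
      mult_nonneg_nonneg[OF norm_ge_zero[of c] ndist_nonneg[OF cauchy_carr[OF s] cauchy_carr[OF s], of m n]]
    by (simp add: distrib_left)
qed (auto intro: scl_closed cauchy_carr)

text \<open>Multiplication is Lipschitz only on bounded sets, so the constant comes from the bounds
  of the Cauchy sequences \<open>t\<close> and \<open>u\<close>. Four sequences and independent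
  indices make it fit both the Cauchy property of products and their independence of
  representatives.\<close>

lemma ndist_mul_dominated:
  assumes s: "s \<in> seqs" and t: "t \<in> seqs" and u: "u \<in> seqs" and v: "v \<in> seqs"
  shows "\<exists>B\<ge>0. \<forall>m n. ndist A (mul A (s m) (t m)) (mul A (u n) (v n))
    \<le> B * (ndist A (s m) (u n) + ndist A (t m) (v n))"
proof -
  obtain B1 where B1: "0 \<le> B1" "\<And>n. nrm A (t n) \<le> B1" using cauchy_bounded[OF t] by metis
  obtain B2 where B2: "0 \<le> B2" "\<And>n. nrm A (u n) \<le> B2" using cauchy_bounded[OF u] by metis
  show ?thesis
  proof (intro exI[of _ "max B1 B2"] conjI allI)
    fix m n
    note c = cauchy_carr[OF s, of m] cauchy_carr[OF u, of n] cauchy_carr[OF t, of m] cauchy_carr[OF v, of n]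
    have "nrm A (t m) \<le> max B1 B2" "nrm A (u n) \<le> max B1 B2" using B1(2)[of m] B2(2)[of n] by auto
    hence "ndist A (s m) (u n) * nrm A (t m) + nrm A (u n) * ndist A (t m) (v n)
        \<le> ndist A (s m) (u n) * max B1 B2 + max B1 B2 * ndist A (t m) (v n)"
      by (intro add_mono mult_left_mono mult_right_mono ndist_nonneg c)
    thus "ndist A (mul A (s m) (t m)) (mul A (u n) (v n)) \<le> max B1 B2 * (ndist A (s m) (u n) + ndist A (t m) (v n))"
      using ndist_mul[OF c] by (simp add: algebra_simps)
  qed (use B1 in simp)
qed

lemma cauchy_mul:
  assumes s: "s \<in> seqs" and t: "t \<in> seqs"
  shows "(\<lambda>n. mul A (s n) (t n)) \<in> seqs"
proof -
  obtain B where B: "0 \<le> B" "\<forall>m n. ndist A (mul A (s m) (t m)) (mul A (s n) (t n))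
    \<le> B * (ndist A (s m) (s n) + ndist A (t m) (t n))"
    using ndist_mul_dominated[OF s t s t] by blast
  show ?thesis
    by (rule cauchy_seqs_dominated[OF s t _ B(1) B(2)[rule_format]]) (intro mul_closed cauchy_carr s t)
qed

lemma equiv_null_rel: "equiv (seqs) (null_rel A)"
proof (rule equivI)
  show "null_rel A \<subseteq> seqs \<times> seqs" by (auto simp: null_rel_def)
  show "refl_on (seqs) (null_rel A)"
    by (auto simp: refl_on_def null_rel_def ndist_self cauchy_carr)
  show "sym (null_rel A)"
    by (rule symI) (auto simp: null_rel_def ndist_commute cauchy_carr)
  show "trans (null_rel A)"
  proof (rule transI)
    fix s t u assume st: "(s, t) \<in> null_rel A" and tu: "(t, u) \<in> null_rel A"
    hence c: "s \<in> seqs" "t \<in> seqs" "u \<in> seqs" by (auto simp: null_rel_def)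
    show "(s, u) \<in> null_rel A"
      by (rule null_rel_dominated[OF st tu c(1,3), where C = 1]) (simp add: ndist_triangle cauchy_carr c)
  qed
qed

abbreviation C where "C \<equiv> completion A"

abbreviation ccl :: "(nat \<Rightarrow> 'a) \<Rightarrow> (nat \<Rightarrow> 'a) set" where
  "ccl s \<equiv> null_rel A `` {s}"

lemma ccl_eq: "(s, t) \<in> null_rel A \<Longrightarrow> ccl s = ccl t"
  by (rule equiv_class_eq[OF equiv_null_rel])

lemma completion_carrI: "s \<in> seqs \<Longrightarrow> ccl s \<in> carr C"
  by (simp add: completion_def quotientI)

lemma completion_carrE:
  assumes "X \<in> carr C"
  obtains s where "s \<in> seqs" "X = ccl s"
  using assms by (auto simp: completion_def elim: quotientE)

lemma completion_add:
  assumes "s \<in> seqs" "t \<in> seqs"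
  shows "add C (ccl s) (ccl t) = ccl (\<lambda>n. add A (s n) (t n))"
proof -
  have "congruent2 (null_rel A) (null_rel A) (\<lambda>s t. ccl (\<lambda>n. add A (s n) (t n)))"
  proof (rule congruent2I')
    fix s u t v assume su: "(s, u) \<in> null_rel A" and tv: "(t, v) \<in> null_rel A"
    hence c: "s \<in> seqs" "t \<in> seqs" "u \<in> seqs" "v \<in> seqs"
      by (auto simp: null_rel_def)
    show "ccl (\<lambda>n. add A (s n) (t n)) = ccl (\<lambda>n. add A (u n) (v n))"
    proof (rule ccl_eq, rule null_rel_dominated[OF su tv])
      show "ndist A (add A (s n) (t n)) (add A (u n) (v n)) \<le> 1 * (ndist A (s n) (u n) + ndist A (t n) (v n))" for n
        unfolding mult_1 by (intro ndist_add cauchy_carr c)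
    qed (intro cauchy_add c)+
  qed
  from UN_equiv_class2[OF equiv_null_rel equiv_null_rel this assms]
  show ?thesis by (simp add: completion_def)
qed

lemma completion_scl:
  assumes "s \<in> seqs"
  shows "scl C c (ccl s) = ccl (\<lambda>n. scl A c (s n))"
proof -
  have "congruent (null_rel A) (\<lambda>s. ccl (\<lambda>n. scl A c (s n)))"
  proof (rule congruentI)
    fix s u assume su: "(s, u) \<in> null_rel A"
    hence c: "s \<in> seqs" "u \<in> seqs" by (auto simp: null_rel_def)
    show "ccl (\<lambda>n. scl A c (s n)) = ccl (\<lambda>n. scl A c (u n))"
    proof (rule ccl_eq, rule null_rel_dominated[OF su su])
      fix n
      \<comment> \<open>The pair \<open>su\<close> fills both slots of
        \<open>null_rel_dominated\<close>, hence the halved constant.\<close>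
      show "ndist A (scl A c (s n)) (scl A c (u n)) \<le> (cmod c / 2) * (ndist A (s n) (u n) + ndist A (s n) (u n))"
        using ndist_scl[OF cauchy_carr[OF c(1)] cauchy_carr[OF c(2)], of c n n] by simp
    qed (intro cauchy_scl c)+
  qed
  from UN_equiv_class[OF equiv_null_rel this assms]
  show ?thesis by (simp add: completion_def)
qed

lemma completion_mul:
  assumes "s \<in> seqs" "t \<in> seqs"
  shows "mul C (ccl s) (ccl t) = ccl (\<lambda>n. mul A (s n) (t n))"
proof -
  have "congruent2 (null_rel A) (null_rel A) (\<lambda>s t. ccl (\<lambda>n. mul A (s n) (t n)))"
  proof (rule congruent2I')
    fix s u t v assume su: "(s, u) \<in> null_rel A" and tv: "(t, v) \<in> null_rel A"
    hence c: "s \<in> seqs" "t \<in> seqs" "u \<in> seqs" "v \<in> seqs"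
      by (auto simp: null_rel_def)
    obtain B where B: "\<forall>m n. ndist A (mul A (s m) (t m)) (mul A (u n) (v n))
      \<le> B * (ndist A (s m) (u n) + ndist A (t m) (v n))"
      using ndist_mul_dominated[OF c] by blast
    show "ccl (\<lambda>n. mul A (s n) (t n)) = ccl (\<lambda>n. mul A (u n) (v n))"
      by (rule ccl_eq, rule null_rel_dominated[OF su tv _ _ B[rule_format]]) (intro cauchy_mul c)+
  qed
  from UN_equiv_class2[OF equiv_null_rel equiv_null_rel this assms]
  show ?thesis by (simp add: completion_def)
qed

text \<open>A general normed target covers both uses of this \<open>THE\<close>: the real norm of
  the completion and the complex values of an extended functional.\<close>

lemma the_limit_ccl:
  fixes f :: "'a \<Rightarrow> 'v::real_normed_vector"
  assumes s: "s \<in> seqs"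
    and f: "\<And>x y. x \<in> carr A \<Longrightarrow> y \<in> carr A \<Longrightarrow> dist (f x) (f y) \<le> ndist A x y"
    and lim: "(\<lambda>n. f (s n)) \<longlonglongrightarrow> l"
  shows "(THE r. \<forall>t\<in>ccl s. (\<lambda>n. f (t n)) \<longlonglongrightarrow> r) = l"
proof (rule the_equality)
  show "\<forall>t\<in>ccl s. (\<lambda>n. f (t n)) \<longlonglongrightarrow> l"
  proof
    fix t assume "t \<in> ccl s"
    hence t: "(s, t) \<in> null_rel A" by simp
    hence c: "s \<in> seqs" "t \<in> seqs" and null: "(\<lambda>n. ndist A (s n) (t n)) \<longlonglongrightarrow> 0"
      by (auto simp: null_rel_def)
    have "norm (f (t n) - f (s n)) \<le> ndist A (s n) (t n)" for n
      using f[OF cauchy_carr[OF c(1)] cauchy_carr[OF c(2)], of n n] by (simp only: dist_norm norm_minus_commute)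
    hence "(\<lambda>n. f (t n) - f (s n)) \<longlonglongrightarrow> 0"
      by (intro Lim_null_comparison[OF _ null] always_eventually allI)
    with lim show "(\<lambda>n. f (t n)) \<longlonglongrightarrow> l" by (rule Lim_transform)
  qed
  fix r assume "\<forall>t\<in>ccl s. (\<lambda>n. f (t n)) \<longlonglongrightarrow> r"
  hence "(\<lambda>n. f (s n)) \<longlonglongrightarrow> r" using equiv_class_self[OF equiv_null_rel s] by blast
  thus "r = l" using lim LIMSEQ_unique by blast
qed

lemma completion_nrm:
  assumes "s \<in> seqs"
  shows "(\<lambda>n. nrm A (s n)) \<longlonglongrightarrow> nrm C (ccl s)"
proof -
  obtain l where l: "(\<lambda>n. nrm A (s n)) \<longlonglongrightarrow> l"
    using Cauchy_nrm[OF assms] Cauchy_convergent_iff convergent_def by blast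
  have "nrm C (ccl s) = (THE r. \<forall>t\<in>ccl s. (\<lambda>n. nrm A (t n)) \<longlonglongrightarrow> r)"
    by (simp add: completion_def)
  also have "\<dots> = l" by (rule the_limit_ccl[OF assms _ l]) (simp add: dist_real_def nrm_diff_le)
  finally show ?thesis using l by simp
qed

lemma completion_add_closed_algebra: "add_closed_algebra C"
proof unfold_locales
  fix X c assume "X \<in> carr C"
  then obtain s where s: "s \<in> seqs" and X: "X = ccl s" by (rule completion_carrE)
  show "scl C c X \<in> carr C"
    by (simp add: X completion_scl completion_carrI cauchy_scl s)
  show "0 \<le> nrm C X"
    unfolding X by (rule LIMSEQ_le_const[OF completion_nrm[OF s]]) (simp add: nrm_nonneg cauchy_carr s)
  show "nrm C (scl C c X) \<le> cmod c * nrm C X"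
    unfolding X completion_scl[OF s]
    by (rule LIMSEQ_le[OF completion_nrm[OF cauchy_scl[OF s]] tendsto_mult_left[OF completion_nrm[OF s]]])
       (simp add: nrm_scl_le cauchy_carr s)
next
  fix X Y c assume "X \<in> carr C" "Y \<in> carr C"
  then obtain s t where s: "s \<in> seqs" and X: "X = ccl s" and t: "t \<in> seqs" and Y: "Y = ccl t"
    by (elim completion_carrE)
  show "mul C X Y \<in> carr C"
    by (simp add: X Y completion_mul completion_carrI cauchy_mul s t)
  show "add C X Y \<in> carr C"
    by (simp add: X Y completion_add completion_carrI cauchy_add s t)
  show "nrm C (mul C X Y) \<le> nrm C X * nrm C Y"
    unfolding X Y completion_mul[OF s t]
    by (rule LIMSEQ_le[OF completion_nrm[OF cauchy_mul[OF s t]]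
          tendsto_mult[OF completion_nrm[OF s] completion_nrm[OF t]]])
       (simp add: nrm_mul_le cauchy_carr s t)
  show "mul C (scl C c X) Y = scl C c (mul C X Y)"
    by (simp add: X Y completion_mul completion_scl cauchy_scl cauchy_mul s t scl_mul cauchy_carr)
  show "mul C X (scl C c Y) = scl C c (mul C X Y)"
    by (simp add: X Y completion_mul completion_scl cauchy_scl cauchy_mul s t mul_scl cauchy_carr)
next
  fix X Y Z assume "X \<in> carr C" "Y \<in> carr C" "Z \<in> carr C"
  then obtain s t u where s: "s \<in> seqs" and X: "X = ccl s" and t: "t \<in> seqs" and Y: "Y = ccl t"
    and u: "u \<in> seqs" and Z: "Z = ccl u"
    by (elim completion_carrE)
  show "mul C (add C X Y) Z = add C (mul C X Z) (mul C Y Z)"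
    by (simp add: X Y Z completion_mul completion_add cauchy_add cauchy_mul s t u add_mul cauchy_carr)
  show "mul C X (add C Y Z) = add C (mul C X Y) (mul C X Z)"
    by (simp add: X Y Z completion_mul completion_add cauchy_add cauchy_mul s t u mul_add cauchy_carr)
qed

text \<open>Extension by continuity: linearity and the bound make \<open>\<psi>\<close> 1-Lipschitz
  for \<open>ndist\<close>, so its values along a Cauchy sequence converge.\<close>

lemma completion_functional:
  fixes \<psi> :: "'a \<Rightarrow> complex"
  assumes add: "\<And>x y. x \<in> carr A \<Longrightarrow> y \<in> carr A \<Longrightarrow> \<psi> (add A x y) = \<psi> x + \<psi> y"
    and scl: "\<And>c x. x \<in> carr A \<Longrightarrow> \<psi> (scl A c x) = c * \<psi> x"
    and bound: "\<And>x. x \<in> carr A \<Longrightarrow> cmod (\<psi> x) \<le> nrm A x"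
  shows "\<exists>\<omega>\<in>carr (dual C). \<forall>x\<in>carr A. \<omega> (ccl (\<lambda>_. x)) = \<psi> x"
proof -
  define \<omega> where "\<omega> = (\<lambda>X\<in>carr C. THE r. \<forall>t\<in>X. (\<lambda>n. \<psi> (t n)) \<longlonglongrightarrow> r)"
  have lip: "dist (\<psi> x) (\<psi> y) \<le> ndist A x y" if "x \<in> carr A" "y \<in> carr A" for x y
    using bound[OF dif_closed[OF that]] that by (simp add: add scl scl_closed dist_norm ndist_def)
  have \<omega>_eq: "\<omega> (ccl s) = l" if s: "s \<in> seqs" "(\<lambda>n. \<psi> (s n)) \<longlonglongrightarrow> l" for s l
    using the_limit_ccl[OF s(1) lip s(2)] by (simp add: \<omega>_def completion_carrI s(1))
  have lim: "(\<lambda>n. \<psi> (s n)) \<longlonglongrightarrow> \<omega> (ccl s)" if s: "s \<in> seqs" for s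
  proof -
    have "Cauchy (\<lambda>n. \<psi> (s n))"
    proof (rule metric_CauchyI)
      fix e :: real assume "0 < e"
      then obtain N where "\<forall>m\<ge>N. \<forall>n\<ge>N. ndist A (s m) (s n) < e" using cauchy_seqsD[OF s] by blast
      thus "\<exists>N. \<forall>m\<ge>N. \<forall>n\<ge>N. dist (\<psi> (s m)) (\<psi> (s n)) < e"
        using lip[OF cauchy_carr[OF s] cauchy_carr[OF s]] le_less_trans by blast
    qed
    then obtain l where "(\<lambda>n. \<psi> (s n)) \<longlonglongrightarrow> l" using Cauchy_convergent convergent_def by blast
    thus ?thesis using \<omega>_eq[OF s] by simp
  qed
  have "\<omega> \<in> carr (dual C)"
  proof (rule dualI[where K = 1])
    show "\<omega> \<in> extensional (carr C)" by (simp add: \<omega>_def)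
  next
    fix X Y assume "X \<in> carr C" "Y \<in> carr C"
    then obtain s t where st: "s \<in> seqs" "X = ccl s" "t \<in> seqs" "Y = ccl t"
      by (metis completion_carrE)
    have "(\<lambda>n. \<psi> (add A (s n) (t n))) \<longlonglongrightarrow> \<omega> (ccl s) + \<omega> (ccl t)"
      using tendsto_add[OF lim[OF st(1)] lim[OF st(3)]] by (simp add: add cauchy_carr st)
    thus "\<omega> (add C X Y) = \<omega> X + \<omega> Y"
      unfolding st completion_add[OF st(1,3)] by (rule \<omega>_eq[OF cauchy_add[OF st(1,3)]])
  next
    fix c X assume "X \<in> carr C"
    then obtain s where s: "s \<in> seqs" "X = ccl s" by (rule completion_carrE)
    have "(\<lambda>n. \<psi> (scl A c (s n))) \<longlonglongrightarrow> c * \<omega> (ccl s)"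
      using tendsto_mult_left[OF lim[OF s(1)]] by (simp add: scl cauchy_carr s)
    thus "\<omega> (scl C c X) = c * \<omega> X"
      unfolding s completion_scl[OF s(1)] by (rule \<omega>_eq[OF cauchy_scl[OF s(1)]])
  next
    fix X assume "X \<in> carr C"
    then obtain s where s: "s \<in> seqs" "X = ccl s" by (rule completion_carrE)
    have "cmod (\<omega> (ccl s)) \<le> nrm C (ccl s)"
      by (rule LIMSEQ_le[OF tendsto_norm[OF lim[OF s(1)]] completion_nrm[OF s(1)]])
         (simp add: bound cauchy_carr s)
    thus "cmod (\<omega> X) \<le> 1 * nrm C X" by (simp add: s)
  qed
  moreover have "\<omega> (ccl (\<lambda>_. x)) = \<psi> x" if "x \<in> carr A" for x
    by (rule \<omega>_eq[OF cauchy_const[OF that] tendsto_const])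
  ultimately show ?thesis by blast
qed

text \<open>Constant sequences embed \<open>A\<close> isometrically and multiplicatively, so the
  functional and the two test sequences can be given before completing.\<close>

lemma completion_not_arens_regular:
  fixes \<psi> :: "'a \<Rightarrow> complex" and a b :: "nat \<Rightarrow> 'a"
  assumes add: "\<And>x y. x \<in> carr A \<Longrightarrow> y \<in> carr A \<Longrightarrow> \<psi> (add A x y) = \<psi> x + \<psi> y"
    and scl: "\<And>c x. x \<in> carr A \<Longrightarrow> \<psi> (scl A c x) = c * \<psi> x"
    and bound: "\<And>x. x \<in> carr A \<Longrightarrow> cmod (\<psi> x) \<le> nrm A x"
    and a: "\<And>n. a n \<in> carr A" "\<And>n. nrm A (a n) \<le> 1"
    and b: "\<And>n. b n \<in> carr A" "\<And>n. nrm A (b n) \<le> 1"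
    and ab: "\<And>n m. \<psi> (mul A (a n) (b m)) = (if n \<le> m then 1 else 0)"
  shows "\<not> arens_regular C"
proof -
  interpret completion: add_closed_algebra C by (rule completion_add_closed_algebra)
  obtain \<omega> where \<omega>: "\<omega> \<in> carr (dual C)" "\<And>x. x \<in> carr A \<Longrightarrow> \<omega> (ccl (\<lambda>_. x)) = \<psi> x"
    using completion_functional[of \<psi>, OF add scl bound] by blast
  have nrm: "nrm C (ccl (\<lambda>_. x)) = nrm A x" if "x \<in> carr A" for x
    using completion_nrm[OF cauchy_const[OF that]] by (simp add: tendsto_const_iff)
  show ?thesis
    by (rule completion.not_arens_regular_of_iterated_limits[OF \<omega>(1),
          where a = "\<lambda>n. ccl (\<lambda>_. a n)" and b = "\<lambda>n. ccl (\<lambda>_. b n)"])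
       (simp_all add: completion_carrI cauchy_const a b nrm completion_mul \<omega>(2) mul_closed ab)
qed

end

section \<open>Projective tensor products\<close>

lemma lookup_free_scl [simp]: "Poly_Mapping.lookup (free_scl c u) k = c * Poly_Mapping.lookup u k"
  by (simp add: free_scl_def Poly_Mapping.map.rep_eq when_def)

interpretation free: vector_space "free_scl :: complex \<Rightarrow> ('c \<Rightarrow>\<^sub>0 complex) \<Rightarrow> ('c \<Rightarrow>\<^sub>0 complex)"
  by unfold_locales (auto intro!: poly_mapping_eqI simp: lookup_add algebra_simps)

lemma keys_free_scl: "Poly_Mapping.keys (free_scl c u) \<subseteq> Poly_Mapping.keys u"
  by (auto simp: in_keys_iff)

lemma keys_diff_subset: "Poly_Mapping.keys (u - v) \<subseteq> Poly_Mapping.keys u \<union> Poly_Mapping.keys (v :: 'c \<Rightarrow>\<^sub>0 complex)"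
  by (auto simp: in_keys_iff lookup_minus)

lemma keys_sum_subset:
  "(\<And>i. i \<in> I \<Longrightarrow> Poly_Mapping.keys (f i :: 'c \<Rightarrow>\<^sub>0 complex) \<subseteq> K) \<Longrightarrow> Poly_Mapping.keys (sum f I) \<subseteq> K"
proof (induction I rule: infinite_finite_induct)
  case (insert i I)
  have "Poly_Mapping.keys (f i) \<subseteq> K" "Poly_Mapping.keys (sum f I) \<subseteq> K" using insert by auto
  thus ?case using keys_add[of "f i" "sum f I"] insert by auto
qed auto

lemma poly_mapping_expansion:
  "(u :: 'c \<Rightarrow>\<^sub>0 complex) = (\<Sum>k\<in>Poly_Mapping.keys u. free_scl (Poly_Mapping.lookup u k) (Poly_Mapping.single k 1))"
proof (rule poly_mapping_eqI)
  fix k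
  have "(\<Sum>x\<in>Poly_Mapping.keys u. Poly_Mapping.lookup u x * (if x = k then 1 else 0))
      = (\<Sum>x\<in>Poly_Mapping.keys u. if x = k then Poly_Mapping.lookup u x else 0)"
    by (rule sum.cong) auto
  thus "Poly_Mapping.lookup u k = Poly_Mapping.lookup
      (\<Sum>k\<in>Poly_Mapping.keys u. free_scl (Poly_Mapping.lookup u k) (Poly_Mapping.single k 1)) k"
    by (simp add: lookup_sum lookup_single when_def in_keys_iff)
qed

text \<open>The linear extension of \<open>\<phi>\<close> from the basis to the free vector
  space.\<close>

definition lift :: "('c \<Rightarrow> complex) \<Rightarrow> ('c \<Rightarrow>\<^sub>0 complex) \<Rightarrow> complex" where
  "lift \<phi> u = (\<Sum>k\<in>Poly_Mapping.keys u. Poly_Mapping.lookup u k * \<phi> k)"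

lemma lift_eq_sum:
  assumes "finite K" "Poly_Mapping.keys u \<subseteq> K"
  shows "lift \<phi> u = (\<Sum>k\<in>K. Poly_Mapping.lookup u k * \<phi> k)"
  unfolding lift_def by (rule sum.mono_neutral_left) (use assms in \<open>auto simp: in_keys_iff\<close>)

lemma lift_add: "lift \<phi> (u + v) = lift \<phi> u + lift \<phi> v"
proof -
  define K where "K = Poly_Mapping.keys u \<union> Poly_Mapping.keys v"
  have "finite K" "Poly_Mapping.keys u \<subseteq> K" "Poly_Mapping.keys v \<subseteq> K" "Poly_Mapping.keys (u + v) \<subseteq> K"
    using keys_add[of u v] by (auto simp: K_def)
  thus ?thesis by (simp add: lift_eq_sum lookup_add distrib_right sum.distrib)
qed

lemma lift_scl: "lift \<phi> (free_scl c u) = c * lift \<phi> u"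
  using lift_eq_sum[OF finite_keys keys_free_scl, of \<phi> c u]
  by (simp add: lift_def sum_distrib_left mult.assoc)

lemma lift_diff: "lift \<phi> (u - v) = lift \<phi> u - lift \<phi> v"
  using lift_add[of \<phi> "u - v" v] by simp

lemma lift_single [simp]: "lift \<phi> (Poly_Mapping.single k 1) = \<phi> k"
  by (simp add: lift_def)

text \<open>The definition sums over the keys, which shrink under cancellation. Larger common index
  sets make additivity a termwise identity.\<close>

lemma free_mul_eq_sum:
  assumes "finite K" "Poly_Mapping.keys u \<subseteq> K" "finite L" "Poly_Mapping.keys v \<subseteq> L"
  shows "free_mul A B u v = (\<Sum>a\<in>K. \<Sum>b\<in>L. free_scl (Poly_Mapping.lookup u a * Poly_Mapping.lookup v b)
    (gen (mul A (fst a) (fst b)) (mul B (snd a) (snd b))))"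
  (is "_ = (\<Sum>a\<in>K. \<Sum>b\<in>L. ?f a b)")
proof -
  have "free_mul A B u v = (\<Sum>a\<in>Poly_Mapping.keys u. \<Sum>b\<in>Poly_Mapping.keys v. ?f a b)"
    by (simp add: free_mul_def split_beta)
  also have "\<dots> = (\<Sum>a\<in>Poly_Mapping.keys u. \<Sum>b\<in>L. ?f a b)"
    by (intro sum.cong refl sum.mono_neutral_left) (use assms in \<open>auto simp: in_keys_iff\<close>)
  also have "\<dots> = (\<Sum>a\<in>K. \<Sum>b\<in>L. ?f a b)"
    by (rule sum.mono_neutral_left) (use assms in \<open>auto simp: in_keys_iff\<close>)
  finally show ?thesis .
qed

lemma free_mul_add_left: "free_mul A B (u + u') v = free_mul A B u v + free_mul A B u' v"
proof -
  define K where "K = Poly_Mapping.keys u \<union> Poly_Mapping.keys u'"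
  have "finite K" "Poly_Mapping.keys u \<subseteq> K" "Poly_Mapping.keys u' \<subseteq> K" "Poly_Mapping.keys (u + u') \<subseteq> K"
    using keys_add[of u u'] by (auto simp: K_def)
  thus ?thesis
    by (simp add: free_mul_eq_sum[of K _ "Poly_Mapping.keys v"] lookup_add distrib_right
        free.scale_left_distrib sum.distrib)
qed

lemma free_mul_add_right: "free_mul A B u (v + v') = free_mul A B u v + free_mul A B u v'"
proof -
  define K where "K = Poly_Mapping.keys v \<union> Poly_Mapping.keys v'"
  have "finite K" "Poly_Mapping.keys v \<subseteq> K" "Poly_Mapping.keys v' \<subseteq> K" "Poly_Mapping.keys (v + v') \<subseteq> K"
    using keys_add[of v v'] by (auto simp: K_def)
  thus ?thesis
    by (simp add: free_mul_eq_sum[of "Poly_Mapping.keys u" _ K] lookup_add distrib_left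
        free.scale_left_distrib sum.distrib)
qed

lemma free_mul_scl_left: "free_mul A B (free_scl c u) v = free_scl c (free_mul A B u v)"
  by (simp add: free_mul_eq_sum[of "Poly_Mapping.keys u" _ "Poly_Mapping.keys v"] keys_free_scl
      free.scale_sum_right mult.assoc)

lemma free_mul_scl_right: "free_mul A B u (free_scl c v) = free_scl c (free_mul A B u v)"
  by (simp add: free_mul_eq_sum[of "Poly_Mapping.keys u" _ "Poly_Mapping.keys v"] keys_free_scl
      free.scale_sum_right mult.left_commute)

lemma free_mul_diff_left: "free_mul A B (u - u') v = free_mul A B u v - free_mul A B u' v"
  using free_mul_add_left[of A B "u - u'" u' v] by simp

lemma free_mul_diff_right: "free_mul A B u (v - v') = free_mul A B u v - free_mul A B u v'"
  using free_mul_add_right[of A B u "v - v'" v'] by simp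

lemma free_mul_0 [simp]: "free_mul A B 0 v = 0" "free_mul A B u 0 = 0"
  by (simp_all add: free_mul_def)

lemma free_mul_gen: "free_mul A B (gen x y) (gen x' y') = gen (mul A x x') (mul B y y')"
  by (simp add: free_mul_def)

section \<open>The quotient by the bilinearity relations\<close>

locale tensor_factors = A: carrier_algebra A + B: carrier_algebra B
  for A :: "('a, 'm) nalgebra_scheme" and B :: "('b, 'n) nalgebra_scheme"
begin

abbreviation carrF :: "(('a \<times> 'b) \<Rightarrow>\<^sub>0 complex) set" where
  "carrF \<equiv> {u. Poly_Mapping.keys u \<subseteq> carr A \<times> carr B}"

abbreviation relspan :: "(('a \<times> 'b) \<Rightarrow>\<^sub>0 complex) set" where
  "relspan \<equiv> free.span (bilinearity_relations A B)"

abbreviation cl :: "(('a \<times> 'b) \<Rightarrow>\<^sub>0 complex) \<Rightarrow> (('a \<times> 'b) \<Rightarrow>\<^sub>0 complex) set" where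
  "cl u \<equiv> tensor_rel A B `` {u}"

lemma tensor_rel_iff: "(u, v) \<in> tensor_rel A B \<longleftrightarrow> u \<in> carrF \<and> v \<in> carrF \<and> u - v \<in> relspan"
  by (simp add: tensor_rel_def)

lemma gen_carrF: "x \<in> carr A \<Longrightarrow> y \<in> carr B \<Longrightarrow> gen x y \<in> carrF"
  by simp

lemma add_carrF: "u \<in> carrF \<Longrightarrow> v \<in> carrF \<Longrightarrow> u + v \<in> carrF"
  using keys_add[of u v] by blast

lemma diff_carrF: "u \<in> carrF \<Longrightarrow> v \<in> carrF \<Longrightarrow> u - v \<in> carrF"
  using keys_diff_subset[of u v] by blast

lemma minus_carrF: "u \<in> carrF \<Longrightarrow> - u \<in> carrF"
  using diff_carrF[of 0 u] by simp

lemma scl_carrF: "u \<in> carrF \<Longrightarrow> free_scl c u \<in> carrF"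
  using keys_free_scl[of c u] by blast

lemma mul_carrF:
  assumes "u \<in> carrF" "v \<in> carrF"
  shows "free_mul A B u v \<in> carrF"
proof -
  have "Poly_Mapping.keys (free_scl c (gen (mul A (fst a) (fst b)) (mul B (snd a) (snd b)))) \<subseteq> carr A \<times> carr B"
    if "a \<in> Poly_Mapping.keys u" "b \<in> Poly_Mapping.keys v" for a b c
  proof -
    have "a \<in> carr A \<times> carr B" "b \<in> carr A \<times> carr B" using assms that by auto
    hence "gen (mul A (fst a) (fst b)) (mul B (snd a) (snd b)) \<in> carrF"
      by (intro gen_carrF) (auto intro: A.mul_closed B.mul_closed)
    from scl_carrF[OF this, of c] show ?thesis by simp
  qed
  thus ?thesis
    unfolding free_mul_eq_sum[OF finite_keys order_refl finite_keys order_refl]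
    by (intro CollectI keys_sum_subset)
qed

lemma carrF_span: "u \<in> carrF \<Longrightarrow> u \<in> free.span ((\<lambda>k. Poly_Mapping.single k 1) ` (carr A \<times> carr B))"
  by (subst poly_mapping_expansion) (blast intro: free.span_sum free.span_scale free.span_base)

lemma equiv_tensor_rel: "equiv carrF (tensor_rel A B)"
proof (rule equivI)
  show "tensor_rel A B \<subseteq> carrF \<times> carrF" by (auto simp: tensor_rel_def)
  show "refl_on carrF (tensor_rel A B)" by (auto simp: refl_on_def tensor_rel_def free.span_zero)
  show "sym (tensor_rel A B)"
  proof (rule symI)
    fix u v assume "(u, v) \<in> tensor_rel A B"
    thus "(v, u) \<in> tensor_rel A B"
      unfolding tensor_rel_iff using free.span_neg[of "u - v"] by simp
  qed
  show "trans (tensor_rel A B)"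
  proof (rule transI)
    fix u v w assume "(u, v) \<in> tensor_rel A B" "(v, w) \<in> tensor_rel A B"
    thus "(u, w) \<in> tensor_rel A B"
      unfolding tensor_rel_iff using free.span_add[of "u - v" _ "v - w"] by simp
  qed
qed

lemma relations:
  "x \<in> carr A \<Longrightarrow> x' \<in> carr A \<Longrightarrow> y \<in> carr B \<Longrightarrow> gen (add A x x') y - gen x y - gen x' y \<in> relspan"
  "x \<in> carr A \<Longrightarrow> y \<in> carr B \<Longrightarrow> y' \<in> carr B \<Longrightarrow> gen x (add B y y') - gen x y - gen x y' \<in> relspan"
  "x \<in> carr A \<Longrightarrow> y \<in> carr B \<Longrightarrow> gen (scl A c x) y - free_scl c (gen x y) \<in> relspan"
  "x \<in> carr A \<Longrightarrow> y \<in> carr B \<Longrightarrow> gen x (scl B c y) - free_scl c (gen x y) \<in> relspan"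
  by (rule free.span_base, subst bilinearity_relations_def, blast)+

text \<open>For the product, this says that the relations span an ideal; bilinearity reduces it to
  one relation times one generator. The abstract \<open>h\<close> serves left and right
  multiplication alike.\<close>

lemma relspan_bilinear:
  fixes h :: "(('a \<times> 'b) \<Rightarrow>\<^sub>0 complex) \<Rightarrow> (('a \<times> 'b) \<Rightarrow>\<^sub>0 complex) \<Rightarrow> (('a \<times> 'b) \<Rightarrow>\<^sub>0 complex)"
  assumes w: "w \<in> relspan" and v: "v \<in> carrF"
    and zero: "\<And>v. h 0 v = 0" "\<And>w. h w 0 = 0"
    and add: "\<And>w w' v. h (w + w') v = h w v + h w' v" "\<And>w v v'. h w (v + v') = h w v + h w v'"
    and scl: "\<And>c w v. h (free_scl c w) v = free_scl c (h w v)" "\<And>c w v. h w (free_scl c v) = free_scl c (h w v)"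
    and gen: "\<And>r x y. r \<in> bilinearity_relations A B \<Longrightarrow> x \<in> carr A \<Longrightarrow> y \<in> carr B \<Longrightarrow> h r (gen x y) \<in> relspan"
  shows "h w v \<in> relspan"
  using w
proof (rule free.span_induct)
  show "free.subspace {w. h w v \<in> relspan}"
    by (rule free.subspaceI) (auto simp: zero add scl free.span_zero intro: free.span_add free.span_scale)
  fix r assume r: "r \<in> bilinearity_relations A B"
  show "h r v \<in> relspan"
    using carrF_span[OF v]
  proof (rule free.span_induct)
    show "free.subspace {v. h r v \<in> relspan}"
      by (rule free.subspaceI) (auto simp: zero add scl free.span_zero intro: free.span_add free.span_scale)
    show "h r g \<in> relspan" if "g \<in> (\<lambda>k. Poly_Mapping.single k 1) ` (carr A \<times> carr B)" for g
      using that r by (auto intro: gen)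
  qed
qed

lemma relspan_mul_left:
  assumes "w \<in> relspan" "v \<in> carrF"
  shows "free_mul A B w v \<in> relspan"
proof (rule relspan_bilinear[OF assms])
  fix r x y assume "r \<in> bilinearity_relations A B" "x \<in> carr A" "y \<in> carr B"
  thus "free_mul A B r (gen x y) \<in> relspan"
    by (subst (asm) bilinearity_relations_def)
       (auto simp: free_mul_diff_left free_mul_scl_left free_mul_gen A.add_mul B.add_mul A.scl_mul B.scl_mul,
        (intro relations A.mul_closed B.mul_closed; assumption)+)
qed (simp_all add: free_mul_add_left free_mul_add_right free_mul_scl_left free_mul_scl_right)

lemma relspan_mul_right:
  assumes "w \<in> relspan" "v \<in> carrF"
  shows "free_mul A B v w \<in> relspan"
proof (rule relspan_bilinear[OF assms, where h = "\<lambda>w v. free_mul A B v w"])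
  fix r x y assume "r \<in> bilinearity_relations A B" "x \<in> carr A" "y \<in> carr B"
  thus "free_mul A B (gen x y) r \<in> relspan"
    by (subst (asm) bilinearity_relations_def)
       (auto simp: free_mul_diff_right free_mul_scl_right free_mul_gen A.mul_add B.mul_add A.mul_scl B.mul_scl,
        (intro relations A.mul_closed B.mul_closed; assumption)+)
qed (simp_all add: free_mul_add_left free_mul_add_right free_mul_scl_left free_mul_scl_right)

lemma cl_eq: "u \<in> carrF \<Longrightarrow> v \<in> carrF \<Longrightarrow> u - v \<in> relspan \<Longrightarrow> cl u = cl v"
  by (rule equiv_class_eq[OF equiv_tensor_rel]) (simp add: tensor_rel_iff)

abbreviation T where "T \<equiv> alg_tensor A B"

lemma tensor_carrI: "u \<in> carrF \<Longrightarrow> cl u \<in> carr T"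
  unfolding alg_tensor_def by (simp add: quotientI)

lemma tensor_carrE:
  assumes "X \<in> carr T"
  obtains u where "u \<in> carrF" "X = cl u"
  using assms unfolding alg_tensor_def by (auto elim!: quotientE)

lemma tensor_add:
  assumes "u \<in> carrF" "v \<in> carrF"
  shows "add T (cl u) (cl v) = cl (u + v)"
proof -
  have "congruent2 (tensor_rel A B) (tensor_rel A B) (\<lambda>u v. cl (u + v))"
  proof (rule congruent2I')
    fix u u' v v' assume "(u, u') \<in> tensor_rel A B" "(v, v') \<in> tensor_rel A B"
    hence *: "u \<in> carrF" "u' \<in> carrF" "v \<in> carrF" "v' \<in> carrF" "u - u' \<in> relspan" "v - v' \<in> relspan"
      unfolding tensor_rel_iff by blast+
    have "(u + v) - (u' + v') = (u - u') + (v - v')" by simp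
    also have "\<dots> \<in> relspan" by (rule free.span_add[OF *(5,6)])
    finally show "cl (u + v) = cl (u' + v')" by (rule cl_eq[OF add_carrF[OF *(1,3)] add_carrF[OF *(2,4)]])
  qed
  from UN_equiv_class2[OF equiv_tensor_rel equiv_tensor_rel this assms]
  show ?thesis by (simp add: alg_tensor_def)
qed

lemma tensor_scl:
  assumes "u \<in> carrF"
  shows "scl T c (cl u) = cl (free_scl c u)"
proof -
  have "congruent (tensor_rel A B) (\<lambda>u. cl (free_scl c u))"
  proof (rule congruentI)
    fix u u' assume "(u, u') \<in> tensor_rel A B"
    hence *: "u \<in> carrF" "u' \<in> carrF" "u - u' \<in> relspan" unfolding tensor_rel_iff by blast+
    have "free_scl c u - free_scl c u' = free_scl c (u - u')" by (simp add: free.scale_right_diff_distrib)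
    also have "\<dots> \<in> relspan" by (rule free.span_scale[OF *(3)])
    finally show "cl (free_scl c u) = cl (free_scl c u')" by (rule cl_eq[OF scl_carrF[OF *(1)] scl_carrF[OF *(2)]])
  qed
  from UN_equiv_class[OF equiv_tensor_rel this assms]
  show ?thesis by (simp add: alg_tensor_def)
qed

lemma tensor_mul:
  assumes "u \<in> carrF" "v \<in> carrF"
  shows "mul T (cl u) (cl v) = cl (free_mul A B u v)"
proof -
  have "congruent2 (tensor_rel A B) (tensor_rel A B) (\<lambda>u v. cl (free_mul A B u v))"
  proof (rule congruent2I')
    fix u u' v v' assume "(u, u') \<in> tensor_rel A B" "(v, v') \<in> tensor_rel A B"
    hence *: "u \<in> carrF" "u' \<in> carrF" "v \<in> carrF" "v' \<in> carrF" "u - u' \<in> relspan" "v - v' \<in> relspan"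
      unfolding tensor_rel_iff by blast+
    have "free_mul A B u v - free_mul A B u' v' = free_mul A B (u - u') v + free_mul A B u' (v - v')"
      by (simp add: free_mul_diff_left free_mul_diff_right)
    also have "\<dots> \<in> relspan"
      by (rule free.span_add[OF relspan_mul_left[OF *(5,3)] relspan_mul_right[OF *(6,2)]])
    finally show "cl (free_mul A B u v) = cl (free_mul A B u' v')"
      by (rule cl_eq[OF mul_carrF[OF *(1,3)] mul_carrF[OF *(2,4)]])
  qed
  from UN_equiv_class2[OF equiv_tensor_rel equiv_tensor_rel this assms]
  show ?thesis by (simp add: alg_tensor_def)
qed

lemma tensor_dif:
  assumes "u \<in> carrF" "v \<in> carrF"
  shows "dif T (cl u) (cl v) = cl (u - v)"
  unfolding tensor_scl[OF assms(2)] tensor_add[OF assms(1) scl_carrF[OF assms(2)]]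
  by (simp add: free.scale_minus_left)

section \<open>The projective norm through finite representations\<close>

definition rep_sum :: "('a \<times> 'b) list \<Rightarrow> ('a \<times> 'b) \<Rightarrow>\<^sub>0 complex" where
  "rep_sum ws = (\<Sum>(x, y)\<leftarrow>ws. gen x y)"

definition rep_cost :: "('a \<times> 'b) list \<Rightarrow> real" where
  "rep_cost ws = (\<Sum>(x, y)\<leftarrow>ws. nrm A x * nrm B y)"

abbreviation reps :: "('a \<times> 'b) list set" where
  "reps \<equiv> {ws. set ws \<subseteq> carr A \<times> carr B}"

lemma rep_sum_simps [simp]:
  "rep_sum [] = 0" "rep_sum ((x, y) # ws) = gen x y + rep_sum ws" "rep_sum (ws @ ws') = rep_sum ws + rep_sum ws'"
  by (simp_all add: rep_sum_def)

lemma rep_cost_simps [simp]: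
  "rep_cost [] = 0" "rep_cost ((x, y) # ws) = nrm A x * nrm B y + rep_cost ws"
  "rep_cost (ws @ ws') = rep_cost ws + rep_cost ws'"
  by (simp_all add: rep_cost_def)

lemma rep_sum_carrF: "ws \<in> reps \<Longrightarrow> rep_sum ws \<in> carrF"
proof (induction ws)
  case (Cons w ws)
  obtain x y where w: "w = (x, y)" "x \<in> carr A" "y \<in> carr B" using Cons.prems by auto
  have "rep_sum ws \<in> carrF" using Cons by simp
  from add_carrF[OF gen_carrF[OF w(2,3)] this] show ?case by (simp add: w(1))
qed simp

lemma rep_cost_nonneg: "ws \<in> reps \<Longrightarrow> 0 \<le> rep_cost ws"
  by (induction ws) (auto intro!: add_nonneg_nonneg mult_nonneg_nonneg A.nrm_nonneg B.nrm_nonneg)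

text \<open>Representations carry no coefficients, so a scalar is absorbed into the first factor;
  the sums therefore agree only modulo the relations.\<close>

lemma rep_scl:
  fixes c :: complex
  assumes "ws \<in> reps"
  defines "ws' \<equiv> map (\<lambda>(x, y). (scl A c x, y)) ws"
  shows "ws' \<in> reps \<and> free_scl c (rep_sum ws) - rep_sum ws' \<in> relspan \<and> rep_cost ws' \<le> cmod c * rep_cost ws"
  using assms(1) unfolding ws'_def
proof (induction ws)
  case (Cons w ws)
  obtain x y where w: "w = (x, y)" "x \<in> carr A" "y \<in> carr B" using Cons.prems by auto
  define ws' where "ws' = map (\<lambda>(x, y). (scl A c x, y)) ws"
  have IH: "ws' \<in> reps" "free_scl c (rep_sum ws) - rep_sum ws' \<in> relspan" "rep_cost ws' \<le> cmod c * rep_cost ws"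
    using Cons unfolding ws'_def by auto
  have "- (gen (scl A c x) y - free_scl c (gen x y)) + (free_scl c (rep_sum ws) - rep_sum ws') \<in> relspan"
    by (intro free.span_add free.span_neg relations w IH)
  moreover have "nrm A (scl A c x) * nrm B y \<le> cmod c * nrm A x * nrm B y"
    by (intro mult_right_mono A.nrm_scl_le B.nrm_nonneg w)
  ultimately show ?case using IH w
    by (simp add: ws'_def[symmetric] A.scl_closed free.scale_right_distrib algebra_simps)
qed (simp add: free.span_zero)

text \<open>Ensures that the infimum defining the tensor norm is over a nonempty set.\<close>

lemma rep_exists:
  assumes "u \<in> carrF"
  shows "\<exists>ws\<in>reps. u - rep_sum ws \<in> relspan"
  using carrF_span[OF assms]
proof (rule free.span_induct)
  show "free.subspace {u. \<exists>ws\<in>reps. u - rep_sum ws \<in> relspan}"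
  proof (rule free.subspaceI)
    show "0 \<in> {u. \<exists>ws\<in>reps. u - rep_sum ws \<in> relspan}"
      by (auto intro!: exI[of _ "[]"] free.span_zero)
  next
    fix u v assume "u \<in> {u. \<exists>ws\<in>reps. u - rep_sum ws \<in> relspan}" "v \<in> {u. \<exists>ws\<in>reps. u - rep_sum ws \<in> relspan}"
    then obtain ws ws' where "ws \<in> reps" "ws' \<in> reps" "u - rep_sum ws \<in> relspan" "v - rep_sum ws' \<in> relspan"
      by blast
    hence "ws @ ws' \<in> reps" "(u + v) - rep_sum (ws @ ws') \<in> relspan"
      using free.span_add[of "u - rep_sum ws" _ "v - rep_sum ws'"] by (auto simp: algebra_simps)
    thus "u + v \<in> {u. \<exists>ws\<in>reps. u - rep_sum ws \<in> relspan}" by blast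
  next
    fix c u assume "u \<in> {u. \<exists>ws\<in>reps. u - rep_sum ws \<in> relspan}"
    then obtain ws where ws: "ws \<in> reps" "u - rep_sum ws \<in> relspan" by blast
    define ws' where "ws' = map (\<lambda>(x, y). (scl A c x, y)) ws"
    have "ws' \<in> reps" "free_scl c (rep_sum ws) - rep_sum ws' \<in> relspan"
      using rep_scl[OF ws(1), of c] unfolding ws'_def by blast+
    moreover have "free_scl c (u - rep_sum ws) + (free_scl c (rep_sum ws) - rep_sum ws') = free_scl c u - rep_sum ws'"
      by (simp add: free.scale_right_diff_distrib)
    ultimately have "free_scl c u - rep_sum ws' \<in> relspan"
      using free.span_add[OF free.span_scale[OF ws(2), of c]] by metis
    thus "free_scl c u \<in> {u. \<exists>ws\<in>reps. u - rep_sum ws \<in> relspan}" using \<open>ws' \<in> reps\<close> by blast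
  qed
  fix g assume "g \<in> (\<lambda>k. Poly_Mapping.single k (1::complex)) ` (carr A \<times> carr B)"
  then obtain x y where g: "g = gen x y" "x \<in> carr A" "y \<in> carr B" by auto
  hence "[(x, y)] \<in> reps" "g - rep_sum [(x, y)] \<in> relspan" by (auto simp: free.span_zero)
  thus "\<exists>ws\<in>reps. g - rep_sum ws \<in> relspan" by blast
qed

text \<open>Multiply all pairs of terms. The products agree already in the free space, and costs
  multiply because both factor norms are submultiplicative.\<close>

lemma rep_mul:
  assumes "ws \<in> reps" "ws' \<in> reps"
  shows "\<exists>vs\<in>reps. rep_sum vs = free_mul A B (rep_sum ws) (rep_sum ws') \<and> rep_cost vs \<le> rep_cost ws * rep_cost ws'"
proof -
  have 1: "\<exists>vs\<in>reps. rep_sum vs = free_mul A B (gen x y) (rep_sum ws') \<and>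
      rep_cost vs \<le> nrm A x * nrm B y * rep_cost ws'" if xy: "x \<in> carr A" "y \<in> carr B" for x y
    using assms(2)
  proof (induction ws')
    case Nil
    show ?case by (rule bexI[of _ "[]"]) auto
  next
    case (Cons w ws')
    obtain x' y' where w: "w = (x', y')" "x' \<in> carr A" "y' \<in> carr B" using Cons.prems by auto
    obtain vs where vs: "vs \<in> reps" "rep_sum vs = free_mul A B (gen x y) (rep_sum ws')"
      "rep_cost vs \<le> nrm A x * nrm B y * rep_cost ws'" using Cons by auto
    have "nrm A (mul A x x') * nrm B (mul B y y') \<le> (nrm A x * nrm A x') * (nrm B y * nrm B y')"
      by (intro mult_mono A.nrm_mul_le B.nrm_mul_le mult_nonneg_nonneg A.nrm_nonneg B.nrm_nonneg
          B.mul_closed xy w)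
    hence "rep_cost ((mul A x x', mul B y y') # vs) \<le> nrm A x * nrm B y * rep_cost (w # ws')"
      using vs(3) by (simp add: w(1) algebra_simps)
    moreover have "rep_sum ((mul A x x', mul B y y') # vs) = free_mul A B (gen x y) (rep_sum (w # ws'))"
      by (simp add: w(1) vs(2) free_mul_add_right free_mul_gen)
    moreover have "(mul A x x', mul B y y') # vs \<in> reps"
      using vs(1) xy w by (auto intro: A.mul_closed B.mul_closed)
    ultimately show ?case by blast
  qed
  show ?thesis using assms(1)
  proof (induction ws)
    case Nil
    show ?case by (rule bexI[of _ "[]"]) auto
  next
    case (Cons w ws)
    obtain x y where w: "w = (x, y)" "x \<in> carr A" "y \<in> carr B" using Cons.prems by auto
    obtain vs where vs: "vs \<in> reps" "rep_sum vs = free_mul A B (rep_sum ws) (rep_sum ws')"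
      "rep_cost vs \<le> rep_cost ws * rep_cost ws'" using Cons by auto
    obtain us where us: "us \<in> reps" "rep_sum us = free_mul A B (gen x y) (rep_sum ws')"
      "rep_cost us \<le> nrm A x * nrm B y * rep_cost ws'" using 1[OF w(2,3)] by blast
    show ?case
      by (rule bexI[of _ "us @ vs"]) (use us vs in \<open>auto simp: w(1) free_mul_add_left distrib_right\<close>)
  qed
qed

lemma tensor_nrm_eq: "nrm T X = Inf (rep_cost ` {ws \<in> reps. X = cl (rep_sum ws)})"
  unfolding alg_tensor_def rep_cost_def rep_sum_def by (simp add: image_Collect) 

lemma tensor_nrm_le: "ws \<in> reps \<Longrightarrow> nrm T (cl (rep_sum ws)) \<le> rep_cost ws"
  unfolding tensor_nrm_eq
  by (rule cInf_lower) (auto intro!: bdd_belowI2[of _ 0] rep_cost_nonneg)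

lemma tensor_rep:
  assumes "X \<in> carr T"
  obtains ws where "ws \<in> reps" "X = cl (rep_sum ws)"
proof -
  obtain u where u: "u \<in> carrF" "X = cl u" using assms by (rule tensor_carrE)
  obtain ws where "ws \<in> reps" "u - rep_sum ws \<in> relspan" using rep_exists[OF u(1)] by blast
  thus thesis using that cl_eq[OF u(1) rep_sum_carrF] u(2) by blast
qed

lemma tensor_reps_nonempty:
  assumes "X \<in> carr T"
  shows "rep_cost ` {ws \<in> reps. X = cl (rep_sum ws)} \<noteq> {}"
proof -
  obtain ws where "ws \<in> reps" "X = cl (rep_sum ws)" using assms by (rule tensor_rep)
  hence "rep_cost ws \<in> rep_cost ` {ws \<in> reps. X = cl (rep_sum ws)}" by (intro imageI) simp
  thus ?thesis by (rule ex_in_conv[THEN iffD1, OF exI])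
qed

lemma tensor_nrm_approx:
  assumes "X \<in> carr T" "0 < e"
  obtains ws where "ws \<in> reps" "X = cl (rep_sum ws)" "rep_cost ws < nrm T X + e"
proof -
  have "Inf (rep_cost ` {ws \<in> reps. X = cl (rep_sum ws)}) < nrm T X + e"
    unfolding tensor_nrm_eq[symmetric] using assms(2) by simp
  from cInf_lessD[OF tensor_reps_nonempty[OF assms(1)] this] obtain r
    where r: "r \<in> rep_cost ` {ws \<in> reps. X = cl (rep_sum ws)}" "r < nrm T X + e" ..
  from r(1) obtain ws where rw: "r = rep_cost ws" and ws: "ws \<in> {ws \<in> reps. X = cl (rep_sum ws)}" by (rule imageE)
  have lt: "rep_cost ws < nrm T X + e" using r(2) unfolding rw .
  from ws have "ws \<in> reps" "X = cl (rep_sum ws)" by simp_all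
  from that[OF this lt] show thesis .
qed

lemma tensor_nrm_nonneg:
  assumes "X \<in> carr T"
  shows "0 \<le> nrm T X"
proof -
  have "0 \<le> r" if "r \<in> rep_cost ` {ws \<in> reps. X = cl (rep_sum ws)}" for r
  proof -
    obtain ws where "r = rep_cost ws" "ws \<in> {ws \<in> reps. X = cl (rep_sum ws)}" using \<open>r \<in> _\<close> by (rule imageE)
    thus ?thesis using rep_cost_nonneg[of ws] by simp
  qed
  thus ?thesis unfolding tensor_nrm_eq by (rule cInf_greatest[OF tensor_reps_nonempty[OF assms]])
qed

lemma tensor_nrm_add_le:
  assumes "X \<in> carr T" "Y \<in> carr T"
  shows "nrm T (add T X Y) \<le> nrm T X + nrm T Y"
proof (rule field_le_epsilon)
  fix e :: real assume "0 < e"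
  hence e: "0 < e / 2" by simp
  obtain ws where ws: "ws \<in> reps" "X = cl (rep_sum ws)" "rep_cost ws < nrm T X + e / 2"
    using tensor_nrm_approx[OF assms(1) e] .
  obtain ws' where ws': "ws' \<in> reps" "Y = cl (rep_sum ws')" "rep_cost ws' < nrm T Y + e / 2"
    using tensor_nrm_approx[OF assms(2) e] .
  have "nrm T (add T X Y) \<le> rep_cost (ws @ ws')"
    using tensor_nrm_le[of "ws @ ws'"] ws(1) ws'(1)
    unfolding ws(2) ws'(2) tensor_add[OF rep_sum_carrF[OF ws(1)] rep_sum_carrF[OF ws'(1)]] by simp
  thus "nrm T (add T X Y) \<le> nrm T X + nrm T Y + e" using ws(3) ws'(3) by simp
qed

lemma tensor_nrm_scl_le:
  assumes "X \<in> carr T"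
  shows "nrm T (scl T c X) \<le> cmod c * nrm T X"
proof (rule field_le_epsilon)
  fix e :: real assume "0 < e"
  \<comment> \<open>The added 1 allows \<open>c = 0\<close>.\<close>
  hence e: "0 < e / (cmod c + 1)" by (simp add: add_nonneg_pos)
  obtain ws where ws: "ws \<in> reps" "X = cl (rep_sum ws)" "rep_cost ws < nrm T X + e / (cmod c + 1)"
    using tensor_nrm_approx[OF assms(1) e] .
  define ws' where "ws' = map (\<lambda>(x, y). (scl A c x, y)) ws"
  have ws': "ws' \<in> reps" "free_scl c (rep_sum ws) - rep_sum ws' \<in> relspan" "rep_cost ws' \<le> cmod c * rep_cost ws"
    using rep_scl[OF ws(1), of c] unfolding ws'_def by blast+
  have "scl T c X = cl (rep_sum ws')"
    unfolding ws(2) tensor_scl[OF rep_sum_carrF[OF ws(1)]]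
    by (rule cl_eq[OF scl_carrF[OF rep_sum_carrF[OF ws(1)]] rep_sum_carrF[OF ws'(1)] ws'(2)])
  hence "nrm T (scl T c X) \<le> cmod c * rep_cost ws" using tensor_nrm_le[OF ws'(1)] ws'(3) by simp
  also have "\<dots> \<le> cmod c * (nrm T X + e / (cmod c + 1))" using ws(3) by (intro mult_left_mono) auto
  also have "\<dots> = cmod c * nrm T X + cmod c * (e / (cmod c + 1))" by (rule distrib_left)
  also have "cmod c * (e / (cmod c + 1)) \<le> (cmod c + 1) * (e / (cmod c + 1))"
    using e by (intro mult_right_mono) auto
  also have "\<dots> = e" using norm_ge_zero[of c] by (simp add: add_nonneg_eq_0_iff)
  finally show "nrm T (scl T c X) \<le> cmod c * nrm T X + e" by simp
qed

text \<open>Near-optimal representations give \<open>(nrm T X + e) * (nrm T Y + e)\<close> for each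
  positive \<open>e\<close>; the claim is the limit as \<open>e\<close> decreases to 0.\<close>

lemma tensor_nrm_mul_le:
  assumes "X \<in> carr T" "Y \<in> carr T"
  shows "nrm T (mul T X Y) \<le> nrm T X * nrm T Y"
proof (rule tendsto_lowerbound)
  show "((\<lambda>e. (nrm T X + e) * (nrm T Y + e)) \<longlongrightarrow> nrm T X * nrm T Y) (at_right 0)"
    by (auto intro!: tendsto_eq_intros)
  have "nrm T (mul T X Y) \<le> (nrm T X + e) * (nrm T Y + e)" if e: "0 < e" for e
  proof -
    obtain ws where ws: "ws \<in> reps" "X = cl (rep_sum ws)" "rep_cost ws < nrm T X + e"
      using tensor_nrm_approx[OF assms(1) e] .
    obtain ws' where ws': "ws' \<in> reps" "Y = cl (rep_sum ws')" "rep_cost ws' < nrm T Y + e"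
      using tensor_nrm_approx[OF assms(2) e] .
    obtain vs where vs: "vs \<in> reps" "rep_sum vs = free_mul A B (rep_sum ws) (rep_sum ws')"
      "rep_cost vs \<le> rep_cost ws * rep_cost ws'" using rep_mul[OF ws(1) ws'(1)] by blast
    have "nrm T (mul T X Y) \<le> rep_cost vs"
      using tensor_nrm_le[OF vs(1)]
      unfolding ws(2) ws'(2) tensor_mul[OF rep_sum_carrF[OF ws(1)] rep_sum_carrF[OF ws'(1)]] vs(2) .
    also have "\<dots> \<le> (nrm T X + e) * (nrm T Y + e)"
      using vs(3) ws(3) ws'(3) rep_cost_nonneg[OF ws(1)] rep_cost_nonneg[OF ws'(1)]
      by (meson mult_mono less_imp_le order_trans)
    finally show ?thesis .
  qed
  thus "\<forall>\<^sub>F e in at_right 0. nrm T (mul T X Y) \<le> (nrm T X + e) * (nrm T Y + e)"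
    by (auto intro: eventually_at_rightI[of 0 1])
qed simp

lemma tensor_seminormed_algebra: "seminormed_algebra T"
proof unfold_locales
  note ops = tensor_add tensor_scl tensor_mul add_carrF diff_carrF minus_carrF scl_carrF mul_carrF
    free.scale_minus_left
    free.scale_right_diff_distrib free_mul_add_left free_mul_add_right free_mul_diff_left free_mul_diff_right
    free_mul_scl_left free_mul_scl_right algebra_simps
  fix X c assume X: "X \<in> carr T"
  then obtain u where u: "u \<in> carrF" and Xu: "X = cl u" by (rule tensor_carrE)
  show "scl T c X \<in> carr T" unfolding Xu tensor_scl[OF u] by (intro tensor_carrI scl_carrF u)
  show "0 \<le> nrm T X" by (rule tensor_nrm_nonneg[OF X])
  show "nrm T (scl T c X) \<le> cmod c * nrm T X" by (rule tensor_nrm_scl_le[OF X])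
  \<comment> \<open>The empty list represents zero at cost 0.\<close>
  have "nrm T (dif T X X) \<le> 0"
    unfolding Xu tensor_dif[OF u u] using tensor_nrm_le[of "[]"] by simp
  moreover have "0 \<le> nrm T (dif T X X)"
    unfolding Xu tensor_dif[OF u u] by (intro tensor_nrm_nonneg tensor_carrI diff_carrF u)
  ultimately show "nrm T (dif T X X) = 0" by simp
  fix Y assume Y: "Y \<in> carr T"
  then obtain v where v: "v \<in> carrF" and Yv: "Y = cl v" by (rule tensor_carrE)
  show "mul T X Y \<in> carr T" unfolding Xu Yv tensor_mul[OF u v] by (intro tensor_carrI mul_carrF u v)
  show "add T X Y \<in> carr T" unfolding Xu Yv tensor_add[OF u v] by (intro tensor_carrI add_carrF u v)
  show "nrm T (mul T X Y) \<le> nrm T X * nrm T Y" by (rule tensor_nrm_mul_le[OF X Y])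
  show "nrm T (add T X Y) \<le> nrm T X + nrm T Y" by (rule tensor_nrm_add_le[OF X Y])
  show "mul T (scl T c X) Y = scl T c (mul T X Y)" "mul T X (scl T c Y) = scl T c (mul T X Y)"
    "dif T Y X = scl T (- 1) (dif T X Y)" "add T (dif T X Y) Y = X"
    "dif T (scl T c X) (scl T c Y) = scl T c (dif T X Y)"
    \<comment> \<open>Keeping \<open>mem_Collect_eq\<close> out leaves membership in
      \<open>carrF\<close> folded, in the shape in which the conditional rules of \<open>ops\<close>
      expect it.\<close>
    using u v by (simp_all add: Xu Yv ops free.scale_right_distrib del: mem_Collect_eq)
  fix Z assume Z: "Z \<in> carr T"
  then obtain w where w: "w \<in> carrF" and Zw: "Z = cl w" by (rule tensor_carrE)
  show "mul T (add T X Y) Z = add T (mul T X Z) (mul T Y Z)"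
    "mul T X (add T Y Z) = add T (mul T X Y) (mul T X Z)"
    "dif T X Z = add T (dif T X Y) (dif T Y Z)"
    using u v w by (simp_all add: Xu Yv Zw ops del: mem_Collect_eq)
  fix Y' assume "Y' \<in> carr T"
  then obtain v' where v': "v' \<in> carrF" and Y': "Y' = cl v'" by (rule tensor_carrE)
  show "dif T (add T X Z) (add T Y Y') = add T (dif T X Y) (dif T Z Y')"
    "dif T (mul T X Z) (mul T Y Y') = add T (mul T (dif T X Y) Z) (mul T Y (dif T Z Y'))"
    using u v w v' by (simp_all add: Xu Yv Zw Y' ops del: mem_Collect_eq)
qed

end

locale tensor_form = tensor_factors A B
  for A :: "('a, 'm) nalgebra_scheme" and B :: "('b, 'n) nalgebra_scheme" +
  fixes \<phi> :: "'a \<Rightarrow> 'b \<Rightarrow> complex"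
  assumes add_left: "x \<in> carr A \<Longrightarrow> x' \<in> carr A \<Longrightarrow> y \<in> carr B \<Longrightarrow> \<phi> (add A x x') y = \<phi> x y + \<phi> x' y"
    and add_right: "x \<in> carr A \<Longrightarrow> y \<in> carr B \<Longrightarrow> y' \<in> carr B \<Longrightarrow> \<phi> x (add B y y') = \<phi> x y + \<phi> x y'"
    and scl_left: "x \<in> carr A \<Longrightarrow> y \<in> carr B \<Longrightarrow> \<phi> (scl A c x) y = c * \<phi> x y"
    and scl_right: "x \<in> carr A \<Longrightarrow> y \<in> carr B \<Longrightarrow> \<phi> x (scl B c y) = c * \<phi> x y"
    and bound: "x \<in> carr A \<Longrightarrow> y \<in> carr B \<Longrightarrow> cmod (\<phi> x y) \<le> nrm A x * nrm B y"
begin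

abbreviation free_form :: "(('a \<times> 'b) \<Rightarrow>\<^sub>0 complex) \<Rightarrow> complex" where
  "free_form \<equiv> lift (\<lambda>k. \<phi> (fst k) (snd k))"

text \<open>The linear functional induced on the tensor product by its universal property. The
  choice of representative is immaterial because \<open>free_form\<close> vanishes on the
  relations.\<close>

definition tensor_functional :: "(('a \<times> 'b) \<Rightarrow>\<^sub>0 complex) set \<Rightarrow> complex" where
  "tensor_functional X = free_form (SOME u. u \<in> X)"

lemma free_form_relspan:
  assumes "w \<in> relspan"
  shows "free_form w = 0"
  using assms
proof (rule free.span_induct)
  show "free.subspace {w. free_form w = 0}"
    by (rule free.subspaceI) (auto simp: lift_add lift_scl, simp add: lift_def)
  show "free_form r = 0" if "r \<in> bilinearity_relations A B" for r
    using that unfolding bilinearity_relations_def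
    by (auto simp: lift_diff lift_scl add_left add_right scl_left scl_right)
qed

lemma tensor_functional_cl:
  assumes u: "u \<in> carrF"
  shows "tensor_functional (cl u) = free_form u"
proof -
  define u' where "u' = (SOME u'. u' \<in> cl u)"
  have "u \<in> cl u" by (rule equiv_class_self[OF equiv_tensor_rel u])
  hence "u' \<in> cl u" unfolding u'_def by (rule someI)
  hence "u - u' \<in> relspan" by (simp add: tensor_rel_iff)
  from free_form_relspan[OF this] show ?thesis
    unfolding tensor_functional_def u'_def[symmetric] by (simp add: lift_diff)
qed

lemma tensor_functional_add:
  assumes "X \<in> carr T" "Y \<in> carr T"
  shows "tensor_functional (add T X Y) = tensor_functional X + tensor_functional Y"
proof -
  obtain u v where u: "u \<in> carrF" and X: "X = cl u" and v: "v \<in> carrF" and Y: "Y = cl v"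
    using assms by (elim tensor_carrE)
  show ?thesis
    unfolding X Y tensor_add[OF u v] tensor_functional_cl[OF u] tensor_functional_cl[OF v]
      tensor_functional_cl[OF add_carrF[OF u v]] lift_add ..
qed

lemma tensor_functional_scl:
  assumes "X \<in> carr T"
  shows "tensor_functional (scl T c X) = c * tensor_functional X"
proof -
  obtain u where u: "u \<in> carrF" and X: "X = cl u" using assms by (rule tensor_carrE)
  show ?thesis
    unfolding X tensor_scl[OF u] tensor_functional_cl[OF u] tensor_functional_cl[OF scl_carrF[OF u]] lift_scl ..
qed

lemma free_form_rep_sum_bound: "ws \<in> reps \<Longrightarrow> cmod (free_form (rep_sum ws)) \<le> rep_cost ws"
proof (induction ws)
  case (Cons w ws)
  obtain x y where w: "w = (x, y)" "x \<in> carr A" "y \<in> carr B" using Cons.prems by auto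
  have "cmod (free_form (rep_sum ws)) \<le> rep_cost ws" using Cons by auto
  from norm_triangle_le[OF add_mono[OF bound[OF w(2,3)] this]] show ?case by (simp add: w(1) lift_add)
qed (simp add: lift_def)

lemma tensor_functional_bound:
  assumes X: "X \<in> carr T"
  shows "cmod (tensor_functional X) \<le> nrm T X"
proof (rule field_le_epsilon)
  fix e :: real assume "0 < e"
  from tensor_nrm_approx[OF X this] obtain ws
    where ws: "ws \<in> reps" "X = cl (rep_sum ws)" "rep_cost ws < nrm T X + e" .
  have "cmod (tensor_functional X) \<le> rep_cost ws"
    unfolding ws(2) tensor_functional_cl[OF rep_sum_carrF[OF ws(1)]] by (rule free_form_rep_sum_bound[OF ws(1)])
  thus "cmod (tensor_functional X) \<le> nrm T X + e" using ws(3) by simp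
qed

text \<open>Elementary tensors of elements of norm at most 1 have norm at most 1 and multiply
  factorwise, so the iterated limits are decided by the values of \<open>\<phi>\<close> on products
  in the factors.\<close>

theorem proj_tensor_not_arens_regular:
  fixes a b :: "nat \<Rightarrow> 'a" and a' b' :: "nat \<Rightarrow> 'b"
  assumes a: "\<And>n. a n \<in> carr A" "\<And>n. nrm A (a n) \<le> 1" and b: "\<And>n. b n \<in> carr A" "\<And>n. nrm A (b n) \<le> 1"
    and a': "\<And>n. a' n \<in> carr B" "\<And>n. nrm B (a' n) \<le> 1" and b': "\<And>n. b' n \<in> carr B" "\<And>n. nrm B (b' n) \<le> 1"
    and ab: "\<And>n m. \<phi> (mul A (a n) (b m)) (mul B (a' n) (b' m)) = (if n \<le> m then 1 else 0)"
  shows "\<not> arens_regular (A \<otimes>\<^sub>\<gamma> B)"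
proof -
  interpret T: seminormed_algebra T by (rule tensor_seminormed_algebra)
  have g: "gen (a n) (a' n) \<in> carrF" "gen (b n) (b' n) \<in> carrF" for n
    by (intro gen_carrF a a' b b')+
  have le: "nrm T (cl (gen x y)) \<le> 1" if "x \<in> carr A" "y \<in> carr B" "nrm A x \<le> 1" "nrm B y \<le> 1" for x y
  proof -
    have "nrm T (cl (gen x y)) \<le> nrm A x * nrm B y"
      using tensor_nrm_le[of "[(x, y)]"] that by simp
    also have "\<dots> \<le> 1" using that A.nrm_nonneg B.nrm_nonneg by (intro mult_le_one) auto
    finally show ?thesis .
  qed
  show ?thesis
    unfolding proj_tensor_def
  proof (rule T.completion_not_arens_regular[where \<psi> = tensor_functional
        and a = "\<lambda>n. cl (gen (a n) (a' n))" and b = "\<lambda>n. cl (gen (b n) (b' n))"])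
    show "cl (gen (a n) (a' n)) \<in> carr T" "cl (gen (b n) (b' n)) \<in> carr T" for n
      by (intro tensor_carrI g)+
    show "nrm T (cl (gen (a n) (a' n))) \<le> 1" "nrm T (cl (gen (b n) (b' n))) \<le> 1" for n
      by (intro le a a' b b')+
    show "tensor_functional (mul T (cl (gen (a n) (a' n))) (cl (gen (b m) (b' m)))) = (if n \<le> m then 1 else 0)" for n m
      unfolding tensor_mul[OF g] tensor_functional_cl[OF mul_carrF[OF g]]
      unfolding free_mul_gen by (simp add: ab)
  qed (fact tensor_functional_add tensor_functional_scl tensor_functional_bound)+
qed

end

section \<open>The triangular form\<close>

lemma schatten_carrier_algebra:
  assumes p: "1 \<le> p" "p \<le> 2"
  shows "carrier_algebra (schatten p :: ('h::chilbert_space \<Rightarrow>\<^sub>L 'h) nalgebra)" (is "carrier_algebra ?S")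
proof unfold_locales
  fix X Y :: "'h \<Rightarrow>\<^sub>L 'h" and c
  assume X: "X \<in> carr ?S" and Y: "Y \<in> carr ?S"
  show "mul ?S X Y \<in> carr ?S"
    "nrm ?S (mul ?S X Y) \<le> nrm ?S X * nrm ?S Y"
    by (rule schatten_mul[OF X Y p])+
  show "mul ?S (scl ?S c X) Y = scl ?S c (mul ?S X Y)"
    unfolding schatten_simps by (rule blinfun_eqI) (simp add: op_scaleC_apply)
  have "X \<in> bounded_ops" using X by (simp add: schatten_simps)
  thus "mul ?S X (scl ?S c Y) = scl ?S c (mul ?S X Y)"
    unfolding schatten_simps by (intro blinfun_eqI) (simp add: op_scaleC_apply bounded_opsD)
next
  fix X Y Z :: "'h \<Rightarrow>\<^sub>L 'h"
  show "mul ?S (add ?S X Y) Z = add ?S (mul ?S X Z) (mul ?S Y Z)"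
    unfolding schatten_simps by (rule blinfun_eqI) (simp add: blinfun.add_left)
  show "mul ?S X (add ?S Y Z) = add ?S (mul ?S X Y) (mul ?S X Z)"
    unfolding schatten_simps by (rule blinfun_eqI) (simp add: blinfun.add_left blinfun.add_right)
next
  fix X :: "'h \<Rightarrow>\<^sub>L 'h" and c
  assume X: "X \<in> carr ?S"
  show "scl ?S c X \<in> carr ?S" by (rule schatten_scl[OF X p(1)])
  show "nrm ?S (scl ?S c X) \<le> cmod c * nrm ?S X"
    using schatten_scl(2)[OF X p(1), of c] by simp
  show "0 \<le> nrm ?S X" by (rule schatten_nrm_nonneg)
qed

definition entry :: "(nat \<Rightarrow> 'h::chilbert_space) \<Rightarrow> ('h \<Rightarrow>\<^sub>L 'h) \<Rightarrow> nat \<times> nat \<Rightarrow> complex" where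
  "entry e X k = cinner (e (fst k)) (X (e (snd k)))"

lemma entry_add: "entry e (X + Y) k = entry e X k + entry e Y k"
  by (simp add: entry_def blinfun.add_left cinner_add_right)

lemma entry_scaleC: "entry e (op_scaleC c X) k = c * entry e X k"
  by (simp add: entry_def op_scaleC_apply cinner_scaleC_right)

text \<open>Enlarge \<open>K\<close> to a rectangle; Bessel bounds each column by
  \<open>norm (X (e m))\<close>, and the Hilbert-Schmidt bound sums the columns. The sequence must
  run through \<open>onb\<close>, the basis to which \<open>hs_le\<close> refers.\<close>

lemma entry_sum_sq_le:
  fixes e :: "nat \<Rightarrow> 'h::chilbert_space"
  assumes e: "inj e" "range e \<subseteq> onb" and X: "hs_le X c" and K: "finite K"
  shows "(\<Sum>k\<in>K. (cmod (entry e X k))\<^sup>2) \<le> c"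
proof -
  have "(\<Sum>k\<in>K. (cmod (entry e X k))\<^sup>2) \<le> (\<Sum>k\<in>fst ` K \<times> snd ` K. (cmod (entry e X k))\<^sup>2)"
    by (rule sum_mono2) (use K in \<open>auto intro: rev_image_eqI\<close>)
  also have "\<dots> = (\<Sum>n\<in>fst ` K. \<Sum>m\<in>snd ` K. (cmod (cinner (e n) (X (e m))))\<^sup>2)"
    by (simp add: sum.cartesian_product entry_def split_beta)
  also have "\<dots> = (\<Sum>m\<in>snd ` K. \<Sum>n\<in>fst ` K. (cmod (cinner (e n) (X (e m))))\<^sup>2)"
    by (rule sum.swap)
  also have "\<dots> \<le> (\<Sum>m\<in>snd ` K. (norm (X (e m)))\<^sup>2)"
  proof (rule sum_mono)
    fix m
    have "(\<Sum>n\<in>fst ` K. (cmod (cinner (e n) (X (e m))))\<^sup>2) = (\<Sum>u\<in>e ` fst ` K. (cmod (cinner u (X (e m))))\<^sup>2)"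
      using e(1) by (subst sum.reindex) (auto simp: inj_on_def)
    also have "\<dots> \<le> (norm (X (e m)))\<^sup>2" by (rule bessel_ineq) (use K e(2) in auto)
    finally show "(\<Sum>n\<in>fst ` K. (cmod (cinner (e n) (X (e m))))\<^sup>2) \<le> (norm (X (e m)))\<^sup>2" .
  qed
  also have "\<dots> = (\<Sum>u\<in>e ` snd ` K. (norm (X u))\<^sup>2)"
    using e(1) by (subst sum.reindex) (auto simp: inj_on_def)
  also have "\<dots> \<le> c" by (rule hs_leD[OF X]) (use K e(2) in auto)
  finally show ?thesis .
qed

text \<open>An unconditional sum. On Hilbert-Schmidt pairs the entrywise product is absolutely
  summable over all index pairs, so restriction to the triangle does not affect boundedness.\<close>

definition tri_form ::
  "(nat \<Rightarrow> 'h::chilbert_space) \<Rightarrow> (nat \<Rightarrow> 'k::chilbert_space) \<Rightarrow> ('h \<Rightarrow>\<^sub>L 'h) \<Rightarrow> ('k \<Rightarrow>\<^sub>L 'k) \<Rightarrow> complex" where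
  "tri_form e f X Y = (\<Sum>\<^sub>\<infinity>k\<in>{(n, m). n \<le> m}. entry e X k * entry f Y k)"

context
  fixes e :: "nat \<Rightarrow> 'h::chilbert_space" and f :: "nat \<Rightarrow> 'k::chilbert_space"
  assumes e: "inj e" "range e \<subseteq> onb" and f: "inj f" "range f \<subseteq> onb"
begin

lemma entry_mult_sum_le:
  assumes "0 \<le> a" "hs_le X (a\<^sup>2)" "0 \<le> b" "hs_le Y (b\<^sup>2)" "finite K"
  shows "(\<Sum>k\<in>K. cmod (entry e X k * entry f Y k)) \<le> a * b"
proof -
  have "(\<Sum>k\<in>K. cmod (entry e X k) * cmod (entry f Y k))\<^sup>2
      \<le> (\<Sum>k\<in>K. (cmod (entry e X k))\<^sup>2) * (\<Sum>k\<in>K. (cmod (entry f Y k))\<^sup>2)"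
    by (rule Cauchy_Schwarz_ineq_sum)
  also have "\<dots> \<le> a\<^sup>2 * b\<^sup>2"
    by (intro mult_mono entry_sum_sq_le[OF e assms(2,5)] entry_sum_sq_le[OF f assms(4,5)] sum_nonneg) auto
  finally have "(\<Sum>k\<in>K. cmod (entry e X k * entry f Y k))\<^sup>2 \<le> (a * b)\<^sup>2"
    by (simp add: norm_mult power_mult_distrib)
  thus ?thesis by (rule power2_le_imp_le) (use assms in simp)
qed

lemma entry_mult_abs_summable:
  assumes "0 \<le> a" "hs_le X (a\<^sup>2)" "0 \<le> b" "hs_le Y (b\<^sup>2)"
  shows "(\<lambda>k. cmod (entry e X k * entry f Y k)) summable_on D"
proof (rule nonneg_bdd_above_summable_on)
  show "bdd_above (sum (\<lambda>k. cmod (entry e X k * entry f Y k)) ` {F. F \<subseteq> D \<and> finite F})"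
    by (rule bdd_aboveI2[of _ _ "a * b"]) (use entry_mult_sum_le[OF assms] in blast)
qed simp

lemma entry_mult_summable:
  assumes "hs_le X (a\<^sup>2)" "hs_le Y (b\<^sup>2)"
  shows "(\<lambda>k. entry e X k * entry f Y k) summable_on D"
  \<comment> \<open>Only the squares of \<open>a\<close> and \<open>b\<close> occur in the
    hypotheses, so absolute values supply the signs.\<close>
  by (rule abs_summable_summable, rule entry_mult_abs_summable[of "\<bar>a\<bar>" _ "\<bar>b\<bar>"]) (use assms in simp_all)

lemma tri_form_bound:
  assumes "0 \<le> a" "hs_le X (a\<^sup>2)" "0 \<le> b" "hs_le Y (b\<^sup>2)"
  shows "cmod (tri_form e f X Y) \<le> a * b"
proof -
  note s = entry_mult_abs_summable[OF assms]
  have "cmod (tri_form e f X Y) \<le> (\<Sum>\<^sub>\<infinity>k\<in>{(n, m). n \<le> m}. cmod (entry e X k * entry f Y k))"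
    unfolding tri_form_def by (rule norm_infsum_bound[OF s])
  also have "\<dots> \<le> a * b" by (rule infsum_le_finite_sums[OF s]) (rule entry_mult_sum_le[OF assms])
  finally show ?thesis .
qed

lemma tri_form_add_left:
  assumes "hs_le X (a\<^sup>2)" "hs_le X' (a'\<^sup>2)" "hs_le Y (b\<^sup>2)"
  shows "tri_form e f (X + X') Y = tri_form e f X Y + tri_form e f X' Y"
  unfolding tri_form_def entry_add distrib_right
  by (rule infsum_add[OF entry_mult_summable[OF assms(1,3)] entry_mult_summable[OF assms(2,3)]])

lemma tri_form_add_right:
  assumes "hs_le X (a\<^sup>2)" "hs_le Y (b\<^sup>2)" "hs_le Y' (b'\<^sup>2)"
  shows "tri_form e f X (Y + Y') = tri_form e f X Y + tri_form e f X Y'"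
  unfolding tri_form_def entry_add distrib_left
  by (rule infsum_add[OF entry_mult_summable[OF assms(1,2)] entry_mult_summable[OF assms(1,3)]])

text \<open>Valid for arbitrary operators: if the family is not summable, both sides are 0 by the
  default value of \<open>infsum\<close>.\<close>

lemma tri_form_scaleC:
  "tri_form e f (op_scaleC c X) Y = c * tri_form e f X Y"
  "tri_form e f X (op_scaleC c Y) = c * tri_form e f X Y"
  unfolding tri_form_def entry_scaleC
  by (simp_all add: infsum_cmult_right' mult.assoc mult.left_commute[of _ c])

lemma tri_form_rank_one:
  "tri_form e f (rank_one (e n) (e m)) (rank_one (f n) (f m)) = (if n \<le> m then 1 else 0)"
proof -
  have unit: "cinner (e i) (e j) = (if i = j then 1 else 0)" "cinner (f i) (f j) = (if i = j then 1 else 0)" for i j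
  proof -
    have "e i \<in> onb" "e j \<in> onb" "f i \<in> onb" "f j \<in> onb" using e(2) f(2) by auto
    thus "cinner (e i) (e j) = (if i = j then 1 else 0)" "cinner (f i) (f j) = (if i = j then 1 else 0)"
      by (simp_all add: cinner_onb inj_eq[OF e(1)] inj_eq[OF f(1)])
  qed
  have "tri_form e f (rank_one (e n) (e m)) (rank_one (f n) (f m))
      = (\<Sum>\<^sub>\<infinity>k\<in>{(n, m). n \<le> m}. if k = (n, m) then 1 else 0)"
    unfolding tri_form_def
    \<comment> \<open>Both factors are the same matrix unit, whose one nonzero entry is a 1 at
      position \<open>(n, m)\<close>.\<close>
    by (rule infsum_cong) (auto simp: entry_def rank_one_apply cinner_scaleC_right unit)
  also have "\<dots> = (\<Sum>\<^sub>\<infinity>k\<in>(if n \<le> m then {(n, m)} else {}). 1)"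
    by (rule infsum_cong_neutral) (auto split: if_splits)
  also have "\<dots> = (if n \<le> m then 1 else 0)" by simp
  finally show ?thesis .
qed

end

lemma onb_sequence:
  assumes "infinite_dimensional TYPE('h::chilbert_space)"
  shows "\<exists>e :: nat \<Rightarrow> 'h. inj e \<and> range e \<subseteq> onb"
  using infinite_countable_subset[OF infinite_onb[OF assms]] by blast

theorem corollary4p2:
  fixes p q :: real
  assumes "infinite_dimensional TYPE('h1::chilbert_space)"
    and "infinite_dimensional TYPE('h2::chilbert_space)"
    and "1 \<le> p" "p \<le> 2"
    and "1 \<le> q" "q \<le> 2"
  shows "\<not> arens_regular
    ((schatten p :: ('h1 \<Rightarrow>\<^sub>L 'h1) nalgebra) \<otimes>\<^sub>\<gamma> (schatten q :: ('h2 \<Rightarrow>\<^sub>L 'h2) nalgebra))"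
proof -
  obtain e :: "nat \<Rightarrow> 'h1" where e: "inj e" "range e \<subseteq> onb" using onb_sequence[OF assms(1)] by blast
  obtain f :: "nat \<Rightarrow> 'h2" where f: "inj f" "range f \<subseteq> onb" using onb_sequence[OF assms(2)] by blast
  have unit: "norm (e n) = 1" "norm (f n) = 1" for n
    using e(2) f(2) by (auto intro!: norm_onb)
  note hs = hs_le_schatten[OF _ assms(3,4)] hs_le_schatten[OF _ assms(5,6)]
  interpret A: carrier_algebra "schatten p :: ('h1 \<Rightarrow>\<^sub>L 'h1) nalgebra"
    by (rule schatten_carrier_algebra[OF assms(3,4)])
  interpret B: carrier_algebra "schatten q :: ('h2 \<Rightarrow>\<^sub>L 'h2) nalgebra"
    by (rule schatten_carrier_algebra[OF assms(5,6)])
  interpret tensor_form "schatten p :: ('h1 \<Rightarrow>\<^sub>L 'h1) nalgebra" "schatten q :: ('h2 \<Rightarrow>\<^sub>L 'h2) nalgebra"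
    "tri_form e f"
  proof unfold_locales
    fix X X' :: "'h1 \<Rightarrow>\<^sub>L 'h1" and Y :: "'h2 \<Rightarrow>\<^sub>L 'h2"
    assume c: "X \<in> carr (schatten p)" "X' \<in> carr (schatten p)" "Y \<in> carr (schatten q)"
    show "tri_form e f (add (schatten p) X X') Y = tri_form e f X Y + tri_form e f X' Y"
      unfolding schatten_simps by (rule tri_form_add_left[OF e f hs(1)[OF c(1)] hs(1)[OF c(2)] hs(2)[OF c(3)]])
  next
    fix X :: "'h1 \<Rightarrow>\<^sub>L 'h1" and Y Y' :: "'h2 \<Rightarrow>\<^sub>L 'h2"
    assume c: "X \<in> carr (schatten p)" "Y \<in> carr (schatten q)" "Y' \<in> carr (schatten q)"
    show "tri_form e f X (add (schatten q) Y Y') = tri_form e f X Y + tri_form e f X Y'"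
      unfolding schatten_simps by (rule tri_form_add_right[OF e f hs(1)[OF c(1)] hs(2)[OF c(2)] hs(2)[OF c(3)]])
  next
    fix X :: "'h1 \<Rightarrow>\<^sub>L 'h1" and Y :: "'h2 \<Rightarrow>\<^sub>L 'h2" and c
    assume XY: "X \<in> carr (schatten p)" "Y \<in> carr (schatten q)"
    show "tri_form e f (scl (schatten p) c X) Y = c * tri_form e f X Y"
      "tri_form e f X (scl (schatten q) c Y) = c * tri_form e f X Y"
      unfolding schatten_simps by (rule tri_form_scaleC[OF e f])+
    show "cmod (tri_form e f X Y) \<le> nrm (schatten p) X * nrm (schatten q) Y"
      by (rule tri_form_bound[OF e f schatten_nrm_nonneg hs(1)[OF XY(1)] schatten_nrm_nonneg hs(2)[OF XY(2)]])
  qed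
  show ?thesis
  proof (rule proj_tensor_not_arens_regular[where a = "\<lambda>n. rank_one (e n) (e 0)" and b = "\<lambda>m. rank_one (e 0) (e m)"
        and a' = "\<lambda>n. rank_one (f n) (f 0)" and b' = "\<lambda>m. rank_one (f 0) (f m)"])
    have scaleC1: "op_scaleC 1 T = T" for T :: "'z::chilbert_space \<Rightarrow>\<^sub>L 'z"
      by (rule blinfun_eqI) (simp add: op_scaleC_apply)
    show "tri_form e f (mul (schatten p) (rank_one (e n) (e 0)) (rank_one (e 0) (e m)))
        (mul (schatten q) (rank_one (f n) (f 0)) (rank_one (f 0) (f m))) = (if n \<le> m then 1 else 0)" for n m
      \<comment> \<open>Composing through the common index 0 produces the scalar
        \<open>cinner (e 0) (e 0) = 1\<close>, and likewise for \<open>f\<close>, in front of the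
        matrix unit at \<open>(n, m)\<close>.\<close>
      unfolding schatten_simps rank_one_compose cinner_self unit
      by (simp add: tri_form_rank_one[OF e f] tri_form_scaleC[OF e f])
  qed (intro rank_one_schatten unit assms(3,5))+
qed

end
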